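(* Let $Q\in C^1([0,1]\times[0,1])$ and let $K\in L_2(\Omega\times\Omega)$ be the (solution) kernel of Problem B. Then the integral operator $$\mathbb{L}^{-1}f(x,y)=\iint_\Omega K(x,y,x_1,y_1)f(x_1,y_1)\,dx_1\,dy_1$$ has the Volterra property in $L_2(\Omega)$, i.e. it is a completely continuous (compact) and quasi-nilpotent operator on $L_2(\Omega)$, the latter meaning $$\lim_{n\to\infty}\|\mathbb{L}^{-n}\|_0^{1/n}=0,$$ where $\mathbb{L}^{-n}=\mathbb{L}^{-1}\big[\mathbb{L}^{-(n-1)}\big]$, $n=1,2,3,\ldots$, is the $n$-th power of $\mathbb{L}^{-1}$ and $\|\cdot\|_0$ is the operator norm on $L_2(\Omega)$.
   Context: Domain. Let $1/2<l<1$ and let $\gamma\in C^1[0,l]$ be such that $\gamma(0)=0$, $l+\gamma(l)=1$, the curve $AC: y=-\gamma(x)$, $0<x<l$, is a monotone smooth curve lying in $y<0$, and $x+\gamma(x)$ is monotonically increasing. Put $A=(0,0)$, $B=(1,0)$, $A_0=(0,1)$, $B_0=(1,1)$, $C=(l,-\gamma(l))$. $\Omega\subset\mathbb{R}^2$ is the domain bounded for $y>0$ by the segments $AA_0$, $A_0B_0$, $BB_0$ of the straight lines $x=0$, $y=1$, $x=1$, and for $y<0$ by the curve $AC$ and by the segment $BC: x-y=1$, $l\le x<1$. $AB$ is the segment $y=0$, $0<x<1$. $\Omega_0=\Omega\cap\{y>0\}$ (parabolic part), $\Omega_1=\Omega\cap\{y<0\}$ (hyperbolic part). Operator. $Lu=u_x-u_{yy}$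 for $y>0$ and $Lu=u_{xx}-u_{yy}$ for $y<0$. Problem B. Given $f$, a function $Q$ on $[0,1]\times[0,1]$ and real constants $\alpha,\beta$ with $\alpha^2+\beta^2>0$, find a solution of $Lu=f(x,y)$ satisfying the boundary conditions $u|_{AA_0\cup A_0B_0}=0$, $(u_x-u_y)|_{AC}=0$, and the gluing conditions, for $0<x<1$, $$u_x(x,+0)=u_x(x,-0),\qquad u_y(x,+0)=\alpha\,u_y(x,-0)+\beta\int_0^x u_y(t,-0)Q(x,t)\,dt.$$ Regular solution. A regular solution of Problem B is a function $$u\in C(\overline{\Omega})\cap C^1(\Omega_0\cup AB)\cap C^1(\Omega_1\cup AC\cup AB)\cap C^{1,2}(\Omega_0)\cap C^{2,2}(\Omega_1)$$ that satisfies $Lu=f$ in $\Omega_0$ and in $\Omega_1$, the boundary conditions and the gluing conditions. Here the superscripts $i,j$ in $C^{i,j}$ denote the order of continuous differentiability in $x$ and in $y$ respectively. Kernel. $K\in L_2(\Omega\times\Omega)$ denotes the kernel, independent of $f$, for which the unique regular solution of Problem B with any right-hand side $f\in C^1(\overline{\Omega})$ is $u(x,y)=\iint_\Omega K(x,y,x_1,y_1)f(x_1,y_1)\,dx_1dy_1$; this property determines $K$ up to a null set. The notation $\mathbb{L}^{-1}$ is used because this operator is the inverse of $\mathbb{L}$, the closure in $L_2(\Omega)$ of $L$ defined on the set $W$ of all regular solutions of Problem B (for varying right-hand sides $f=Lu$, with $L$ regarded as an operator from $W$ into $L_2(\Omega)$). *)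

theory Defs
  imports "HOL-Analysis.Analysis"
begin

section \<open>Square-integrable functions and operators on them\<close>

text \<open>Elements of \<open>L\<^sub>2\<close> are represented by functions; equality is equality almost everywhere.\<close>

definition L2_space :: "'a measure \<Rightarrow> ('a \<Rightarrow> real) set" where
  "L2_space M = {f \<in> borel_measurable M. integrable M (\<lambda>x. (f x)\<^sup>2)}"

definition L2_nrm :: "'a measure \<Rightarrow> ('a \<Rightarrow> real) \<Rightarrow> real" where
  "L2_nrm M f = sqrt (LINT x|M. (f x)\<^sup>2)"

definition L2_linear :: "'a measure \<Rightarrow> (('a \<Rightarrow> real) \<Rightarrow> 'a \<Rightarrow> real) \<Rightarrow> bool" where
  "L2_linear M T \<longleftrightarrow>
     (\<forall>f\<in>L2_space M. T f \<in> L2_space M) \<and>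
     (\<forall>f\<in>L2_space M. \<forall>g\<in>L2_space M. (AE x in M. f x = g x) \<longrightarrow> (AE x in M. T f x = T g x)) \<and>
     (\<forall>f\<in>L2_space M. \<forall>g\<in>L2_space M. \<forall>a b.
        AE x in M. T (\<lambda>z. a * f z + b * g z) x = a * T f x + b * T g x)"

definition L2_compact :: "'a measure \<Rightarrow> (('a \<Rightarrow> real) \<Rightarrow> 'a \<Rightarrow> real) \<Rightarrow> bool" where
  "L2_compact M T \<longleftrightarrow>
     L2_linear M T \<and>
     (\<forall>F :: nat \<Rightarrow> 'a \<Rightarrow> real.
        (\<forall>n. F n \<in> L2_space M) \<and> (\<exists>C. \<forall>n. L2_nrm M (F n) \<le> C) \<longrightarrow>
        (\<exists>r g. strict_mono r \<and> g \<in> L2_space M \<and>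
           (\<lambda>n. L2_nrm M (\<lambda>x. T (F (r n)) x - g x)) \<longlonglongrightarrow> 0))"

text \<open>The counterpart of \<^const>\<open>onorm\<close>. As there, the supremum is only meaningful for bounded
  operators; every \<^const>\<open>L2_compact\<close> operator, and hence each of its powers, is bounded.\<close>

definition L2_onorm :: "'a measure \<Rightarrow> (('a \<Rightarrow> real) \<Rightarrow> 'a \<Rightarrow> real) \<Rightarrow> real" where
  "L2_onorm M T = (SUP f\<in>L2_space M. L2_nrm M (T f) / L2_nrm M f)"

definition L2_quasinilpotent :: "'a measure \<Rightarrow> (('a \<Rightarrow> real) \<Rightarrow> 'a \<Rightarrow> real) \<Rightarrow> bool" where
  "L2_quasinilpotent M T \<longleftrightarrow> (\<lambda>n. root n (L2_onorm M (T ^^ n))) \<longlonglongrightarrow> 0"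

definition L2_volterra :: "'a measure \<Rightarrow> (('a \<Rightarrow> real) \<Rightarrow> 'a \<Rightarrow> real) \<Rightarrow> bool" where
  "L2_volterra M T \<longleftrightarrow> L2_compact M T \<and> L2_quasinilpotent M T"

definition kernel_operator ::
    "'a :: euclidean_space set \<Rightarrow> ('a \<times> 'a \<Rightarrow> real) \<Rightarrow> ('a \<Rightarrow> real) \<Rightarrow> 'a \<Rightarrow> real" where
  "kernel_operator D K f = (\<lambda>p. LINT q|lebesgue_on D. K (p, q) * f q)"


section \<open>Partial derivatives and smoothness classes in the plane\<close>

definition ddx :: "(real \<times> real \<Rightarrow> real) \<Rightarrow> real \<times> real \<Rightarrow> real" where
  "ddx u = (\<lambda>(x, y). deriv (\<lambda>t. u (t, y)) x)"

definition ddy :: "(real \<times> real \<Rightarrow> real) \<Rightarrow> real \<times> real \<Rightarrow> real" where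
  "ddy u = (\<lambda>(x, y). deriv (\<lambda>t. u (x, t)) y)"

text \<open>\<open>C\<^sup>i\<^sup>,\<^sup>j(D)\<close> for open \<open>D\<close>: the pure derivatives up to order \<open>i\<close> in \<open>x\<close> and up to order \<open>j\<close>
  in \<open>y\<close> exist and are continuous.\<close>

definition C_class :: "nat \<Rightarrow> nat \<Rightarrow> (real \<times> real) set \<Rightarrow> (real \<times> real \<Rightarrow> real) \<Rightarrow> bool" where
  "C_class i j D u \<longleftrightarrow>
     (\<forall>m\<le>i. continuous_on D ((ddx ^^ m) u)) \<and>
     (\<forall>m\<le>j. continuous_on D ((ddy ^^ m) u)) \<and>
     (\<forall>m<i. \<forall>(x, y)\<in>D. (\<lambda>t. (ddx ^^ m) u (t, y)) differentiable (at x)) \<and>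
     (\<forall>m<j. \<forall>(x, y)\<in>D. (\<lambda>t. (ddy ^^ m) u (x, t)) differentiable (at y))"

text \<open>\<open>C\<^sup>1(S)\<close> for a set \<open>S\<close> consisting of an open set \<open>D\<close> and part of its boundary: on \<open>S\<close> the
  function is continuous, and its first derivatives on \<open>D\<close> extend continuously to \<open>S\<close>.\<close>

definition C1_upto :: "(real \<times> real) set \<Rightarrow> (real \<times> real) set \<Rightarrow> (real \<times> real \<Rightarrow> real) \<Rightarrow> bool" where
  "C1_upto D S u \<longleftrightarrow>
     C_class 1 1 D u \<and> continuous_on S u \<and>
     (\<exists>p. continuous_on S p \<and> (\<forall>z\<in>D. p z = ddx u z)) \<and>
     (\<exists>q. continuous_on S q \<and> (\<forall>z\<in>D. q z = ddy u z))"

text \<open>Boundary value at \<open>z\<close> of a function given on \<open>D\<close>.\<close>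

definition boundary_value :: "(real \<times> real) set \<Rightarrow> (real \<times> real \<Rightarrow> real) \<Rightarrow> real \<times> real \<Rightarrow> real" where
  "boundary_value D g z = Lim (at z within D) g"


section \<open>The domain\<close>

definition admissible_curve :: "real \<Rightarrow> (real \<Rightarrow> real) \<Rightarrow> bool" where
  "admissible_curve l \<gamma> \<longleftrightarrow>
     1 / 2 < l \<and> l < 1 \<and>
     (\<exists>\<gamma>'. continuous_on {0..l} \<gamma>' \<and>
        (\<forall>x\<in>{0..l}. (\<gamma> has_real_derivative \<gamma>' x) (at x within {0..l}))) \<and>
     \<gamma> 0 = 0 \<and> l + \<gamma> l = 1 \<and>
     (\<forall>x\<in>{0<..<l}. \<gamma> x > 0) \<and>
     mono_on {0..l} \<gamma> \<and>
     strict_mono_on {0..l} (\<lambda>x. x + \<gamma> x)"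

definition segment_AB :: "(real \<times> real) set" where
  "segment_AB = {(x, y). 0 < x \<and> x < 1 \<and> y = 0}"

definition curve_AC :: "real \<Rightarrow> (real \<Rightarrow> real) \<Rightarrow> (real \<times> real) set" where
  "curve_AC l \<gamma> = {(x, y). 0 < x \<and> x < l \<and> y = - \<gamma> x}"

definition Omega0 :: "(real \<times> real) set" where
  "Omega0 = {(x, y). 0 < x \<and> x < 1 \<and> 0 < y \<and> y < 1}"

definition Omega1 :: "real \<Rightarrow> (real \<Rightarrow> real) \<Rightarrow> (real \<times> real) set" where
  "Omega1 l \<gamma> = {(x, y). 0 < x \<and> x < 1 \<and> y < 0 \<and> (if x \<le> l then - \<gamma> x < y else x - 1 < y)}"

definition Omega :: "real \<Rightarrow> (real \<Rightarrow> real) \<Rightarrow> (real \<times> real) set" where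
  "Omega l \<gamma> = Omega0 \<union> segment_AB \<union> Omega1 l \<gamma>"


section \<open>Problem B and its solution kernel\<close>

text \<open>The integral in the second gluing condition is required to exist. It is taken in the
  Henstock--Kurzweil sense, which covers improper integrals at \<open>0\<close>, since \<open>u\<^sub>y(t, -0)\<close> need not
  be bounded near \<open>t = 0\<close>.\<close>

definition regular_solution ::
    "real \<Rightarrow> (real \<Rightarrow> real) \<Rightarrow> real \<Rightarrow> real \<Rightarrow> (real \<times> real \<Rightarrow> real) \<Rightarrow>
     (real \<times> real \<Rightarrow> real) \<Rightarrow> (real \<times> real \<Rightarrow> real) \<Rightarrow> bool" where
  "regular_solution l \<gamma> \<alpha> \<beta> Q f u \<longleftrightarrow>
     continuous_on (closure (Omega l \<gamma>)) u \<and>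
     C1_upto Omega0 (Omega0 \<union> segment_AB) u \<and>
     C1_upto (Omega1 l \<gamma>) (Omega1 l \<gamma> \<union> curve_AC l \<gamma> \<union> segment_AB) u \<and>
     C_class 1 2 Omega0 u \<and>
     C_class 2 2 (Omega1 l \<gamma>) u \<and>
     (\<forall>z\<in>Omega0. ddx u z - ddy (ddy u) z = f z) \<and>
     (\<forall>z\<in>Omega1 l \<gamma>. ddx (ddx u) z - ddy (ddy u) z = f z) \<and>
     (\<forall>y\<in>{0..1}. u (0, y) = 0) \<and>
     (\<forall>x\<in>{0..1}. u (x, 1) = 0) \<and>
     (\<forall>z\<in>curve_AC l \<gamma>.
        boundary_value (Omega1 l \<gamma>) (ddx u) z - boundary_value (Omega1 l \<gamma>) (ddy u) z = 0) \<and>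
     (\<forall>x\<in>{0<..<1}.
        boundary_value Omega0 (ddx u) (x, 0) = boundary_value (Omega1 l \<gamma>) (ddx u) (x, 0) \<and>
        (\<lambda>t. boundary_value (Omega1 l \<gamma>) (ddy u) (t, 0) * Q (x, t)) integrable_on {0..x} \<and>
        boundary_value Omega0 (ddy u) (x, 0) =
          \<alpha> * boundary_value (Omega1 l \<gamma>) (ddy u) (x, 0) +
          \<beta> * integral {0..x} (\<lambda>t. boundary_value (Omega1 l \<gamma>) (ddy u) (t, 0) * Q (x, t)))"

text \<open>A kernel of class \<open>L\<^sub>2\<close> is determined only up to a null set, so it represents the solution
  almost everywhere. Uniqueness of the solution is uniqueness as a function on the closed domain.\<close>

definition solution_kernel ::
    "real \<Rightarrow> (real \<Rightarrow> real) \<Rightarrow> real \<Rightarrow> real \<Rightarrow> (real \<times> real \<Rightarrow> real) \<Rightarrow>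
     ((real \<times> real) \<times> (real \<times> real) \<Rightarrow> real) \<Rightarrow> bool" where
  "solution_kernel l \<gamma> \<alpha> \<beta> Q K \<longleftrightarrow>
     K \<in> L2_space (lebesgue_on (Omega l \<gamma> \<times> Omega l \<gamma>)) \<and>
     (\<forall>f. C1_upto (Omega l \<gamma>) (closure (Omega l \<gamma>)) f \<longrightarrow>
        (\<exists>u. regular_solution l \<gamma> \<alpha> \<beta> Q f u \<and>
           (\<forall>v. regular_solution l \<gamma> \<alpha> \<beta> Q f v \<longrightarrow> (\<forall>z\<in>closure (Omega l \<gamma>). v z = u z)) \<and>
           (AE z in lebesgue_on (Omega l \<gamma>). u z = kernel_operator (Omega l \<gamma>) K f z)))"

end

theory Submission
  imports Defs "HOL-Library.Diagonal_Subsequence"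
begin

text \<open>
  Let \<open>\<phi>(x, y) = x\<close> for \<open>y \<ge> 0\<close> and \<open>\<phi>(x, y) = x - y\<close> for \<open>y < 0\<close>. Problem B is causal with respect
  to \<open>\<phi>\<close>: if \<open>f\<close> vanishes where \<open>\<phi> < s\<close>, then so does the solution \<open>u\<close>. Indeed \<open>u\<^sub>x - u\<^sub>y\<close> is then
  constant along the characteristics \<open>x - y = const < s\<close>, hence zero because it vanishes on \<open>AC\<close>;
  so \<open>u\<^sub>y(x, -0) = u\<^sub>x(x, 0)\<close>, the trace \<open>\<tau>(x) = u(x, 0)\<close> satisfies
  \<open>u\<^sub>y(x, +0) = \<alpha> \<tau>'(x) + \<beta> \<integral> \<tau>'(t) Q(x, t) dt\<close>, and energy estimates for the heat equation give
  \<open>u = 0\<close> for \<open>y \<ge> 0\<close>. That \<open>u = 0\<close> also follows for \<open>y < 0\<close> needs every characteristic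
  \<open>x + y = const\<close> to reach \<open>AB\<close> inside \<open>\<Omega>\<close>, i.e. \<open>x - \<gamma>(x)\<close> to be nondecreasing; otherwise the
  homogeneous problem has a nonzero solution, so this follows from the existence of \<open>K\<close>.

  By causality \<open>K(p, q) = 0\<close> for almost all \<open>(p, q)\<close> with \<open>\<phi>(p) < \<phi>(q)\<close>. The operator is
  Hilbert--Schmidt, hence compact, and conjugating it with \<open>e\<^sup>-\<^sup>j\<^sup>\<phi>\<close> turns the kernel into
  \<open>K(p, q) e\<^sup>-\<^sup>j\<^sup>(\<^sup>\<phi>\<^sup>(\<^sup>p\<^sup>)\<^sup>-\<^sup>\<phi>\<^sup>(\<^sup>q\<^sup>)\<^sup>)\<close>, whose \<open>L\<^sub>2\<close> norm tends to \<open>0\<close> as \<open>j \<rightarrow> \<infinity>\<close> by dominated convergence. As \<open>0 \<le> \<phi> \<le> 1\<close> on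
  \<open>\<Omega>\<close>, the conjugation distorts norms of powers only by a factor \<open>e\<^sup>j\<close>, and the spectral radius is
  zero.
\<close>

section \<open>Uniqueness for the heat equation with a memory condition on the boundary\<close>

text \<open>The regularity classes grant little. First derivatives extend continuously to the open
  segment AB and to AC, but not necessarily to the corners or to the side x = 0; mixed derivatives
  need not exist; and u_y(t, -0) may be unbounded as t tends to 0. Identities are therefore proved
  away from the boundary and carried there by continuity, and the memory integral is integrated by
  parts so that only the continuous trace \<tau> enters it; this is where the smoothness of
  \<open>Q\<close> is used.

  The second obstacle is that \<open>K\<close> is tested only against right-hand sides of class C^1,
  and for each of them only up to a null set that depends on it. Its vanishing is extracted from
  countably many test functions, which approximate indicators of rational boxes intersected with
  sets \<phi> > s.

  The conjugated kernel decays only where \<phi>(p) > \<phi>(q), so it matters that the level sets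
  of \<phi> are null. The parameter j is fixed before the power n grows, and the n-th root then
  removes the factor e^j.\<close>

lemma gronwall_zero:
  fixes E :: "real \<Rightarrow> real"
  assumes "0 \<le> b" and E0: "E 0 = 0" and nonneg: "\<And>x. x \<in> {0..b} \<Longrightarrow> 0 \<le> E x"
    and deriv: "\<And>x. x \<in> {0..b} \<Longrightarrow> (E has_real_derivative E' x) (at x within {0..b})"
    and le: "\<And>x. x \<in> {0..b} \<Longrightarrow> E' x \<le> C * E x"
    and x: "x \<in> {0..b}"
  shows "E x = 0"
proof -
  have "exp (- C * 0) * E 0 \<ge> exp (- C * x) * E x"
  proof (rule DERIV_nonpos_imp_decreasing_open[where f="\<lambda>x. exp (- C * x) * E x"])
    show "\<exists>d. DERIV (\<lambda>x. exp (- C * x) * E x) y :> d \<and> d \<le> 0" if "0 < y" "y < x" for y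
    proof (intro exI conjI)
      have "(E has_real_derivative E' y) (at y)"
        using deriv[of y] that x at_within_Icc_at[of 0 y b] by auto
      then show "DERIV (\<lambda>x. exp (- C * x) * E x) y :> exp (- C * y) * (E' y - C * E y)"
        by (auto intro!: derivative_eq_intros simp: algebra_simps)
      show "exp (- C * y) * (E' y - C * E y) \<le> 0"
        using le[of y] that x by (simp add: mult_le_0_iff)
    qed
    have "continuous_on {0..b} E"
      using deriv by (meson DERIV_continuous continuous_on_eq_continuous_within)
    then show "continuous_on {0..x} (\<lambda>x. exp (- C * x) * E x)"
      using x by (auto intro!: continuous_intros elim: continuous_on_subset)
  qed (use x in auto)
  then show ?thesis
    using nonneg[OF x] E0 by (simp add: mult_le_0_iff)
qed

text \<open>Cauchy-Schwarz against the constant 1, read off from the nonnegativity of the integral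
  of (f - m)^2, where \<open>m\<close> is the mean of \<open>f\<close>.\<close>

lemma integral_square_le:
  fixes f :: "real \<Rightarrow> real"
  assumes "0 \<le> x" "continuous_on {0..x} f"
  shows "(integral {0..x} f)\<^sup>2 \<le> x * integral {0..x} (\<lambda>t. (f t)\<^sup>2)"
proof (cases "x = 0")
  case False
  then have x: "x > 0" using assms by simp
  define m where "m = integral {0..x} f / x"
  have i: "f integrable_on {0..x}" "(\<lambda>t. (f t)\<^sup>2) integrable_on {0..x}"
    by (intro integrable_continuous_real continuous_intros assms)+
  have "0 \<le> integral {0..x} (\<lambda>t. (f t - m)\<^sup>2)"
    by (rule integral_nonneg) (auto intro!: integrable_continuous_real continuous_intros assms)
  also have "(\<lambda>t. (f t - m)\<^sup>2) = (\<lambda>t. ((f t)\<^sup>2 - (2 * m) * f t) + m\<^sup>2)"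
    by (auto simp: power2_eq_square algebra_simps)
  also have "integral {0..x} \<dots> = integral {0..x} (\<lambda>t. (f t)\<^sup>2) - 2 * m * integral {0..x} f + m\<^sup>2 * x"
    using i x by (subst integral_add) (auto simp: integral_diff integrable_diff integrable_on_mult_right)
  finally show ?thesis
    using x by (simp add: m_def field_simps power2_eq_square)
qed auto

text \<open>Separate continuity becomes joint continuity because the Lipschitz bound in the first
  variable is uniform in the second: \<open>f (a n) (d n)\<close> differs from
  \<open>f x (d n)\<close> by at most \<open>M * \<bar>a n - x\<bar>\<close>.\<close>

lemma continuous_on_Times_lipschitz:
  fixes f :: "real \<Rightarrow> real \<Rightarrow> real"
  assumes c: "\<And>x. x \<in> A \<Longrightarrow> continuous_on B (f x)"
    and M: "\<And>x x' y. x \<in> A \<Longrightarrow> x' \<in> A \<Longrightarrow> y \<in> B \<Longrightarrow> \<bar>f x' y - f x y\<bar> \<le> M * \<bar>x' - x\<bar>"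
  shows "continuous_on (A \<times> B) (\<lambda>(x, y). f x y)"
proof (clarsimp simp: continuous_on_sequentially)
  fix X x y assume X: "\<forall>n. X n \<in> A \<times> B" and lim: "X \<longlonglongrightarrow> (x, y)" and xA: "x \<in> A" and yB: "y \<in> B"
  define a where "a = (\<lambda>n. fst (X n))"
  define d where "d = (\<lambda>n. snd (X n))"
  have la: "a \<longlonglongrightarrow> x" and ld: "d \<longlonglongrightarrow> y"
    using tendsto_fst[OF lim] tendsto_snd[OF lim] by (auto simp: a_def d_def)
  have aA: "a n \<in> A" and dB: "d n \<in> B" for n using X by (auto simp: a_def d_def mem_Times_iff)
  have 1: "(\<lambda>n. f x (d n)) \<longlonglongrightarrow> f x y"
    using c[OF xA] ld dB yB by (auto simp: continuous_on_sequentially o_def)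
  have 2: "(\<lambda>n. f (a n) (d n) - f x (d n)) \<longlonglongrightarrow> 0"
  proof (rule Lim_null_comparison)
    show "\<forall>\<^sub>F n in sequentially. norm (f (a n) (d n) - f x (d n)) \<le> M * \<bar>a n - x\<bar>"
      using M[OF xA aA dB] by auto
    show "(\<lambda>n. M * \<bar>a n - x\<bar>) \<longlonglongrightarrow> 0"
      using la by (auto intro!: tendsto_eq_intros)
  qed
  have "(\<lambda>n. f (a n) (d n)) \<longlonglongrightarrow> f x y"
    using tendsto_add[OF 1 2] by simp
  then show "((\<lambda>(x, y). f x y) \<circ> X) \<longlonglongrightarrow> f x y"
    by (simp add: o_def a_def d_def case_prod_beta)
qed

text \<open>\<open>u\<close> solves the heat equation, \<open>v\<close> is its time integral and \<open>W = v\<^sub>y\<close>; \<open>v_eq\<close> is the heat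
  equation together with the condition \<open>u\<^sub>y(x, 0) = \<alpha> \<tau>'(x) + S'(x)\<close> for \<open>\<tau>(x) = u(x, 0)\<close>, integrated
  in time. Working with \<open>v\<close> avoids \<open>u\<^sub>y\<close>, which need not extend to all of the boundary.\<close>

locale heat_trace =
  fixes b :: real and u :: "real \<Rightarrow> real \<Rightarrow> real" and \<alpha> :: real and S :: "real \<Rightarrow> real"
    and W :: "real \<Rightarrow> real \<Rightarrow> real" and v :: "real \<Rightarrow> real \<Rightarrow> real"
  assumes b: "0 < b" "b \<le> 1"
    and cont: "continuous_on ({0..b} \<times> {0..1}) (\<lambda>(x, y). u x y)"
    and top: "\<And>x. x \<in> {0..b} \<Longrightarrow> u x 1 = 0"
    and init: "\<And>y. y \<in> {0..1} \<Longrightarrow> u 0 y = 0"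
    and contS: "continuous_on {0..b} S" and S0: "S 0 = 0"
    and W_def: "\<And>x y. W x y = \<alpha> * u x 0 + S x + integral {0..y} (u x)"
    and v_def: "\<And>x y. v x y = integral {0..x} (\<lambda>t. u t y)"
    and v_eq: "\<And>x y. x \<in> {0..b} \<Longrightarrow> y \<in> {0..1} \<Longrightarrow> v x y = v x 0 + integral {0..y} (W x)"
begin

lemma cont_x: "x \<in> {0..b} \<Longrightarrow> continuous_on {0..1} (u x)"
  by (rule continuous_on_compose2[OF cont, of _ "\<lambda>y. (x, y)", simplified])
     (auto intro!: continuous_intros)

lemma cont_y: "y \<in> {0..1} \<Longrightarrow> continuous_on {0..b} (\<lambda>x. u x y)"
  by (rule continuous_on_compose2[OF cont, of _ "\<lambda>x. (x, y)", simplified])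
     (auto intro!: continuous_intros)

lemma u_bound: "\<exists>M\<ge>0. \<forall>x\<in>{0..b}. \<forall>y\<in>{0..1}. \<bar>u x y\<bar> \<le> M"
proof -
  have "compact ((\<lambda>(x, y). u x y) ` ({0..b} \<times> {0..1}))"
    by (intro compact_continuous_image cont compact_Times compact_Icc)
  then obtain M where M: "\<forall>z \<in> (\<lambda>(x, y). u x y) ` ({0..b} \<times> {0..1}). norm z \<le> M"
    using compact_imp_bounded bounded_iff by metis
  then have "\<bar>u x y\<bar> \<le> max M 0" if "x \<in> {0..b}" "y \<in> {0..1}" for x y
  proof -
    have "u x y \<in> (\<lambda>(x, y). u x y) ` ({0..b} \<times> {0..1})"
      using that by (intro image_eqI[of _ _ "(x, y)"]) auto
    with M have "norm (u x y) \<le> M" by (rule bspec)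
    then show ?thesis by simp
  qed
  then show ?thesis by (intro exI[of _ "max M 0"]) auto
qed

lemma W_deriv: "x \<in> {0..b} \<Longrightarrow> y \<in> {0..1} \<Longrightarrow> ((W x) has_real_derivative u x y) (at y within {0..1})"
  unfolding W_def by (auto intro!: derivative_eq_intros integral_has_real_derivative cont_x)

lemma cont_W: "x \<in> {0..b} \<Longrightarrow> continuous_on {0..1} (W x)"
  using W_deriv by (meson DERIV_continuous continuous_on_eq_continuous_within)

text \<open>As a time integral of a merely continuous function, \<open>v\<close> shows no regularity
  in \<open>y\<close> by itself; the derivative comes from \<open>v_eq\<close>, which makes
  \<open>v x\<close> a primitive of \<open>W x\<close>.\<close>

lemma v_deriv_y:
  assumes "x \<in> {0..b}" "y \<in> {0..1}" shows "((v x) has_real_derivative W x y) (at y within {0..1})"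
proof (rule has_field_derivative_transform_within[where d=1 and f="\<lambda>y. v x 0 + integral {0..y} (W x)"])
  show "((\<lambda>y. v x 0 + integral {0..y} (W x)) has_real_derivative W x y) (at y within {0..1})"
    using assms by (auto intro!: derivative_eq_intros integral_has_real_derivative cont_W)
  show "v x 0 + integral {0..y} (W x) = v x y" if "y \<in> {0..1}" for y
    using assms(1) that by (rule v_eq[symmetric])
qed (use assms in auto)

lemma cont_v_y: "x \<in> {0..b} \<Longrightarrow> continuous_on {0..1} (v x)"
  using v_deriv_y by (meson DERIV_continuous continuous_on_eq_continuous_within)

lemma v_deriv_x:
  "x \<in> {0..b} \<Longrightarrow> y \<in> {0..1} \<Longrightarrow> ((\<lambda>x. v x y) has_real_derivative u x y) (at x within {0..b})"
  unfolding v_def by (intro integral_has_real_derivative cont_y)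

lemma v_top: "x \<in> {0..b} \<Longrightarrow> v x 1 = 0"
  unfolding v_def using top by (intro integral_unique) (rule has_integral_is_0, auto)

lemma W_init: "y \<in> {0..1} \<Longrightarrow> W 0 y = 0"
  unfolding W_def using init S0 
  by simp (intro integral_unique has_integral_is_0, auto)

lemma v_lipschitz:
  assumes M: "\<And>x y. x \<in> {0..b} \<Longrightarrow> y \<in> {0..1} \<Longrightarrow> \<bar>u x y\<bar> \<le> M"
    and "x \<in> {0..b}" "x' \<in> {0..b}" "y \<in> {0..1}"
  shows "\<bar>v x' y - v x y\<bar> \<le> M * \<bar>x' - x\<bar>"
  using field_differentiable_bound[of "{0..b}" "\<lambda>x. v x y" "\<lambda>x. u x y" M x' x] v_deriv_x assms
  by (auto simp: norm_minus_commute)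

lemma cont_v: "continuous_on ({0..b} \<times> {0..1}) (\<lambda>(x, y). v x y)"
proof -
  obtain M where M: "0 \<le> M" "\<And>x y. x \<in> {0..b} \<Longrightarrow> y \<in> {0..1} \<Longrightarrow> \<bar>u x y\<bar> \<le> M" using u_bound by blast
  show ?thesis
  proof (rule continuous_on_Times_lipschitz[where M=M])
  qed (use cont_v_y v_lipschitz M in auto)
qed

lemma by_parts:
  assumes f: "\<And>y. y \<in> {0..1} \<Longrightarrow> (f has_real_derivative f' y) (at y within {0..1::real})"
    and g: "\<And>y. y \<in> {0..1} \<Longrightarrow> (g has_real_derivative g' y) (at y within {0..1})"
    and c: "continuous_on {0..1} f'" "continuous_on {0..1} g'"
  shows "integral {0..1} (\<lambda>y. f' y * g y) = f 1 * g 1 - f 0 * g 0 - integral {0..1} (\<lambda>y. f y * g' y)"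
proof -
  have cf: "continuous_on {0..1} f" "continuous_on {0..1} g"
    using f g by (meson DERIV_continuous continuous_on_eq_continuous_within)+
  have "((\<lambda>y. f' y * g y + f y * g' y) has_integral (f 1 * g 1 - f 0 * g 0)) {0..1}"
    by (rule fundamental_theorem_of_calculus)
       (auto intro!: derivative_eq_intros f g simp flip: has_real_derivative_iff_has_vector_derivative)
  moreover have "integral {0..1} (\<lambda>y. f' y * g y + f y * g' y) =
      integral {0..1} (\<lambda>y. f' y * g y) + integral {0..1} (\<lambda>y. f y * g' y)"
    by (intro integral_add integrable_continuous_real continuous_intros c cf)
  ultimately show ?thesis by (simp add: integral_unique)
qed

text \<open>The difference of squares factors, and \<open>W x' y - W x y\<close> is the
  \<open>y\<close>-derivative of \<open>v x' y - v x y\<close>. Integration by parts thus replaces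
  the time increment of \<open>W\<close> by that of \<open>v\<close>, which is differentiable in
  \<open>x\<close>; the boundary term at \<open>y = 1\<close> drops out by
  \<open>v_top\<close>.\<close>

lemma energy_diff:
  assumes x: "x \<in> {0..b}" and x': "x' \<in> {0..b}"
  shows "integral {0..1} (\<lambda>y. (W x' y)\<^sup>2) - integral {0..1} (\<lambda>y. (W x y)\<^sup>2) =
    - (v x' 0 - v x 0) * (W x' 0 + W x 0) - integral {0..1} (\<lambda>y. (v x' y - v x y) * (u x' y + u x y))"
proof -
  have "integral {0..1} (\<lambda>y. (W x' y)\<^sup>2) - integral {0..1} (\<lambda>y. (W x y)\<^sup>2)
     = integral {0..1} (\<lambda>y. (W x' y)\<^sup>2 - (W x y)\<^sup>2)"
    by (intro integral_diff[symmetric] integrable_continuous_real continuous_intros cont_W x x')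
  also have "\<dots> = integral {0..1} (\<lambda>y. (W x' y - W x y) * (W x' y + W x y))"
    by (simp add: power2_eq_square algebra_simps)
  also have "\<dots> = - (v x' 0 - v x 0) * (W x' 0 + W x 0) - integral {0..1} (\<lambda>y. (v x' y - v x y) * (u x' y + u x y))"
  proof -
    have "integral {0..1} (\<lambda>y. (W x' y - W x y) * (W x' y + W x y)) =
        (v x' 1 - v x 1) * (W x' 1 + W x 1) - (v x' 0 - v x 0) * (W x' 0 + W x 0)
        - integral {0..1} (\<lambda>y. (v x' y - v x y) * (u x' y + u x y))"
      by (rule by_parts) (intro DERIV_diff DERIV_add v_deriv_y W_deriv continuous_intros cont_W cont_x x x'; assumption)+
    then show ?thesis by (simp add: v_top[OF x] v_top[OF x'] del: minus_diff_eq)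
  qed
  finally show ?thesis .
qed

lemma cont_trace: "continuous_on {0..b} (\<lambda>x. u x 0)"
  by (rule cont_y) auto

lemma cont_W0: "continuous_on {0..b} (\<lambda>x. W x 0)"
  unfolding W_def by (auto intro!: continuous_intros cont_trace contS)

lemma cont_U: "continuous_on {0..b} (\<lambda>x. integral {0..1} (\<lambda>y. (u x y)\<^sup>2))"
  by (rule integral_continuous_on_param[of _ "0::real" 1, simplified])
     (use cont in \<open>auto intro!: continuous_intros simp: case_prod_beta\<close>)

text \<open>After division by \<open>X n - x\<close>, \<open>energy_diff\<close> contains only
  difference quotients \<open>A\<close> of \<open>v\<close>. They converge to \<open>u\<close> and
  are bounded by \<open>M\<close>, so dominated convergence gives the limit without differentiating
  \<open>u\<close> or \<open>W\<close> in time.\<close>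

lemma energy_deriv:
  assumes x: "x \<in> {0..b}"
  shows "((\<lambda>x. integral {0..1} (\<lambda>y. (W x y)\<^sup>2)) has_real_derivative
     (- 2 * u x 0 * W x 0 - 2 * integral {0..1} (\<lambda>y. (u x y)\<^sup>2))) (at x within {0..b})"
proof -
  obtain M where M: "0 \<le> M" "\<And>x y. x \<in> {0..b} \<Longrightarrow> y \<in> {0..1} \<Longrightarrow> \<bar>u x y\<bar> \<le> M" using u_bound by blast
  let ?e = "\<lambda>x. integral {0..1} (\<lambda>y. (W x y)\<^sup>2)"
  have "(\<lambda>n. (?e (X n) - ?e x) / (X n - x)) \<longlonglongrightarrow> - 2 * u x 0 * W x 0 - 2 * integral {0..1} (\<lambda>y. (u x y)\<^sup>2)"
    if X: "\<And>n. X n \<in> {0..b}" "\<And>n. X n \<noteq> x" "X \<longlonglongrightarrow> x" for X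
  proof -
    define A where "A = (\<lambda>n y. (v (X n) y - v x y) / (X n - x))"
    have limA: "(\<lambda>n. A n y) \<longlonglongrightarrow> u x y" if y: "y \<in> {0..1}" for y
      using v_deriv_x[OF x y] X unfolding has_field_derivative_iff tendsto_at_iff_sequentially A_def
      by (auto simp: o_def)
    have boundA: "\<bar>A n y\<bar> \<le> M" if y: "y \<in> {0..1}" for n y
      using v_lipschitz[OF M(2) x X(1) y, of n] X(2)[of n] by (simp add: A_def field_simps)
    have lim_u: "(\<lambda>n. u (X n) y) \<longlonglongrightarrow> u x y" if y: "y \<in> {0..1}" for y
      using cont_y[OF y] X x by (auto simp: continuous_on_sequentially o_def)
    have limW: "(\<lambda>n. W (X n) 0) \<longlonglongrightarrow> W x 0"
      using cont_W0 X x by (auto simp: continuous_on_sequentially o_def)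
    have cA: "continuous_on {0..1} (A n)" for n
      unfolding A_def using X(2)[of n] by (intro continuous_intros cont_v_y x X(1)) auto
    have "(\<lambda>n. integral {0..1} (\<lambda>y. A n y * (u (X n) y + u x y))) \<longlonglongrightarrow> integral {0..1} (\<lambda>y. u x y * (u x y + u x y))"
    proof (rule dominated_convergence(2))
      show "(\<lambda>y. A n y * (u (X n) y + u x y)) integrable_on {0..1}" for n
        by (intro integrable_continuous_real continuous_intros cA cont_x x X)
      show "norm (A n y * (u (X n) y + u x y)) \<le> M * (M + M)" if "y \<in> {0..1}" for n y
        unfolding norm_mult using boundA[OF that] M(1) M(2)[OF X(1) that, of n] M(2)[OF x that]
        by (intro mult_mono) auto
      show "(\<lambda>n. A n y * (u (X n) y + u x y)) \<longlonglongrightarrow> u x y * (u x y + u x y)" if "y \<in> {0..1}" for y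
        by (intro tendsto_intros limA lim_u that)
    qed auto
    then have 1: "(\<lambda>n. - A n 0 * (W (X n) 0 + W x 0) - integral {0..1} (\<lambda>y. A n y * (u (X n) y + u x y)))
       \<longlonglongrightarrow> - u x 0 * (W x 0 + W x 0) - integral {0..1} (\<lambda>y. u x y * (u x y + u x y))"
      by (intro tendsto_intros limA limW) auto
    have 2: "(?e (X n) - ?e x) / (X n - x) =
        - A n 0 * (W (X n) 0 + W x 0) - integral {0..1} (\<lambda>y. A n y * (u (X n) y + u x y))" for n
    proof -
      have Aeq: "v (X n) y - v x y = (X n - x) * A n y" for y
        using X(2)[of n] by (simp add: A_def)
      have "?e (X n) - ?e x = (X n - x) * (- A n 0 * (W (X n) 0 + W x 0) - integral {0..1} (\<lambda>y. A n y * (u (X n) y + u x y)))"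
        unfolding energy_diff[OF x X(1)] Aeq mult.assoc integral_mult_right by (simp add: right_diff_distrib)
      then show ?thesis
        using X(2)[of n] by simp
    qed
    have 3: "- u x 0 * (W x 0 + W x 0) - integral {0..1} (\<lambda>y. u x y * (u x y + u x y)) =
        - 2 * u x 0 * W x 0 - 2 * integral {0..1} (\<lambda>y. (u x y)\<^sup>2)"
    proof -
      have "(\<lambda>y. u x y * (u x y + u x y)) = (\<lambda>y. 2 * (u x y)\<^sup>2)"
        by (auto simp: power2_eq_square)
      then show ?thesis by simp
    qed
    show ?thesis using 1 unfolding 2 3 .
  qed
  then show ?thesis
    unfolding has_field_derivative_iff tendsto_at_iff_sequentially by (auto simp: o_def)
qed


lemma trace_integrals: 
  assumes x: "x \<in> {0..b}"
  shows "(integral {0..x} (\<lambda>t. \<bar>u t 0\<bar>))\<^sup>2 \<le> integral {0..x} (\<lambda>t. (u t 0)\<^sup>2)"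
proof -
  have c: "continuous_on {0..x} (\<lambda>t. u t 0)"
    using cont_trace x by (auto elim: continuous_on_subset)
  have "(integral {0..x} (\<lambda>t. \<bar>u t 0\<bar>))\<^sup>2 \<le> x * integral {0..x} (\<lambda>t. \<bar>u t 0\<bar>\<^sup>2)"
    using x by (intro integral_square_le continuous_intros c) auto
  also have "\<dots> \<le> 1 * integral {0..x} (\<lambda>t. \<bar>u t 0\<bar>\<^sup>2)"
    using x b by (intro mult_right_mono integral_nonneg integrable_continuous_real continuous_intros c) auto
  finally show ?thesis by simp
qed

text \<open>The weight \<open>1 - y\<close> isolates the value at \<open>y = 0\<close>, since it
  removes the uncontrolled boundary term at \<open>y = 1\<close>. The cross term is split by 2 c |W
  u| \<le> c^2 W^2 + u^2. Scaling by \<open>c\<close> leaves the factor 1 before the integral of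
  u^2, less than the 2 available in \<open>energy_deriv\<close>, however large \<open>c\<close>
  is.\<close>

lemma W0_square_le:
  assumes x: "x \<in> {0..b}" and c: "0 < c"
  shows "c * (W x 0)\<^sup>2 \<le> (c + c\<^sup>2) * integral {0..1} (\<lambda>y. (W x y)\<^sup>2) + integral {0..1} (\<lambda>y. (u x y)\<^sup>2)"
proof -
  have i: "f integrable_on {0..1}" if "continuous_on {0..1} f" for f :: "real \<Rightarrow> real"
    using that by (rule integrable_continuous_real)
  have "integral {0..1} (\<lambda>y. (-1) * (W x y * W x y)) =
      0 - (1 - 0) * (W x 0 * W x 0) - integral {0..1} (\<lambda>y. (1 - y) * (W x y * u x y + u x y * W x y))"
    by (subst by_parts[where f="\<lambda>y. 1 - y" and g'="\<lambda>y. W x y * u x y + u x y * W x y"])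
       (auto intro!: derivative_eq_intros W_deriv continuous_intros cont_W cont_x x)
  then have "(W x 0)\<^sup>2 = integral {0..1} (\<lambda>y. (W x y)\<^sup>2) - integral {0..1} (\<lambda>y. (1 - y) * (W x y * u x y + u x y * W x y))"
    by (simp add: power2_eq_square)
  also have "\<dots> = integral {0..1} (\<lambda>y. (W x y)\<^sup>2 - (1 - y) * (W x y * u x y + u x y * W x y))"
    by (intro integral_diff[symmetric] i continuous_intros cont_W cont_x x)
  finally have eq: "(W x 0)\<^sup>2 = integral {0..1} (\<lambda>y. (W x y)\<^sup>2 - (1 - y) * (W x y * u x y + u x y * W x y))" .
  have "c * (W x 0)\<^sup>2 = integral {0..1} (\<lambda>y. c * ((W x y)\<^sup>2 - (1 - y) * (W x y * u x y + u x y * W x y)))"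
    unfolding eq by simp
  also have "\<dots> \<le> integral {0..1} (\<lambda>y. (c + c\<^sup>2) * (W x y)\<^sup>2 + (u x y)\<^sup>2)"
  proof (rule integral_le)
    fix y :: real assume y: "y \<in> {0..1}"
    have "- 2 * c * (1 - y) * (W x y * u x y) \<le> (c * W x y)\<^sup>2 * (1-y) + (u x y)\<^sup>2 * (1-y)"
      using y zero_le_power2[of "c * W x y + u x y"] 
        mult_left_mono[of 0 "(c * W x y + u x y)\<^sup>2" "1 - y"]
      by (simp add: power2_eq_square algebra_simps)
    also have "\<dots> \<le> (c * W x y)\<^sup>2 * 1 + (u x y)\<^sup>2 * 1"
      using y by (intro add_mono mult_left_mono) auto
    finally show "c * ((W x y)\<^sup>2 - (1 - y) * (W x y * u x y + u x y * W x y)) \<le> (c + c\<^sup>2) * (W x y)\<^sup>2 + (u x y)\<^sup>2"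
      by (simp add: power2_eq_square algebra_simps)
  qed (intro i continuous_intros cont_W cont_x x)+
  also have "\<dots> = (c + c\<^sup>2) * integral {0..1} (\<lambda>y. (W x y)\<^sup>2) + integral {0..1} (\<lambda>y. (u x y)\<^sup>2)"
    by (subst integral_add) (auto intro!: i continuous_intros cont_W cont_x x)
  finally show ?thesis .
qed

lemma integral_square_zero:
  fixes f :: "real \<Rightarrow> real"
  assumes "continuous_on {c..d} f" "integral {c..d} (\<lambda>t. (f t)\<^sup>2) = 0" "c < d" "t \<in> {c..d}"
  shows "f t = 0"
  using integral_eq_0_iff[of c d "\<lambda>t. (f t)\<^sup>2"] continuous_on_power[OF assms(1), of 2] assms(2-4) by simp

text \<open>For \<open>\<alpha> < 0\<close> the energy of \<open>u\<close> itself has an indefinite boundary term. The energy \<open>\<integral> W\<^sup>2\<close>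
  serves for either sign, because \<open>W\<^sup>2\<close> at \<open>y = 0\<close>, and with it \<open>\<alpha>\<^sup>2 \<tau>\<^sup>2\<close>, is controlled by
  \<open>\<integral> W\<^sup>2\<close> and a small multiple of \<open>\<integral> u\<^sup>2\<close>.\<close>

theorem vanishes_dynamic:
  assumes \<alpha>: "\<alpha> \<noteq> 0"
    and S: "\<And>x. x \<in> {0..b} \<Longrightarrow> \<bar>S x\<bar> \<le> C * integral {0..x} (\<lambda>t. \<bar>u t 0\<bar>)"
    and x: "x \<in> {0..b}" and y: "y \<in> {0..1}"
  shows "u x y = 0"
proof -
  define N where "N = (\<lambda>x. integral {0..x} (\<lambda>t. (u t 0)\<^sup>2))"
  define e where "e = (\<lambda>x. integral {0..1} (\<lambda>y. (W x y)\<^sup>2))"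
  define U where "U = (\<lambda>x. integral {0..1} (\<lambda>y. (u x y)\<^sup>2))"
  \<comment> \<open>Doubling \<open>\<tau>2\<close> and adding the square of \<open>W x 0\<close>
    yields the coefficients 4 / \<alpha>^2 + 1 and 4 C^2 / \<alpha>^2; \<open>c\<close> dominates
    both.\<close>
  define c where "c = 1 + 4 * (1 + C\<^sup>2) / \<alpha>\<^sup>2"
  have c: "c > 0" "4 / \<alpha>\<^sup>2 + 1 \<le> c" "4 * C\<^sup>2 / \<alpha>\<^sup>2 \<le> c"
    using \<alpha> by (auto simp: c_def field_simps add_pos_nonneg)
  have N0: "N x \<ge> 0" and e0: "e x \<ge> 0" if "x \<in> {0..b}" for x
    using that unfolding N_def e_def
    by (auto intro!: integral_nonneg integrable_continuous_real continuous_intros cont_W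
        intro: continuous_on_subset[OF cont_trace])
  have U0: "U x \<ge> 0" if "x \<in> {0..b}" for x
    using that unfolding U_def by (auto intro!: integral_nonneg integrable_continuous_real continuous_intros cont_x)
  have S2: "(S x)\<^sup>2 \<le> C\<^sup>2 * N x" if x: "x \<in> {0..b}" for x
  proof -
    have "(S x)\<^sup>2 \<le> (C * integral {0..x} (\<lambda>t. \<bar>u t 0\<bar>))\<^sup>2"
      using S[OF x] by (simp add: abs_le_square_iff[symmetric])
    also have "\<dots> \<le> C\<^sup>2 * N x"
      unfolding power_mult_distrib N_def by (intro mult_left_mono trace_integrals x) auto
    finally show ?thesis .
  qed
  have \<tau>2: "(u x 0)\<^sup>2 \<le> (2 / \<alpha>\<^sup>2) * (W x 0)\<^sup>2 + (2 * C\<^sup>2 / \<alpha>\<^sup>2) * N x" if x: "x \<in> {0..b}" for x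
  proof -
    have "\<alpha>\<^sup>2 * (u x 0)\<^sup>2 = (W x 0 - S x)\<^sup>2"
      by (simp add: W_def power_mult_distrib)
    also have "\<dots> \<le> 2 * (W x 0)\<^sup>2 + 2 * (S x)\<^sup>2"
      using zero_le_power2[of "W x 0 + S x"] by (simp add: power2_eq_square algebra_simps)
    also have "\<dots> \<le> 2 * (W x 0)\<^sup>2 + 2 * (C\<^sup>2 * N x)"
      using S2[OF x] by simp
    finally show ?thesis using \<alpha> by (simp add: field_simps)
  qed
  \<comment> \<open>\<open>N\<close> joins the energy because \<open>S\<close> is controlled only
    through the past of the trace.\<close>
  have E0: "e x + N x = 0" if "x \<in> {0..b}" for x
  proof (rule gronwall_zero[where E="\<lambda>x. e x + N x" and b=b and C="c + c\<^sup>2"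
        and E'="\<lambda>x. - 2 * u x 0 * W x 0 - 2 * U x + (u x 0)\<^sup>2"])
    show "e 0 + N 0 = 0"
      using W_init by (simp add: N_def e_def) (intro integral_unique has_integral_is_0, auto)
    show "((\<lambda>x. e x + N x) has_real_derivative - 2 * u x 0 * W x 0 - 2 * U x + (u x 0)\<^sup>2) (at x within {0..b})"
      if "x \<in> {0..b}" for x
      unfolding e_def N_def U_def using that
      by (intro DERIV_add energy_deriv integral_has_real_derivative continuous_intros cont_trace)
    show "- 2 * u x 0 * W x 0 - 2 * U x + (u x 0)\<^sup>2 \<le> (c + c\<^sup>2) * (e x + N x)" if x: "x \<in> {0..b}" for x
    proof -
      have "0 \<le> (u x 0 + W x 0)\<^sup>2" by simp
      then have "- 2 * u x 0 * W x 0 + (u x 0)\<^sup>2 \<le> 2 * (u x 0)\<^sup>2 + (W x 0)\<^sup>2"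
        by (simp add: power2_eq_square algebra_simps)
      also have "\<dots> \<le> (4 / \<alpha>\<^sup>2 + 1) * (W x 0)\<^sup>2 + (4 * C\<^sup>2 / \<alpha>\<^sup>2) * N x"
        using mult_left_mono[OF \<tau>2[OF x], of 2] by (simp add: algebra_simps)
      also have "\<dots> \<le> c * (W x 0)\<^sup>2 + c * N x"
        using N0[OF x] by (intro add_mono mult_right_mono c) auto
      also have "\<dots> \<le> (c + c\<^sup>2) * e x + U x + (c + c\<^sup>2) * N x"
        using W0_square_le[OF x c(1)] N0[OF x] unfolding e_def U_def
        by (intro add_mono mult_right_mono) auto
      finally show ?thesis using U0[OF x] by (simp add: algebra_simps)
    qed
    show "0 \<le> e x + N x" if "x \<in> {0..b}" for x using N0[OF that] e0[OF that] by simp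
  qed (use b that in auto)
  have u0: "u x 0 = 0" if x: "x \<in> {0..b}" for x
  proof (rule integral_square_zero[OF cont_trace _ _ x])
    show "integral {0..b} (\<lambda>t. (u t 0)\<^sup>2) = 0" using E0[of b] N0[of b] e0[of b] b by (auto simp: N_def)
  qed (use b in auto)
  have W0: "W x y = 0" if x: "x \<in> {0..b}" and y: "y \<in> {0..1}" for x y
  proof (rule integral_square_zero[OF cont_W[OF x] _ _ y])
    show "integral {0..1} (\<lambda>y. (W x y)\<^sup>2) = 0" using E0[OF x] N0[OF x] e0[OF x] by (auto simp: e_def)
  qed auto
  \<comment> \<open>With \<open>W\<close> also \<open>v\<close> vanishes, and \<open>u\<close> is
    recovered as the \<open>x\<close>-derivative of \<open>v\<close>.\<close>
  have v0: "v x y = 0" if x: "x \<in> {0..b}" and y: "y \<in> {0..1}" for x y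
  proof -
    have "v x 0 = 0" unfolding v_def using u0 x by (intro integral_unique has_integral_is_0) auto
    moreover have "integral {0..y} (W x) = 0"
      using W0[OF x] y by (intro integral_unique has_integral_is_0) auto
    ultimately show ?thesis using v_eq[OF x y] by simp
  qed
  have "((\<lambda>x. 0) has_real_derivative u x y) (at x within {0..b})"
    using v_deriv_x[OF x y] by (rule has_field_derivative_transform_within[where d=1]) (use v0 x y in auto)
  moreover have "((\<lambda>x. 0) has_real_derivative 0) (at x within {0..b})" by simp
  ultimately show ?thesis
    using vector_derivative_unique_within_closed_interval[of 0 b x "\<lambda>x. 0" "u x y" 0] x b
    by (simp add: has_real_derivative_iff_has_vector_derivative)
qed

end

context heat_trace begin

text \<open>For \<open>\<alpha> = 0\<close> the boundary term no longer controls \<open>\<tau>\<close>, and the energy of \<open>u\<close> is needed. It is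
  obtained as a limit of the energies of the difference quotients \<open>w\<close> of \<open>v\<close> in \<open>x\<close>, in which the
  term \<open>\<integral> w\<^sub>y\<^sup>2\<close>, which need not converge, is first bounded below by means of \<open>w\<^sup>2\<close> at \<open>y = 0\<close>.\<close>

lemma static_step:
  assumes \<alpha>: "\<alpha> = 0" and \<kappa>: "\<kappa> > 0"
    and R: "continuous_on {0..b} R" and S: "\<And>x. x \<in> {0..b} \<Longrightarrow> S x = integral {0..x} R"
    and X: "0 \<le> X" "X < b"
  shows "integral {0..1} (\<lambda>y. (u X y)\<^sup>2) \<le> integral {0..X} (\<lambda>x. 2 * (- (u x 0 * R x) - \<kappa> * (u x 0)\<^sup>2 + 
     \<kappa>\<^sup>2 * integral {0..1} (\<lambda>y. (u x y)\<^sup>2)))"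
proof -
  obtain M where M: "0 \<le> M" "\<And>x y. x \<in> {0..b} \<Longrightarrow> y \<in> {0..1} \<Longrightarrow> \<bar>u x y\<bar> \<le> M" using u_bound by blast
  have "bounded (R ` {0..b})"
    by (intro compact_imp_bounded compact_continuous_image R) auto
  then obtain M' where M': "\<And>x. x \<in> {0..b} \<Longrightarrow> \<bar>R x\<bar> \<le> M'"
    unfolding bounded_iff real_norm_def by blast
  have M'0: "M' \<ge> 0" using M'[of 0] b by force
  \<comment> \<open>The shifted argument \<open>x + h n\<close> has to stay in \<open>{0..b}\<close>
    for all \<open>x \<le> X\<close>, which is possible because \<open>X < b\<close>.\<close>
  define h where "h = (\<lambda>n. (b - X) / real (Suc n))"
  have h: "h n > 0" "X + h n \<le> b" for n
    using X mult_right_mono[of X b "real n"] by (auto simp: h_def field_simps)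
  have hlim: "h \<longlonglongrightarrow> 0"
    unfolding h_def by (rule LIMSEQ_Suc) (rule lim_const_over_n)
  have in_b: "x \<in> {0..b}" "x + h n \<in> {0..b}" if "x \<in> {0..X}" for x n
    using that h[of n] X by auto
  define w where "w = (\<lambda>n x y. (v (x + h n) y - v x y) / h n)"
  define P where "P = (\<lambda>n x y. (W (x + h n) y - W x y) / h n)"
  define D where "D = (\<lambda>n x y. (u (x + h n) y - u x y) / h n)"
  define E where "E = (\<lambda>n x. integral {0..1} (\<lambda>y. (w n x y)\<^sup>2))"
  have seq: "(\<lambda>n. (f (x + h n) - f x) / h n) \<longlonglongrightarrow> f'"
    if "(f has_real_derivative f') (at x within {0..b})" "x \<in> {0..X}" for f f' x
  proof -
    have "(\<lambda>n. x + h n) \<longlonglongrightarrow> x" using hlim by (auto intro!: tendsto_eq_intros)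
    then show ?thesis
      using that h(1) in_b[OF that(2)] unfolding has_field_derivative_iff tendsto_at_iff_sequentially
      by (auto simp: o_def less_imp_neq[OF h(1), symmetric] dest!: spec[of _ "\<lambda>n. x + h n"])
  qed
  have w_lim: "(\<lambda>n. w n x y) \<longlonglongrightarrow> u x y" if "x \<in> {0..X}" "y \<in> {0..1}" for x y
    unfolding w_def using seq[OF v_deriv_x[OF in_b(1)[OF that(1)] that(2)] that(1)] .
  \<comment> \<open>Here \<open>\<alpha> = 0\<close> is used: the trace drops out of
    \<open>W x 0\<close>, which becomes a primitive of the continuous function \<open>R\<close>, so
    the quotients \<open>P n x 0\<close> converge.\<close>
  have Seq: "W x 0 = integral {0..x} R" if "x \<in> {0..b}" for x
    unfolding W_def \<alpha> using S[OF that] by simp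
  have R_deriv: "((\<lambda>x. W x 0) has_real_derivative R x) (at x within {0..b})" if "x \<in> {0..b}" for x
    by (rule has_field_derivative_transform_within[where d=1, OF integral_has_real_derivative[OF R that]])
       (use that Seq in auto)
  have P_lim: "(\<lambda>n. P n x 0) \<longlonglongrightarrow> R x" if "x \<in> {0..X}" for x
    unfolding P_def using seq[OF R_deriv[OF in_b(1)[OF that]] that] .
  have w_bound: "\<bar>w n x y\<bar> \<le> M" if "x \<in> {0..X}" "y \<in> {0..1}" for n x y
    using v_lipschitz[OF M(2) in_b[OF that(1)] that(2), of n] h(1)[of n] by (simp add: w_def field_simps)
  have P_bound: "\<bar>P n x 0\<bar> \<le> M'" if "x \<in> {0..X}" for n x
    using field_differentiable_bound[of "{0..b}" "\<lambda>x. W x 0" R M' "x + h n" x] R_deriv M' in_b[OF that] h(1)[of n]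
    by (auto simp: P_def field_simps)
  have u_shift: "continuous_on ({0..X} \<times> {0..1}) (\<lambda>(x, y). u (x + h n) y)" for n
    using continuous_on_compose2[OF cont, of "{0..X} \<times> {0..1}" "\<lambda>(x, y). (x + h n, y)"] in_b
    by (force intro!: continuous_intros simp: case_prod_beta)
  have v_shift: "continuous_on ({0..X} \<times> {0..1}) (\<lambda>(x, y). v (x + h n) y)" for n
    using continuous_on_compose2[OF cont_v, of "{0..X} \<times> {0..1}" "\<lambda>(x, y). (x + h n, y)"] in_b
    by (force intro!: continuous_intros simp: case_prod_beta)
  have c2: "continuous_on ({0..X} \<times> {0..1}) (\<lambda>(x, y). u x y)" "continuous_on ({0..X} \<times> {0..1}) (\<lambda>(x, y). v x y)"
    by (rule continuous_on_subset[OF cont] continuous_on_subset[OF cont_v]; use X in auto)+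
  have w_cont: "continuous_on ({0..X} \<times> {0..1}) (\<lambda>(x, y). w n x y)" for n
    using v_shift[of n] c2(2) h(1)[of n] unfolding w_def case_prod_beta
    by (intro continuous_intros) auto
  have D_cont: "continuous_on ({0..X} \<times> {0..1}) (\<lambda>(x, y). D n x y)" for n
    using u_shift[of n] c2(1) h(1)[of n] unfolding D_def case_prod_beta
    by (intro continuous_intros) auto
  have w_y: "((w n x) has_real_derivative P n x y) (at y within {0..1})" if "x \<in> {0..X}" "y \<in> {0..1}" for n x y
    unfolding w_def P_def by (intro DERIV_cdivide DERIV_diff v_deriv_y in_b that)
  have P_y: "((P n x) has_real_derivative D n x y) (at y within {0..1})" if "x \<in> {0..X}" "y \<in> {0..1}" for n x y
    unfolding D_def P_def by (intro DERIV_cdivide DERIV_diff W_deriv in_b that)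
  have cw: "continuous_on {0..1} (w n x)" and cP: "continuous_on {0..1} (P n x)"
      and cD: "continuous_on {0..1} (D n x)" if "x \<in> {0..X}" for n x
    unfolding w_def P_def D_def using h(1)[of n]
    by (auto intro!: continuous_intros cont_v_y cont_W cont_x simp: in_b[OF that, simplified])
  have w_x: "((\<lambda>x. w n x y) has_real_derivative D n x y) (at x within {0..X})" if "x \<in> {0..X}" "y \<in> {0..1}" for n x y
  proof -
    have 1: "((\<lambda>x. v x y) has_real_derivative u x y) (at x within {0..X})"
      using v_deriv_x[OF in_b(1)[OF that(1)] that(2)] by (rule DERIV_subset) (use X in auto)
    have "(((\<lambda>x. v x y) \<circ> (\<lambda>x. x + h n)) has_real_derivative u (x + h n) y * 1) (at x within {0..X})"
    proof (rule DERIV_image_chain)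
      show "((\<lambda>x. v x y) has_real_derivative u (x + h n) y) (at (x + h n) within (\<lambda>x. x + h n) ` {0..X})"
        using v_deriv_x[OF in_b(2)[OF that(1)] that(2)] by (rule DERIV_subset) (use in_b[OF that(1)] h[of n] X in auto)
    qed (auto intro!: derivative_eq_intros)
    then have 2: "((\<lambda>x. v (x + h n) y) has_real_derivative u (x + h n) y) (at x within {0..X})"
      by (simp add: o_def)
    show ?thesis unfolding w_def D_def by (intro DERIV_cdivide DERIV_diff 1 2)
  qed
  have w_top: "w n x 1 = 0" if "x \<in> {0..X}" for n x
    using v_top[OF in_b(1)[OF that]] v_top[OF in_b(2)[OF that]] by (simp add: w_def)
  have i: "f integrable_on {0..1}" if "continuous_on {0..1} f" for f :: "real \<Rightarrow> real"
    using that by (rule integrable_continuous_real)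
  have E_deriv: "(E n has_real_derivative integral {0..1} (\<lambda>y. 2 * (D n x y * w n x y))) (at x within {0..X})"
    if x: "x \<in> {0..X}" for n x
    unfolding E_def
  proof (rule leibniz_rule_field_derivative[where a="0::real" and b=1, simplified])
    show "((\<lambda>x. (w n x t)\<^sup>2) has_real_derivative 2 * (D n x t * w n x t)) (at x within {0..X})"
      if "x \<in> {0..X}" "0 \<le> t \<and> t \<le> 1" for x t
      by (rule derivative_eq_intros w_x | use that in simp)+
    show "(\<lambda>y. (w n x y)\<^sup>2) integrable_on {0..1}" if "x \<in> {0..X}" for x
      by (intro i continuous_intros cw that)
    show "continuous_on ({0..X} \<times> {0..1}) (\<lambda>(x, y). 2 * (D n x y * w n x y))"
      using D_cont[of n] w_cont[of n] unfolding case_prod_beta by (intro continuous_intros)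
  qed (use x in auto)
  \<comment> \<open>By parts, half the derivative of \<open>E n\<close> is - w P at
    \<open>y = 0\<close> minus the integral of P^2. Since w vanishes at \<open>y = 1\<close>, the
    value of w^2 at \<open>y = 0\<close> is minus twice the integral of P w, and the square of
    \<kappa> w + P shows that the integral of P^2 is at least \<kappa> w^2 - \<kappa>^2 E.\<close>
  have E_le: "integral {0..1} (\<lambda>y. 2 * (D n x y * w n x y)) \<le> 2 * (- (w n x 0 * P n x 0) - \<kappa> * (w n x 0)\<^sup>2 + \<kappa>\<^sup>2 * E n x)"
    if x: "x \<in> {0..X}" for n x
  proof -
    have 1: "integral {0..1} (\<lambda>y. D n x y * w n x y) = - (w n x 0 * P n x 0) - integral {0..1} (\<lambda>y. (P n x y)\<^sup>2)"
      by (subst by_parts[where f="P n x" and g'="P n x"]) (auto simp: power2_eq_square w_top[OF x] intro: P_y w_y x cP cD)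
    have 2: "integral {0..1} (\<lambda>y. P n x y * w n x y) = - (w n x 0)\<^sup>2 - integral {0..1} (\<lambda>y. w n x y * P n x y)"
      by (subst by_parts[where f="w n x" and g'="P n x"]) (auto simp: power2_eq_square w_top[OF x] intro: P_y w_y x cP cD)
    have "\<kappa> * (w n x 0)\<^sup>2 = \<kappa> * (-2 * integral {0..1} (\<lambda>y. P n x y * w n x y))"
      using 2 by (simp add: mult.commute)
    also have "\<dots> = integral {0..1} (\<lambda>y. - 2 * \<kappa> * (P n x y * w n x y))"
      unfolding integral_mult_right by simp
    also have "\<dots> \<le> integral {0..1} (\<lambda>y. \<kappa>\<^sup>2 * (w n x y)\<^sup>2 + (P n x y)\<^sup>2)"
    proof (rule integral_le)
      show "- 2 * \<kappa> * (P n x y * w n x y) \<le> \<kappa>\<^sup>2 * (w n x y)\<^sup>2 + (P n x y)\<^sup>2" for y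
        using zero_le_power2[of "\<kappa> * w n x y + P n x y"] by (simp add: power2_eq_square algebra_simps)
    qed (intro i continuous_intros cw cP x)+
    also have "\<dots> = \<kappa>\<^sup>2 * E n x + integral {0..1} (\<lambda>y. (P n x y)\<^sup>2)"
      unfolding E_def by (subst integral_add) (auto intro!: i continuous_intros cw cP x)
    finally show ?thesis using 1 by simp
  qed
  have E_cont: "continuous_on {0..X} (E n)" for n
    using E_deriv by (meson DERIV_continuous continuous_on_eq_continuous_within)
  have w0_cont: "continuous_on {0..X} (\<lambda>x. w n x 0)" for n
    unfolding continuous_on_eq_continuous_within by (intro ballI DERIV_continuous[OF w_x]) auto
  have P0_cont: "continuous_on {0..X} (\<lambda>x. P n x 0)" for n
  proof -
    have "continuous_on {0..X} (\<lambda>x. W (x + h n) 0)" "continuous_on {0..X} (\<lambda>x. W x 0)"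
      using in_b by (auto intro!: continuous_on_compose2[OF cont_W0] continuous_intros)
    then show ?thesis unfolding P_def using h(1)[of n] by (intro continuous_intros) auto
  qed
  have step: "E n X - E n 0 \<le> integral {0..X} (\<lambda>x. 2 * (- (w n x 0 * P n x 0) - \<kappa> * (w n x 0)\<^sup>2 + \<kappa>\<^sup>2 * E n x))" for n
  proof (rule has_integral_le)
    show "((\<lambda>x. integral {0..1} (\<lambda>y. 2 * (D n x y * w n x y))) has_integral (E n X - E n 0)) {0..X}"
      by (rule fundamental_theorem_of_calculus) (use X E_deriv in \<open>auto simp flip: has_real_derivative_iff_has_vector_derivative\<close>)
    show "((\<lambda>x. 2 * (- (w n x 0 * P n x 0) - \<kappa> * (w n x 0)\<^sup>2 + \<kappa>\<^sup>2 * E n x)) has_integral 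
       integral {0..X} (\<lambda>x. 2 * (- (w n x 0 * P n x 0) - \<kappa> * (w n x 0)\<^sup>2 + \<kappa>\<^sup>2 * E n x))) {0..X}"
      by (intro integrable_integral integrable_continuous_real continuous_intros E_cont w0_cont P0_cont)
  qed (use E_le in auto)
  have E_lim: "(\<lambda>n. E n x) \<longlonglongrightarrow> integral {0..1} (\<lambda>y. (u x y)\<^sup>2)" if x: "x \<in> {0..X}" for x
    unfolding E_def
  proof (rule dominated_convergence(2))
    show "norm ((w n x y)\<^sup>2) \<le> M\<^sup>2" if "y \<in> {0..1}" for n y
      using w_bound[OF x that, of n] by (simp add: abs_le_square_iff[symmetric])
  qed (use x w_lim in \<open>auto intro!: i continuous_intros cw tendsto_intros\<close>)
  have E_bound: "\<bar>E n x\<bar> \<le> M\<^sup>2" if x: "x \<in> {0..X}" for n x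
  proof -
    have "norm (E n x) \<le> M\<^sup>2 * (1 - 0)" unfolding E_def
      using w_bound[OF x] M(1) by (intro integral_bound continuous_intros cw x) (auto simp: abs_le_square_iff[symmetric])
    then show ?thesis by simp
  qed
  have "(\<lambda>n. integral {0..X} (\<lambda>x. 2 * (- (w n x 0 * P n x 0) - \<kappa> * (w n x 0)\<^sup>2 + \<kappa>\<^sup>2 * E n x))) \<longlonglongrightarrow>
     integral {0..X} (\<lambda>x. 2 * (- (u x 0 * R x) - \<kappa> * (u x 0)\<^sup>2 + \<kappa>\<^sup>2 * integral {0..1} (\<lambda>y. (u x y)\<^sup>2)))"
  proof (rule dominated_convergence(2))
    show "norm (2 * (- (w n x 0 * P n x 0) - \<kappa> * (w n x 0)\<^sup>2 + \<kappa>\<^sup>2 * E n x)) \<le> 2 * (M * M' + \<kappa> * M\<^sup>2 + \<kappa>\<^sup>2 * M\<^sup>2)"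
      if x: "x \<in> {0..X}" for n x
    proof -
      have 1: "\<bar>w n x 0 * P n x 0\<bar> \<le> M * M'"
        unfolding abs_mult using w_bound[OF x, of 0 n] P_bound[OF x, of n] M(1) by (intro mult_mono) auto
      have 2: "\<bar>\<kappa> * (w n x 0)\<^sup>2\<bar> \<le> \<kappa> * M\<^sup>2"
        using w_bound[OF x, of 0 n] \<kappa> by (auto simp: abs_mult abs_le_square_iff[symmetric])
      have 3: "\<bar>\<kappa>\<^sup>2 * E n x\<bar> \<le> \<kappa>\<^sup>2 * M\<^sup>2"
        using E_bound[OF x, of n] \<kappa> by (auto simp: abs_mult)
      have 4: "\<bar>2 * (- p - q + r)\<bar> \<le> 2 * (p' + q' + r')" if "\<bar>p\<bar> \<le> p'" "\<bar>q\<bar> \<le> q'" "\<bar>r\<bar> \<le> r'" for p q r p' q' r' :: real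
        using that unfolding abs_le_iff by (auto simp: algebra_simps)
      show ?thesis unfolding real_norm_def by (rule 4[OF 1 2 3])
    qed
    show "(\<lambda>x. 2 * (- (w n x 0 * P n x 0) - \<kappa> * (w n x 0)\<^sup>2 + \<kappa>\<^sup>2 * E n x)) integrable_on {0..X}" for n
      by (intro integrable_continuous_real continuous_intros E_cont w0_cont P0_cont)
    show "(\<lambda>n. 2 * (- (w n x 0 * P n x 0) - \<kappa> * (w n x 0)\<^sup>2 + \<kappa>\<^sup>2 * E n x)) \<longlonglongrightarrow>
       2 * (- (u x 0 * R x) - \<kappa> * (u x 0)\<^sup>2 + \<kappa>\<^sup>2 * integral {0..1} (\<lambda>y. (u x y)\<^sup>2))" if "x \<in> {0..X}" for x
      by (intro tendsto_intros w_lim P_lim E_lim that) auto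
  qed auto
  moreover have "(\<lambda>n. E n X - E n 0) \<longlonglongrightarrow> integral {0..1} (\<lambda>y. (u X y)\<^sup>2) - integral {0..1} (\<lambda>y. (u 0 y)\<^sup>2)"
    using X by (intro tendsto_diff E_lim) auto
  moreover have "integral {0..1} (\<lambda>y. (u 0 y)\<^sup>2) = 0"
    using init by (intro integral_unique has_integral_is_0) auto
  ultimately show ?thesis
    using LIMSEQ_le step by (metis (no_types, lifting) diff_zero)
qed

text \<open>The boundary term - \<kappa> \<tau>^2 in \<open>static_step\<close> can be made as
  strong as desired at the expense of a multiple of \<open>U\<close>. It therefore absorbs the
  memory term, which is bounded by \<tau>^2 and its time integral \<open>N\<close>; what remains is
  an integral inequality for \<open>U\<close>.\<close>

theorem vanishes_static:
  assumes \<alpha>: "\<alpha> = 0" and C: "0 \<le> C"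
    and R: "continuous_on {0..b} R" and S: "\<And>x. x \<in> {0..b} \<Longrightarrow> S x = integral {0..x} R"
    and R_le: "\<And>x. x \<in> {0..b} \<Longrightarrow> \<bar>R x\<bar> \<le> C * (\<bar>u x 0\<bar> + integral {0..x} (\<lambda>t. \<bar>u t 0\<bar>))"
    and x: "0 \<le> x" "x < b" and y: "y \<in> {0..1}"
  shows "u x y = 0"
proof -
  define U where "U = (\<lambda>x. integral {0..1} (\<lambda>y. (u x y)\<^sup>2))"
  \<comment> \<open>Young's inequality bounds - 2 u R by 3 C \<tau>^2 + C N. With this
    \<open>\<kappa>\<close> the trace part is at most C N - (C + 2) \<tau>^2, whose integral over
    \<open>{0..X}\<close> is nonpositive because \<open>X \<le> 1\<close>.\<close>
  define \<kappa> where "\<kappa> = 2 * C + 1"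
  have \<kappa>: "\<kappa> > 0" using C by (simp add: \<kappa>_def)
  have U0: "U x \<ge> 0" if "x \<in> {0..b}" for x
    using that unfolding U_def by (auto intro!: integral_nonneg integrable_continuous_real continuous_intros cont_x)
  have U_le: "U X \<le> 2 * \<kappa>\<^sup>2 * integral {0..X} U" if X: "X \<in> {0..x}" for X
  proof -
    have cs: "continuous_on {0..X} (\<lambda>t. u t 0)" "continuous_on {0..X} R" "continuous_on {0..X} U"
      using X x by (auto simp: U_def intro: continuous_on_subset[OF cont_trace] continuous_on_subset[OF R] continuous_on_subset[OF cont_U])
    have ic: "f integrable_on {0..X}" if "continuous_on {0..X} f" for f :: "real \<Rightarrow> real"
      using that by (rule integrable_continuous_real)
    define N where "N = integral {0..X} (\<lambda>t. (u t 0)\<^sup>2)"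
    have N0: "N \<ge> 0" unfolding N_def by (intro integral_nonneg ic continuous_intros cs) auto
    have "U X \<le> integral {0..X} (\<lambda>x. 2 * (- (u x 0 * R x) - \<kappa> * (u x 0)\<^sup>2 + \<kappa>\<^sup>2 * U x))"
      unfolding U_def by (rule static_step[OF \<alpha> \<kappa> R S]) (use X x in auto)
    also have "\<dots> \<le> integral {0..X} (\<lambda>x. (C * N - (C + 2) * (u x 0)\<^sup>2) + 2 * \<kappa>\<^sup>2 * U x)"
    proof (rule integral_le)
      fix t assume t: "t \<in> {0..X}"
      then have tb: "t \<in> {0..b}" using X x by auto
      define J where "J = integral {0..t} (\<lambda>t. \<bar>u t 0\<bar>)"
      have "J\<^sup>2 \<le> integral {0..t} (\<lambda>t. (u t 0)\<^sup>2)"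
        unfolding J_def by (rule trace_integrals[OF tb])
      also have "\<dots> \<le> N"
        unfolding N_def using t
        by (intro integral_subset_le ic continuous_intros cs integrable_continuous_real continuous_on_subset[OF cs(1)]) auto
      finally have J: "J\<^sup>2 \<le> N" .
      have "- (u t 0 * R t) \<le> \<bar>u t 0\<bar> * \<bar>R t\<bar>"
        by (metis abs_ge_minus_self abs_mult)
      also have "\<dots> \<le> \<bar>u t 0\<bar> * (C * (\<bar>u t 0\<bar> + J))"
        unfolding J_def by (intro mult_left_mono R_le tb) auto
      also have "\<dots> = C * (u t 0)\<^sup>2 + C * (\<bar>u t 0\<bar> * J)"
        by (simp add: power2_eq_square algebra_simps)
      also have "\<dots> \<le> C * (u t 0)\<^sup>2 + C * (((u t 0)\<^sup>2 + J\<^sup>2) / 2)"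
        using zero_le_power2[of "\<bar>u t 0\<bar> - J"] C
        by (intro add_left_mono mult_left_mono) (auto simp: power2_diff)
      also have "\<dots> \<le> C * (u t 0)\<^sup>2 + C * (((u t 0)\<^sup>2 + N) / 2)"
        using J C by (intro add_left_mono mult_left_mono) auto
      finally show "2 * (- (u t 0 * R t) - \<kappa> * (u t 0)\<^sup>2 + \<kappa>\<^sup>2 * U t) \<le> (C * N - (C + 2) * (u t 0)\<^sup>2) + 2 * \<kappa>\<^sup>2 * U t"
        unfolding \<kappa>_def by (simp add: field_simps)
    qed (intro ic continuous_intros cs)+
    also have "\<dots> = (C * N * X - (C + 2) * N) + 2 * \<kappa>\<^sup>2 * integral {0..X} U"
      unfolding N_def using X
      by (subst integral_add, (intro ic continuous_intros cs)+, subst integral_diff) (auto intro!: ic continuous_intros cs)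
    also have "\<dots> \<le> 2 * \<kappa>\<^sup>2 * integral {0..X} U"
    proof -
      have "C * N * X \<le> C * N * 1" using C N0 X x b by (intro mult_left_mono) auto
      then show ?thesis using N0 by (simp add: algebra_simps)
    qed
    finally show ?thesis .
  qed
  have cU: "continuous_on {0..x} U" using x by (auto simp: U_def intro: continuous_on_subset[OF cont_U])
  \<comment> \<open>\<open>U\<close> is known only through an integral inequality, so Gronwall is
    applied to its primitive.\<close>
  have iU: "integral {0..x} U = 0"
  proof (rule gronwall_zero[where E="\<lambda>x. integral {0..x} U" and E'=U and b=x and C="2 * \<kappa>\<^sup>2"])
    show "0 \<le> integral {0..X} U" if "X \<in> {0..x}" for X
      using that U0 x by (intro integral_nonneg integrable_continuous_real continuous_on_subset[OF cU]) auto
  qed (use x cU U_le in \<open>auto intro: integral_has_real_derivative\<close>)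
  have xb: "x \<in> {0..b}" using x by auto
  have "U x = 0" using U_le[of x] iU U0[OF xb] x by auto
  then show ?thesis
    using integral_square_zero[OF cont_x[OF xb] _ _ y] by (simp add: U_def)
qed

end

section \<open>Partial derivatives of functions in the smoothness classes\<close>

lemma C_class_DERIV_x:
  assumes "C_class i j D u" "0 < i" "(x, y) \<in> D"
  shows "((\<lambda>t. u (t, y)) has_real_derivative ddx u (x, y)) (at x)"
proof -
  have "(\<lambda>t. (ddx ^^ 0) u (t, y)) differentiable (at x)"
    using assms unfolding C_class_def by blast
  then show ?thesis by (simp add: ddx_def DERIV_deriv_iff_real_differentiable)
qed

lemma C_class_DERIV_y:
  assumes "C_class i j D u" "0 < j" "(x, y) \<in> D"
  shows "((\<lambda>t. u (x, t)) has_real_derivative ddy u (x, y)) (at y)"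
proof -
  have "(\<lambda>t. (ddy ^^ 0) u (x, t)) differentiable (at y)"
    using assms unfolding C_class_def by blast
  then show ?thesis by (simp add: ddy_def DERIV_deriv_iff_real_differentiable)
qed

lemma C_class_DERIV_xx:
  assumes "C_class i j D u" "1 < i" "(x, y) \<in> D"
  shows "((\<lambda>t. ddx u (t, y)) has_real_derivative ddx (ddx u) (x, y)) (at x)"
proof -
  have "(\<lambda>t. (ddx ^^ 1) u (t, y)) differentiable (at x)"
    using assms unfolding C_class_def by blast
  then show ?thesis by (simp add: ddx_def[of "ddx u"] DERIV_deriv_iff_real_differentiable)
qed

lemma C_class_DERIV_yy:
  assumes "C_class i j D u" "1 < j" "(x, y) \<in> D"
  shows "((\<lambda>t. ddy u (x, t)) has_real_derivative ddy (ddy u) (x, y)) (at y)"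
proof -
  have "(\<lambda>t. (ddy ^^ 1) u (x, t)) differentiable (at y)"
    using assms unfolding C_class_def by blast
  then show ?thesis by (simp add: ddy_def[of "ddy u"] DERIV_deriv_iff_real_differentiable)
qed

lemma C_class_continuous:
  assumes "C_class i j D u"
  shows "0 < i \<Longrightarrow> continuous_on D (ddx u)" "1 < i \<Longrightarrow> continuous_on D (ddx (ddx u))"
    "0 < j \<Longrightarrow> continuous_on D (ddy u)" "1 < j \<Longrightarrow> continuous_on D (ddy (ddy u))"
proof -
  have x: "m \<le> i \<Longrightarrow> continuous_on D ((ddx ^^ m) u)" and y: "m \<le> j \<Longrightarrow> continuous_on D ((ddy ^^ m) u)" for m
    using assms by (auto simp: C_class_def)
  show "0 < i \<Longrightarrow> continuous_on D (ddx u)" "1 < i \<Longrightarrow> continuous_on D (ddx (ddx u))"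
    "0 < j \<Longrightarrow> continuous_on D (ddy u)" "1 < j \<Longrightarrow> continuous_on D (ddy (ddy u))"
    using x[of 1] x[of 2] y[of 1] y[of 2] by (auto simp: numeral_2_eq_2)
qed

text \<open>Used to carry identities to \<open>x = 0\<close> or \<open>y = 0\<close>, and to the
  ends of a characteristic, where only continuity is available.\<close>

lemma constant_extends_left:
  fixes f :: "real \<Rightarrow> real"
  assumes "continuous_on {a..d} f" "a < d" "\<And>y. a < y \<Longrightarrow> y \<le> d \<Longrightarrow> f y = c"
  shows "f a = c"
proof -
  have "(f \<longlongrightarrow> f a) (at_right a)"
    using assms(1,2) by (auto simp: continuous_on_def at_within_Icc_at_right dest!: bspec[of _ _ a])
  moreover have "(f \<longlongrightarrow> c) (at_right a)"
    by (rule tendsto_eventually) (use assms in \<open>auto simp: eventually_at_right intro!: exI[of _ d]\<close>)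
  ultimately show ?thesis by (rule tendsto_unique[rotated]) auto
qed

section \<open>Reduction of the parabolic part to the heat equation with memory\<close>

lemma continuous_on_integral_upto:
  fixes F :: "real \<times> real \<Rightarrow> real"
  assumes F: "continuous_on (A \<times> {0..c}) F" and "compact A"
  shows "continuous_on (A \<times> {0..c}) (\<lambda>(x, y). integral {0..y} (\<lambda>z. F (x, z)))"
proof -
  have "compact (F ` (A \<times> {0..c}))"
    by (intro compact_continuous_image F compact_Times assms compact_Icc)
  then obtain M where M: "\<And>x y. x \<in> A \<Longrightarrow> y \<in> {0..c} \<Longrightarrow> \<bar>F (x, y)\<bar> \<le> M"
    using compact_imp_bounded by (force simp: bounded_iff)
  have cF: "continuous_on {0..c} (\<lambda>z. F (x, z))" if "x \<in> A" for x
    using that by (intro continuous_on_compose2[OF F] continuous_intros) auto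
  \<comment> \<open>The pair is swapped so that the upper limit of integration, in which the
    integral is Lipschitz, comes first.\<close>
  have "continuous_on ({0..c} \<times> A) (\<lambda>(y, x). integral {0..y} (\<lambda>z. F (x, z)))"
  proof (rule continuous_on_Times_lipschitz)
    show "continuous_on A (\<lambda>x. integral {0..y} (\<lambda>z. F (x, z)))" if "y \<in> {0..c}" for y
      by (rule integral_continuous_on_param[of _ "0::real" y, simplified])
         (use that in \<open>auto intro: continuous_on_subset[OF F]\<close>)
    show "\<bar>integral {0..y'} (\<lambda>z. F (x, z)) - integral {0..y} (\<lambda>z. F (x, z))\<bar> \<le> M * \<bar>y' - y\<bar>"
      if "y \<in> {0..c}" "y' \<in> {0..c}" "x \<in> A" for y y' x
      using field_differentiable_bound[of "{0..c}" "\<lambda>y. integral {0..y} (\<lambda>z. F (x, z))" "\<lambda>z. F (x, z)" M y' y]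
        integral_has_real_derivative[OF cF[OF that(3)]] M that by auto
  qed
  then have "continuous_on (A \<times> {0..c}) ((\<lambda>(y, x). integral {0..y} (\<lambda>z. F (x, z))) \<circ> prod.swap)"
    by (intro continuous_on_compose continuous_on_swap) (simp add: product_swap)
  then show ?thesis by (simp add: o_def case_prod_beta)
qed

text \<open>The work lies in establishing \<open>v_eq\<close> for the locale
  \<open>heat_trace\<close>. The heat equation is integrated over \<open>{e..x}\<close> in time and
  twice in \<open>y\<close>, where \<open>e > 0\<close> keeps away from the side
  \<open>x = 0\<close>; then \<open>e\<close> tends to 0. The function \<open>\<rho>\<close> stands
  for u_y(x, -0), of which only integrability against \<open>Q\<close> is known near 0.\<close>

theorem parabolic_vanishes:
  fixes u :: "real \<times> real \<Rightarrow> real"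
  assumes s: "0 < s" "s \<le> 1"
    and cu: "continuous_on ({0..1} \<times> {0..1}) u"
    and u12: "C_class 1 2 Omega0 u"
    and p: "continuous_on (Omega0 \<union> segment_AB) p" "\<And>z. z \<in> Omega0 \<Longrightarrow> p z = ddx u z"
    and q: "continuous_on (Omega0 \<union> segment_AB) q" "\<And>z. z \<in> Omega0 \<Longrightarrow> q z = ddy u z"
    and heat: "\<And>x y. 0 < x \<Longrightarrow> x < s \<Longrightarrow> 0 < y \<Longrightarrow> y < 1 \<Longrightarrow> ddx u (x, y) = ddy (ddy u) (x, y)"
    and left: "\<And>y. y \<in> {0..1} \<Longrightarrow> u (0, y) = 0" and top: "\<And>x. x \<in> {0..1} \<Longrightarrow> u (x, 1) = 0"
    and Q: "C1_upto ({0<..<1} \<times> {0<..<1}) ({0..1} \<times> {0..1}) Q"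
    and \<rho>: "\<And>x. 0 < x \<Longrightarrow> x < s \<Longrightarrow> p (x, 0) = \<rho> x"
    and int: "\<And>x. 0 < x \<Longrightarrow> x < s \<Longrightarrow> (\<lambda>t. \<rho> t * Q (x, t)) integrable_on {0..x}"
    and glue: "\<And>x. 0 < x \<Longrightarrow> x < s \<Longrightarrow> q (x, 0) = \<alpha> * \<rho> x + \<beta> * integral {0..x} (\<lambda>t. \<rho> t * Q (x, t))"
    and x: "0 \<le> x" "x < s" and y: "y \<in> {0..1}"
  shows "u (x, y) = 0"
proof -
  \<comment> \<open>Strictly between \<open>x\<close> and \<open>s\<close>: the heat equation and
    the gluing conditions hold up to \<open>b\<close>, and \<open>vanishes_static\<close> reaches
    every time below \<open>b\<close>.\<close>
  define b where "b = (x + s) / 2"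
  have b: "0 < b" "b < s" "x < b" "b < 1" using x s by (auto simp: b_def)
  define \<tau> where "\<tau> = (\<lambda>x. u (x, 0))"
  have Om: "(t, y) \<in> Omega0" if "0 < t" "t < 1" "0 < y" "y < 1" for t y
    using that by (simp add: Omega0_def)
  have OmAB: "{c..d} \<times> {0..e} \<subseteq> Omega0 \<union> segment_AB" if "0 < c" "d < 1" "e < 1" for c d e
    using that by (auto simp: Omega0_def segment_AB_def)
  have c\<tau>: "continuous_on {0..1} \<tau>"
    unfolding \<tau>_def by (intro continuous_on_compose2[OF cu] continuous_intros) auto
  have cux: "continuous_on {0..1} (\<lambda>x. u (x, y))" if "y \<in> {0..1}" for y
    using that by (intro continuous_on_compose2[OF cu] continuous_intros) auto
  have cuy: "continuous_on {0..1} (\<lambda>y. u (x, y))" if "x \<in> {0..1}" for x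
    using that by (intro continuous_on_compose2[OF cu] continuous_intros) auto
  \<comment> \<open>For \<open>y = 0\<close> the function \<open>p\<close> is only an extension and
    not a derivative to be integrated; the identity comes as the limit of those for
    \<open>y > 0\<close>.\<close>
  have incr: "integral {c..d} (\<lambda>t. p (t, y)) = u (d, y) - u (c, y)"
    if cd: "0 < c" "c \<le> d" "d < 1" and y: "0 \<le> y" "y < 1" for c d y
  proof -
    have pos: "integral {c..d} (\<lambda>t. p (t, y)) = u (d, y) - u (c, y)" if y: "0 < y" "y < 1" for y
    proof (rule integral_unique, rule fundamental_theorem_of_calculus)
      show "((\<lambda>t. u (t, y)) has_vector_derivative p (t, y)) (at t within {c..d})" if "t \<in> {c..d}" for t
        using C_class_DERIV_x[OF u12 _ Om, of t y] p(2)[OF Om, of t y] that y cd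
        by (auto intro: has_field_derivative_at_within simp flip: has_real_derivative_iff_has_vector_derivative)
    qed (use cd in auto)
    show ?thesis
    proof (cases "y = 0")
      case True
      have "continuous_on {0..1/2} (\<lambda>y. integral {c..d} (\<lambda>t. p (t, y)))"
        by (rule integral_continuous_on_param[of _ c d, simplified])
           (use cd in \<open>auto simp: Omega0_def segment_AB_def case_prod_beta intro!: continuous_on_compose2[OF p(1)] continuous_intros\<close>)
      then have "continuous_on {0..1/2} (\<lambda>y. integral {c..d} (\<lambda>t. p (t, y)) - (u (d, y) - u (c, y)))"
        using cd by (intro continuous_intros continuous_on_subset[OF cuy]) auto
      from constant_extends_left[OF this, of 0] pos True show ?thesis by auto
    qed (use pos y in auto)
  qed
  have \<tau>_deriv: "(\<tau> has_real_derivative \<rho> t) (at t)" if t: "0 < t" "t < s" for t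
  proof -
    define d where "d = (t + s) / 2"
    have d: "t < d" "d < s" "d < 1" using t s by (auto simp: d_def)
    have "((\<lambda>x. \<tau> (t/2) + integral {t/2..x} (\<lambda>t. p (t, 0))) has_real_derivative p (t, 0)) (at t within {t/2..d})"
      using d t by (auto intro!: derivative_eq_intros integral_has_real_derivative continuous_on_compose2[OF p(1)] continuous_intros simp: segment_AB_def)
    then have "(\<tau> has_real_derivative p (t, 0)) (at t within {t/2..d})"
      by (rule has_field_derivative_transform_within[where d=1]) (use t d s incr[of "t/2" _ 0] in \<open>auto simp: \<tau>_def\<close>)
    then show ?thesis
      using at_within_Icc_at[of "t/2" t d] t d s \<rho>[of t] by simp
  qed
  obtain kx kt where cQ: "continuous_on ({0..1} \<times> {0..1}) Q" and Q11: "C_class 1 1 ({0<..<1} \<times> {0<..<1}) Q"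
    and kt: "continuous_on ({0..1} \<times> {0..1}) kt" "\<And>z. z \<in> {0<..<1} \<times> {0<..<1} \<Longrightarrow> kt z = ddy Q z"
    using Q unfolding C1_upto_def by metis
  \<comment> \<open>The memory term after the derivative has been moved from \<open>\<tau>\<close>
    to \<open>Q\<close>. It is continuous up to \<open>x = 0\<close> and bounded in terms of
    \<open>\<tau>\<close>, although the derivative \<open>\<rho>\<close> of \<open>\<tau>\<close>
    need not be bounded there.\<close>
  define R where "R = (\<lambda>x. \<beta> * (\<tau> x * Q (x, x) - integral {0..x} (\<lambda>t. \<tau> t * kt (x, t))))"
  have parts: "integral {0..x} (\<lambda>t. \<rho> t * Q (x, t)) = \<tau> x * Q (x, x) - integral {0..x} (\<lambda>t. \<tau> t * kt (x, t))"
    if x: "0 < x" "x < s" for x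
  proof -
    have cQx: "continuous_on {0..x} (\<lambda>t. Q (x, t))"
      using x s by (intro continuous_on_compose2[OF cQ] continuous_intros) auto
    have ck: "continuous_on {0..x} (\<lambda>t. \<tau> t * kt (x, t))"
      using x s by (intro continuous_intros continuous_on_subset[OF c\<tau>] continuous_on_compose2[OF kt(1)]) auto
    \<comment> \<open>The error of integrating by parts over \<open>{e..x}\<close>. It vanishes for
      \<open>e > 0\<close>; it is continuous at \<open>e = 0\<close> because indefinite
      Henstock-Kurzweil integrals are, and the boundary term there disappears with
      \<open>\<tau> 0 = 0\<close>.\<close>
    define Z where "Z = (\<lambda>e. integral {e..x} (\<lambda>t. \<rho> t * Q (x, t)) - (\<tau> x * Q (x, x) - \<tau> e * Q (x, e) - integral {e..x} (\<lambda>t. \<tau> t * kt (x, t))))"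
    have "continuous_on {0..x} Z"
      unfolding Z_def using x s
      by (intro continuous_intros cQx indefinite_integral_continuous_1' int continuous_on_subset[OF c\<tau>] integrable_continuous_real ck) auto
    moreover have "Z e = 0" if e: "0 < e" "e \<le> x" for e
    proof -
      have "((\<lambda>t. \<rho> t * Q (x, t) + \<tau> t * kt (x, t)) has_integral (\<tau> x * Q (x, x) - \<tau> e * Q (x, e))) {e..x}"
      proof (rule fundamental_theorem_of_calculus)
        show "((\<lambda>t. \<tau> t * Q (x, t)) has_vector_derivative \<rho> t * Q (x, t) + \<tau> t * kt (x, t)) (at t within {e..x})"
          if t: "t \<in> {e..x}" for t
        proof -
          have "((\<lambda>t. Q (x, t)) has_real_derivative kt (x, t)) (at t)"
            using C_class_DERIV_y[OF Q11, of x t] kt(2)[of "(x, t)"] t e x s by simp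
          then have "((\<lambda>t. \<tau> t * Q (x, t)) has_real_derivative \<rho> t * Q (x, t) + \<tau> t * kt (x, t)) (at t)"
            using \<tau>_deriv[of t] t e x by (auto intro!: derivative_eq_intros)
          then show ?thesis
            by (auto intro: has_field_derivative_at_within simp flip: has_real_derivative_iff_has_vector_derivative)
        qed
      qed (use e in auto)
      moreover have "integral {e..x} (\<lambda>t. \<rho> t * Q (x, t) + \<tau> t * kt (x, t)) =
         integral {e..x} (\<lambda>t. \<rho> t * Q (x, t)) + integral {e..x} (\<lambda>t. \<tau> t * kt (x, t))"
      proof (rule integral_add)
        show "(\<lambda>t. \<rho> t * Q (x, t)) integrable_on {e..x}"
          using int[OF x] by (rule integrable_on_subinterval) (use e in auto)
        show "(\<lambda>t. \<tau> t * kt (x, t)) integrable_on {e..x}"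
          by (rule integrable_continuous_real, rule continuous_on_subset[OF ck]) (use e in auto)
      qed
      ultimately show ?thesis by (simp add: Z_def integral_unique)
    qed
    ultimately have "Z 0 = 0" using x by (intro constant_extends_left[of 0 x Z 0]) auto
    moreover have "\<tau> 0 = 0" using left by (simp add: \<tau>_def)
    ultimately show ?thesis by (simp add: Z_def)
  qed
  have qR: "q (x, 0) = \<alpha> * \<rho> x + R x" if "0 < x" "x < s" for x
    using glue[OF that] parts[OF that] by (simp add: R_def)
  have cR: "continuous_on {0..1} R"
  proof -
    have "continuous_on ({0..1} \<times> {0..1}) (\<lambda>z. \<tau> (snd z) * kt z)"
      by (intro continuous_on_mult kt(1) continuous_on_compose2[OF c\<tau> continuous_on_snd[OF continuous_on_id]]) auto
    from continuous_on_integral_upto[OF this compact_Icc]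
    have "continuous_on ({0..1} \<times> {0..1}) (\<lambda>(x, y). integral {0..y} (\<lambda>t. \<tau> t * kt (x, t)))" by simp
    then have "continuous_on {0..1} (\<lambda>x. (\<lambda>(x, y). integral {0..y} (\<lambda>t. \<tau> t * kt (x, t))) (x, x))"
      by (rule continuous_on_compose2[where f="\<lambda>x. (x, x)"]) (auto intro: continuous_on_Pair continuous_on_id)
    moreover have "continuous_on {0..1} (\<lambda>x. Q (x, x))"
      by (intro continuous_on_compose2[OF cQ] continuous_intros) auto
    ultimately show ?thesis
      unfolding R_def by (auto intro!: continuous_intros c\<tau>)
  qed
  have "bounded (Q ` ({0..1} \<times> {0..1}) \<union> kt ` ({0..1} \<times> {0..1}))"
    by (intro compact_imp_bounded compact_Un compact_continuous_image cQ kt compact_Times compact_Icc)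
  then obtain M where M: "norm r \<le> M" if "r \<in> Q ` ({0..1} \<times> {0..1}) \<union> kt ` ({0..1} \<times> {0..1})" for r
    unfolding bounded_iff by blast
  have MQ: "\<bar>Q (x, t)\<bar> \<le> M" "\<bar>kt (x, t)\<bar> \<le> M" if "x \<in> {0..1}" "t \<in> {0..1}" for x t
    using M[of "Q (x, t)"] M[of "kt (x, t)"] that by auto
  have M0: "M \<ge> 0" using MQ(1)[of 0 0] by simp
  have R_le: "\<bar>R x\<bar> \<le> (\<bar>\<beta>\<bar> * M) * (\<bar>\<tau> x\<bar> + integral {0..x} (\<lambda>t. \<bar>\<tau> t\<bar>))" if x: "x \<in> {0..b}" for x
  proof -
    have "\<bar>integral {0..x} (\<lambda>t. \<tau> t * kt (x, t))\<bar> \<le> integral {0..x} (\<lambda>t. M * \<bar>\<tau> t\<bar>)"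
      unfolding real_norm_def[symmetric]
    proof (rule integral_norm_bound_integral)
      show "(\<lambda>t. \<tau> t * kt (x, t)) integrable_on {0..x}"
        using x b by (intro integrable_continuous_real continuous_intros continuous_on_subset[OF c\<tau>] continuous_on_compose2[OF kt(1)]) auto
      show "(\<lambda>t. M * norm (\<tau> t)) integrable_on {0..x}"
        using x b by (intro integrable_continuous_real continuous_intros continuous_on_subset[OF c\<tau>]) auto
      show "norm (\<tau> t * kt (x, t)) \<le> M * norm (\<tau> t)" if "t \<in> {0..x}" for t
        using mult_right_mono[OF MQ(2)[of x t], of "\<bar>\<tau> t\<bar>"] that x b by (simp add: abs_mult mult.commute)
    qed
    then have 1: "\<bar>integral {0..x} (\<lambda>t. \<tau> t * kt (x, t))\<bar> \<le> M * integral {0..x} (\<lambda>t. \<bar>\<tau> t\<bar>)" by simp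
    have 2: "\<bar>\<tau> x * Q (x, x)\<bar> \<le> M * \<bar>\<tau> x\<bar>"
      using mult_right_mono[OF MQ(1)[of x x], of "\<bar>\<tau> x\<bar>"] x b by (simp add: abs_mult mult.commute)
    have "\<bar>\<tau> x * Q (x, x) - integral {0..x} (\<lambda>t. \<tau> t * kt (x, t))\<bar> \<le> M * (\<bar>\<tau> x\<bar> + integral {0..x} (\<lambda>t. \<bar>\<tau> t\<bar>))"
      using 1 2 by (simp add: algebra_simps)
    then show ?thesis unfolding R_def abs_mult mult.assoc by (intro mult_left_mono) auto
  qed
  define S where "S = (\<lambda>x. integral {0..x} R)"
  have S_deriv: "(S has_real_derivative R x) (at x within {0..1})" if "x \<in> {0..1}" for x
    unfolding S_def by (intro integral_has_real_derivative cR that)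
  have cS: "continuous_on {0..1} S"
    using S_deriv by (meson DERIV_continuous continuous_on_eq_continuous_within)
  define W where "W = (\<lambda>x y. \<alpha> * u (x, 0) + S x + integral {0..y} (\<lambda>z. u (x, z)))"
  define v where "v = (\<lambda>x y. integral {0..x} (\<lambda>t. u (t, y)))"
  have W_deriv: "((W x) has_real_derivative u (x, y)) (at y within {0..1})" if "x \<in> {0..1}" "y \<in> {0..1}" for x y
    unfolding W_def using that by (auto intro!: derivative_eq_intros integral_has_real_derivative cuy)
  have cWx: "continuous_on {0..1} (W x)" if "x \<in> {0..1}" for x
    using W_deriv[OF that] by (meson DERIV_continuous continuous_on_eq_continuous_within)
  have cW: "continuous_on ({0..1} \<times> {0..1}) (\<lambda>(x, y). W x y)"
    unfolding W_def case_prod_beta using continuous_on_integral_upto[OF cu]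
    by (auto intro!: continuous_intros continuous_on_compose2[OF cS] continuous_on_compose2[OF cu] simp: case_prod_beta)
  have v_diff: "integral {e..x} (\<lambda>t. u (t, y)) = v x y - v e y" if "0 \<le> e" "e \<le> x" "x \<le> 1" "y \<in> {0..1}" for e x y
    unfolding v_def using that Henstock_Kurzweil_Integration.integral_combine[where a=0 and c=e and b=x and f="\<lambda>t. u (t, y)"]
    by (force intro!: integrable_continuous_real continuous_on_subset[OF cux])
  \<comment> \<open>The error \<open>H\<close> is constant in \<open>y\<close>: differentiation
    under the integral gives u_yy = u_x, whose time integral is the increment of \<open>u\<close>,
    and \<open>u\<close> is the \<open>y\<close>-derivative of \<open>W\<close>. At
    \<open>y = 0\<close> the error vanishes because the gluing condition makes
    \<open>q (t, 0)\<close> the derivative of \<open>W t 0\<close>.\<close>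
  have flux: "integral {e..x} (\<lambda>t. q (t, y)) = W x y - W e y"
    if ex: "0 < e" "e \<le> x" "x < s" and y: "0 \<le> y" "y < 1" for e x y
  proof -
    define H where "H = (\<lambda>y. integral {e..x} (\<lambda>t. q (t, y)) - (W x y - W e y))"
    have cq: "continuous_on {0..y} (\<lambda>y. integral {e..x} (\<lambda>t. q (t, y)))" if "y < 1" for y
      by (rule integral_continuous_on_param[of _ e x, simplified])
         (use ex s that in \<open>auto simp: Omega0_def segment_AB_def case_prod_beta intro!: continuous_on_compose2[OF q(1)] continuous_intros\<close>)
    have cH: "continuous_on {0..y} H" if "y < 1" for y
      unfolding H_def using ex s that by (intro continuous_intros cq continuous_on_subset[OF cWx]) auto
    have dH: "(H has_real_derivative 0) (at y)" if y: "0 < y" "y < 1" for y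
    proof -
      have "((\<lambda>y. integral {e..x} (\<lambda>t. q (t, y))) has_real_derivative integral {e..x} (\<lambda>t. ddy (ddy u) (t, y))) (at y within {0<..<1})"
      proof (rule leibniz_rule_field_derivative[where a=e and b=x, simplified])
        show "((\<lambda>y. q (t, y)) has_real_derivative ddy (ddy u) (t, y)) (at y within {0<..<1})"
          if "y \<in> {0<..<1}" "e \<le> t \<and> t \<le> x" for y t
        proof (rule has_field_derivative_transform_within[where d=1 and f="\<lambda>y. ddy u (t, y)"])
          show "((\<lambda>y. ddy u (t, y)) has_real_derivative ddy (ddy u) (t, y)) (at y within {0<..<1})"
            using C_class_DERIV_yy[OF u12 _ Om, of t y] that ex s by (auto intro: has_field_derivative_at_within)
        qed (use that ex s q(2) Om in auto)
        show "(\<lambda>t. q (t, y)) integrable_on {e..x}" if "y \<in> {0<..<1}" for y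
          using ex s that by (intro integrable_continuous_real continuous_on_compose2[OF q(1)] continuous_intros)
            (auto simp: Omega0_def segment_AB_def)
        show "continuous_on ({0<..<1} \<times> {e..x}) (\<lambda>(y, t). ddy (ddy u) (t, y))"
          using ex s C_class_continuous(4)[OF u12] unfolding case_prod_beta
          by (intro continuous_on_compose2[where f="\<lambda>z. (snd z, fst z)" and g="ddy (ddy u)"] continuous_intros) (auto simp: Omega0_def)
      qed (use y in auto)
      moreover have "integral {e..x} (\<lambda>t. ddy (ddy u) (t, y)) = integral {e..x} (\<lambda>t. p (t, y))"
        using ex s y heat p(2) Om by (intro integral_cong) auto
      ultimately have "((\<lambda>y. integral {e..x} (\<lambda>t. q (t, y))) has_real_derivative (u (x, y) - u (e, y))) (at y)"
        using incr[of e x y] ex s y by (simp add: at_within_open[of y "{0<..<1}"])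
      moreover have "(W r has_real_derivative u (r, y)) (at y)" if "r \<in> {0..1}" for r
        using W_deriv[OF that, of y] at_within_Icc_at[of 0 y 1] y by simp
      ultimately show ?thesis
        unfolding H_def using ex s by (auto intro!: derivative_eq_intros)
    qed
    have "H y = H 0"
    proof (cases "y = 0")
      case False
      then show ?thesis using y cH[of y] dH by (intro DERIV_isconst_end) auto
    qed auto
    also have "H 0 = 0"
    proof -
      have "((\<lambda>t. q (t, 0)) has_integral (W x 0 - W e 0)) {e..x}"
      proof (rule fundamental_theorem_of_calculus)
        show "((\<lambda>t. W t 0) has_vector_derivative q (t, 0)) (at t within {e..x})" if t: "t \<in> {e..x}" for t
        proof -
          have "(S has_real_derivative R t) (at t)"
            using S_deriv[of t] at_within_Icc_at[of 0 t 1] t ex s by simp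
          then have "((\<lambda>t. W t 0) has_real_derivative q (t, 0)) (at t)"
            unfolding W_def using \<tau>_deriv[of t] qR[of t] t ex
            by (auto intro!: derivative_eq_intros simp: \<tau>_def)
          then show ?thesis
            by (auto intro: has_field_derivative_at_within simp flip: has_real_derivative_iff_has_vector_derivative)
        qed
      qed (use ex in auto)
      then show ?thesis by (simp add: H_def integral_unique)
    qed
    finally show ?thesis by (simp add: H_def)
  qed
  \<comment> \<open>The same argument once more: the \<open>y\<close>-derivative of the time
    integral of \<open>u\<close> is the flux just computed.\<close>
  have v_eq_diff: "v x y - v e y - integral {0..y} (\<lambda>z. W x z - W e z) = v x 0 - v e 0"
    if ex: "0 < e" "e \<le> x" "x < s" and y: "0 \<le> y" "y \<le> 1" for e x y
  proof -
    define H where "H = (\<lambda>y. integral {e..x} (\<lambda>t. u (t, y)) - integral {0..y} (\<lambda>z. W x z - W e z))"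
    have cd: "continuous_on {0..1} (\<lambda>z. W x z - W e z)"
      using ex s by (intro continuous_intros cWx) auto
    have "continuous_on {0..1} (\<lambda>y. integral {e..x} (\<lambda>t. u (t, y)))"
      by (rule integral_continuous_on_param[of _ e x, simplified])
         (use ex s in \<open>auto simp: case_prod_beta intro!: continuous_on_compose2[OF cu] continuous_intros\<close>)
    then have cH: "continuous_on {0..1} H"
      unfolding H_def by (intro continuous_intros indefinite_integral_continuous_1 integrable_continuous_real cd) 
    have dH: "(H has_real_derivative 0) (at y)" if y: "0 < y" "y < 1" for y
    proof -
      have "((\<lambda>y. integral {e..x} (\<lambda>t. u (t, y))) has_real_derivative integral {e..x} (\<lambda>t. q (t, y))) (at y within {0<..<1})"
      proof (rule leibniz_rule_field_derivative[where a=e and b=x, simplified])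
        show "((\<lambda>y. u (t, y)) has_real_derivative q (t, y)) (at y within {0<..<1})"
          if "y \<in> {0<..<1}" "e \<le> t \<and> t \<le> x" for y t
          using C_class_DERIV_y[OF u12 _ Om, of t y] q(2)[OF Om, of t y] that ex s
          by (auto intro: has_field_derivative_at_within)
        show "(\<lambda>t. u (t, y)) integrable_on {e..x}" if "y \<in> {0<..<1}" for y
          using ex s that by (intro integrable_continuous_real continuous_on_subset[OF cux]) auto
        show "continuous_on ({0<..<1} \<times> {e..x}) (\<lambda>(y, t). q (t, y))"
          using ex s unfolding case_prod_beta
          by (intro continuous_on_compose2[OF q(1)] continuous_intros) (auto simp: Omega0_def)
      qed (use y in auto)
      moreover have "((\<lambda>y. integral {0..y} (\<lambda>z. W x z - W e z)) has_real_derivative W x y - W e y) (at y)"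
        using integral_has_real_derivative[OF cd, of y] at_within_Icc_at[of 0 y 1] y by simp
      ultimately show ?thesis
        unfolding H_def using flux[of e x y] ex y by (auto intro!: derivative_eq_intros simp: at_within_open[of y "{0<..<1}"])
    qed
    have "H y = H 0"
      using y by (intro DERIV_isconst2[OF _ cH dH]) auto
    then show ?thesis using v_diff[of e x] ex s y by (simp add: H_def)
  qed
  \<comment> \<open>Here \<open>e\<close> tends to 0, where \<open>Z\<close> vanishes by the initial
    condition.\<close>
  have v_eq: "v x y = v x 0 + integral {0..y} (W x)" if x: "x \<in> {0..b}" and y: "y \<in> {0..1}" for x y
  proof -
    define Z where "Z = (\<lambda>x. v x y - v x 0 - integral {0..y} (W x))"
    have cv: "continuous_on {0..1} (\<lambda>x. v x y)" if "y \<in> {0..1}" for y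
      unfolding v_def by (intro indefinite_integral_continuous_1 integrable_continuous_real cux that)
    have "continuous_on {0..1} (\<lambda>x. integral {0..y} (W x))"
      by (rule integral_continuous_on_param[of _ 0 y, simplified])
         (use y in \<open>auto intro: continuous_on_subset[OF cW]\<close>)
    then have cZ: "continuous_on {0..1} Z"
      unfolding Z_def using y by (intro continuous_intros cv) auto
    have Ze: "Z e = Z x" if "0 < e" "e \<le> x" for e
    proof -
      have "integral {0..y} (\<lambda>z. W x z - W e z) = integral {0..y} (W x) - integral {0..y} (W e)"
        using x y that b by (intro integral_diff integrable_continuous_real continuous_on_subset[OF cWx]) auto
      then show ?thesis using v_eq_diff[of e x y] x y that b by (simp add: Z_def)
    qed
    have "Z 0 = Z x"
    proof (cases "x = 0")
      case False
      show ?thesis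
      proof (rule constant_extends_left[of 0 x Z "Z x"])
        show "continuous_on {0..x} Z" using x b by (auto intro: continuous_on_subset[OF cZ])
      qed (use False x in \<open>auto intro: Ze\<close>)
    qed auto
    moreover have "Z 0 = 0"
    proof -
      have "W 0 z = 0" if "z \<in> {0..y}" for z
      proof -
        have "integral {0..z} (\<lambda>z. u (0, z)) = 0"
          using left that y by (intro integral_unique has_integral_is_0) auto
        then show ?thesis using left by (simp add: W_def S_def)
      qed
      then have "integral {0..y} (W 0) = 0" by (intro integral_unique has_integral_is_0) auto
      then show ?thesis by (simp add: Z_def v_def)
    qed
    ultimately show ?thesis by (simp add: Z_def)
  qed
  have xb: "x < b" "b < 1" using b by auto
  interpret heat_trace b "\<lambda>x y. u (x, y)" \<alpha> S W v
  proof
    show "continuous_on ({0..b} \<times> {0..1}) (\<lambda>(x, y). u (x, y))"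
      using b by (auto intro: continuous_on_subset[OF cu])
    show "continuous_on {0..b} S" using b by (auto intro: continuous_on_subset[OF cS])
    show "S 0 = 0" by (simp add: S_def)
    show "v x y = v x 0 + integral {0..y} (W x)" if "x \<in> {0..b}" "y \<in> {0..1}" for x y
      using that by (rule v_eq)
  qed (use b left top in \<open>auto simp: W_def v_def\<close>)
  show ?thesis
  proof (cases "\<alpha> = 0")
    case True
    show ?thesis
    proof (rule vanishes_static[OF True, where R=R and C="\<bar>\<beta>\<bar> * M"])
      show "continuous_on {0..b} R" using b by (auto intro: continuous_on_subset[OF cR])
    qed (use M0 R_le x y xb in \<open>auto simp: S_def \<tau>_def\<close>)
  next
    case False
    show ?thesis
    proof (rule vanishes_dynamic[OF False, where C="2 * (\<bar>\<beta>\<bar> * M)"])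
      fix x assume x: "x \<in> {0..b}"
      define J where "J = integral {0..x} (\<lambda>t. \<bar>\<tau> t\<bar>)"
      have cx: "continuous_on {0..x} \<tau>" "continuous_on {0..x} R"
        using x b by (auto intro: continuous_on_subset[OF c\<tau>] continuous_on_subset[OF cR])
      \<comment> \<open>Integrating \<open>R_le\<close> bounds \<open>S\<close> by a multiple of
        \<open>J + J * x\<close>; the factor 2 in the constant comes from
        \<open>x \<le> 1\<close>.\<close>
      have "\<bar>S x\<bar> \<le> integral {0..x} (\<lambda>t. (\<bar>\<beta>\<bar> * M) * (\<bar>\<tau> t\<bar> + J))"
        unfolding S_def real_norm_def[symmetric]
      proof (rule integral_norm_bound_integral)
        show "R integrable_on {0..x}" by (intro integrable_continuous_real cx)
        show "(\<lambda>t. norm \<beta> * M * (norm (\<tau> t) + J)) integrable_on {0..x}"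
          by (intro integrable_continuous_real continuous_intros cx)
        show "norm (R t) \<le> norm \<beta> * M * (norm (\<tau> t) + J)" if t: "t \<in> {0..x}" for t
        proof -
          have "integral {0..t} (\<lambda>t. \<bar>\<tau> t\<bar>) \<le> J" unfolding J_def using t
            by (intro integral_subset_le integrable_continuous_real continuous_intros continuous_on_subset[OF cx(1)]) auto
          then have "(\<bar>\<beta>\<bar> * M) * (\<bar>\<tau> t\<bar> + integral {0..t} (\<lambda>t. \<bar>\<tau> t\<bar>)) \<le> (\<bar>\<beta>\<bar> * M) * (\<bar>\<tau> t\<bar> + J)"
            using M0 by (intro mult_left_mono) auto
          then show ?thesis using R_le[of t] t x by auto
        qed
      qed
      also have "\<dots> = (\<bar>\<beta>\<bar> * M) * (J + J * x)"
      proof -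
        have "integral {0..x} (\<lambda>t. \<bar>\<tau> t\<bar> + J) = J + J * x"
          unfolding J_def using x by (subst integral_add) (auto intro!: integrable_continuous_real continuous_intros cx)
        then show ?thesis by simp
      qed
      also have "\<dots> \<le> (\<bar>\<beta>\<bar> * M) * (J + J * 1)"
      proof -
        have "J \<ge> 0" unfolding J_def by (intro integral_nonneg integrable_continuous_real continuous_intros cx) auto
        then show ?thesis using M0 x b by (intro mult_left_mono add_left_mono) auto
      qed
      finally show "\<bar>S x\<bar> \<le> 2 * (\<bar>\<beta>\<bar> * M) * integral {0..x} (\<lambda>t. \<bar>u (t, 0)\<bar>)"
        by (simp add: J_def \<tau>_def)
    qed (use x xb y in auto)
  qed
qed

section \<open>The wave equation without mixed derivatives\<close>

text \<open>The classes speak only of partial derivatives. Total differentiability, on which the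
  chain rule rests, follows because one of the two, \<open>ddy u\<close>, exists and is continuous
  on a neighbouring box.\<close>

lemma C_class_directional_DERIV:
  assumes D: "open D" and u: "C_class i j D u" "0 < i" "0 < j"
    and z: "(x + c * \<sigma>, y + d * \<sigma>) \<in> D"
  shows "((\<lambda>\<sigma>. u (x + c * \<sigma>, y + d * \<sigma>)) has_real_derivative
    c * ddx u (x + c * \<sigma>, y + d * \<sigma>) + d * ddy u (x + c * \<sigma>, y + d * \<sigma>)) (at \<sigma>)"
proof -
  define X where "X = x + c * \<sigma>" 
  define Y where "Y = y + d * \<sigma>"
  obtain A B where AB: "open A" "open B" "X \<in> A" "Y \<in> B" "A \<times> B \<subseteq> D"
    using open_prod_elim[OF D z] unfolding X_def Y_def by (metis mem_Sigma_iff)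
  obtain e where e: "e > 0" "ball Y e \<subseteq> B"
    using AB(2,4) by (auto simp: open_contains_ball)
  have "((\<lambda>(x, y). u (x, y)) has_derivative (\<lambda>(tx, ty). tx * ddx u (X, Y) + blinfun_scaleR_left (ddy u (X, Y)) ty)) (at (X, Y) within A \<times> ball Y e)"
  proof (rule has_derivative_partialsI)
    have "((\<lambda>x. u (x, Y)) has_derivative (*) (ddx u (X, Y))) (at X within A)"
      using C_class_DERIV_x[OF u(1,2), of X Y] AB
      by (auto simp: has_field_derivative_def intro: has_derivative_at_withinI)
    then show "((\<lambda>x. u (x, Y)) has_derivative (\<lambda>tx. tx * ddx u (X, Y))) (at X within A)"
      by (rule has_derivative_eq_rhs) (auto simp: fun_eq_iff)
    show "((\<lambda>y. u (x, y)) has_derivative blinfun_apply (blinfun_scaleR_left (ddy u (x, y)))) (at y within ball Y e)"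
      if xy: "x \<in> A" "y \<in> ball Y e" for x y
    proof -
      have "(x, y) \<in> D" using xy AB e by auto
      then have "((\<lambda>y. u (x, y)) has_derivative (*) (ddy u (x, y))) (at y within ball Y e)"
        using C_class_DERIV_y[OF u(1,3), of x y]
        by (auto simp: has_field_derivative_def intro: has_derivative_at_withinI)
      then show ?thesis
        by (rule has_derivative_eq_rhs) (auto simp: fun_eq_iff)
    qed
    have "continuous (at (X, Y)) (ddy u)"
      using C_class_continuous(3)[OF u(1,3)] D AB
      by (auto simp: continuous_on_eq_continuous_at)
    then show "continuous (at (X, Y) within A \<times> ball Y e) (\<lambda>(x, y). blinfun_scaleR_left (ddy u (x, y)))"
      unfolding case_prod_beta prod.collapse
      by (rule bounded_linear.continuous[OF bounded_linear_blinfun_scaleR_left continuous_at_imp_continuous_at_within])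
    show "Y \<in> ball Y e" using e by simp
    show "convex (ball Y e)" by (rule convex_ball)
  qed
  then have du: "(u has_derivative (\<lambda>(tx, ty). tx * ddx u (X, Y) + ty * ddy u (X, Y))) (at (X, Y))"
    using at_within_open[of "(X, Y)" "A \<times> ball Y e"] AB(1,3) e(1) by (simp add: open_Times mult.commute)
  have "((\<lambda>\<sigma>. (x + c * \<sigma>, y + d * \<sigma>)) has_derivative (\<lambda>t. (c * t, d * t))) (at \<sigma>)"
    by (auto intro!: derivative_eq_intros)
  from has_derivative_compose[OF this du[unfolded X_def Y_def]] show ?thesis
    unfolding has_field_derivative_def by (rule has_derivative_eq_rhs) (auto simp: fun_eq_iff algebra_simps)
qed

text \<open>The quotient is the mean of \<open>p\<close> over the square of side \<open>a\<close> at
  the corner, so it converges by continuity of \<open>p\<close> there.\<close>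

lemma corner_average_limit:
  fixes g :: "real \<Rightarrow> real \<Rightarrow> real" and p :: "real \<times> real \<Rightarrow> real"
  assumes a0: "0 < a0"
    and g: "\<And>r t. r \<in> {0..a0} \<Longrightarrow> t \<in> {0..a0} \<Longrightarrow> ((\<lambda>r. g r t) has_real_derivative p (r, t)) (at r within {0..a0})"
    and cg: "\<And>r. r \<in> {0..a0} \<Longrightarrow> continuous_on {0..a0} (g r)"
    and p: "continuous_on ({0..a0} \<times> {0..a0}) p"
  shows "((\<lambda>a. integral {0..a} (\<lambda>t. g a t - g 0 t) / a\<^sup>2) \<longlongrightarrow> p (0, 0)) (at_right 0)"
proof (rule tendstoI)
  fix \<epsilon> :: real assume \<epsilon>: "\<epsilon> > 0"
  have "\<exists>\<delta>>0. \<forall>z\<in>{0..a0} \<times> {0..a0}. dist z (0, 0) < \<delta> \<longrightarrow> dist (p z) (p (0, 0)) < \<epsilon> / 2"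
    using p a0 \<epsilon> unfolding continuous_on_iff by (metis atLeastAtMost_iff half_gt_zero le_numeral_extra(3) less_imp_le mem_Sigma_iff)
  then obtain \<delta> where \<delta>: "\<delta> > 0" "\<And>z. z \<in> {0..a0} \<times> {0..a0} \<Longrightarrow> dist z (0, 0) < \<delta> \<Longrightarrow> dist (p z) (p (0, 0)) < \<epsilon> / 2"
    by blast
  have "dist (integral {0..a} (\<lambda>t. g a t - g 0 t) / a\<^sup>2) (p (0, 0)) < \<epsilon>" if a: "0 < a" "a < min a0 (\<delta> / 2)" for a
  proof -
    have small: "\<bar>p (r, t) - p (0, 0)\<bar> \<le> \<epsilon> / 2" if "r \<in> {0..a}" "t \<in> {0..a}" for r t
    proof -
      have "dist (r, t) (0, 0) \<le> \<bar>r\<bar> + \<bar>t\<bar>"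
        using sqrt_sum_squares_le_sum_abs[of r t] by (simp add: dist_prod_def dist_real_def)
      also have "\<dots> < \<delta>" using that a by auto
      finally show ?thesis using \<delta>(2)[of "(r, t)"] that a by (force simp: dist_real_def)
    qed
    have bnd: "norm (g a t - g 0 t - a * p (0, 0)) \<le> a * (\<epsilon> / 2)" if t: "t \<in> {0..a}" for t
    proof -
      have "norm ((g a t - p (0, 0) * a) - (g 0 t - p (0, 0) * 0)) \<le> (\<epsilon> / 2) * norm (a - 0)"
      proof (rule field_differentiable_bound[of "{0..a}" "\<lambda>r. g r t - p (0, 0) * r" "\<lambda>r. p (r, t) - p (0, 0)"])
        show "((\<lambda>r. g r t - p (0, 0) * r) has_real_derivative p (r, t) - p (0, 0)) (at r within {0..a})"
          if "r \<in> {0..a}" for r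
        proof -
          have "((\<lambda>r. g r t) has_real_derivative p (r, t)) (at r within {0..a})"
            by (rule DERIV_subset[OF g]) (use that t a in auto)
          then show ?thesis by (auto intro!: derivative_eq_intros)
        qed
        show "norm (p (r, t) - p (0, 0)) \<le> \<epsilon> / 2" if "r \<in> {0..a}" for r
          using small[OF that t] by simp
      qed (use a in auto)
      moreover have "(g a t - p (0, 0) * a) - (g 0 t - p (0, 0) * 0) = g a t - g 0 t - a * p (0, 0)"
        by simp
      moreover have "(\<epsilon> / 2) * norm (a - 0) = a * (\<epsilon> / 2)" using a by simp
      ultimately show ?thesis by (simp only:)
    qed
    have int: "(\<lambda>t. g a t - g 0 t) integrable_on {0..a}"
      using a by (intro integrable_continuous_real continuous_intros continuous_on_subset[OF cg]) auto
    have "norm (integral {0..a} (\<lambda>t. g a t - g 0 t - a * p (0, 0))) \<le> integral {0..a} (\<lambda>t. a * (\<epsilon> / 2))"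
    proof (rule integral_norm_bound_integral[OF _ _ bnd])
      show "(\<lambda>t. g a t - g 0 t - a * p (0, 0)) integrable_on {0..a}"
        by (intro integrable_diff[OF int] integrable_const_ivl)
    qed auto
    also have "integral {0..a} (\<lambda>t. g a t - g 0 t - a * p (0, 0)) = integral {0..a} (\<lambda>t. g a t - g 0 t) - a * (a * p (0, 0))"
      using int a by (subst integral_diff) auto
    finally have "\<bar>integral {0..a} (\<lambda>t. g a t - g 0 t) - a\<^sup>2 * p (0, 0)\<bar> \<le> a\<^sup>2 * (\<epsilon> / 2)"
      using a by (simp add: power2_eq_square mult.assoc)
    then have "\<bar>(integral {0..a} (\<lambda>t. g a t - g 0 t) - a\<^sup>2 * p (0, 0)) / a\<^sup>2\<bar> \<le> \<epsilon> / 2"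
      using a by (simp add: abs_divide divide_le_eq mult.commute)
    then show ?thesis using a \<epsilon> by (simp add: dist_real_def diff_divide_distrib)
  qed
  then show "\<forall>\<^sub>F a in at_right 0. dist (integral {0..a} (\<lambda>t. g a t - g 0 t) / a\<^sup>2) (p (0, 0)) < \<epsilon>"
    unfolding eventually_at_right_field using a0 \<delta> by (intro exI[of _ "min a0 (\<delta> / 2)"]) auto
qed

text \<open>The mixed derivatives of \<open>u\<close> need not exist, so the invariance is proved for averages
  over small squares.\<close>

lemma wave_invariant:
  assumes D: "open D" and u: "C_class 2 2 D u" and a0: "0 < a0" and L: "0 \<le> L"
    and strip: "\<And>\<sigma> r t. \<sigma> \<in> {0..L} \<Longrightarrow> r \<in> {0..a0} \<Longrightarrow> t \<in> {0..a0} \<Longrightarrow>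
       (x + \<sigma> + r, y + \<sigma> + t) \<in> D \<and>
       ddx (ddx u) (x + \<sigma> + r, y + \<sigma> + t) = ddy (ddy u) (x + \<sigma> + r, y + \<sigma> + t)"
  shows "ddx u (x + L, y + L) - ddy u (x + L, y + L) = ddx u (x, y) - ddy u (x, y)"
proof -
  have inD: "(x + \<sigma> + r, y + \<sigma> + t) \<in> D" if "\<sigma> \<in> {0..L}" "r \<in> {0..a0}" "t \<in> {0..a0}" for \<sigma> r t
    using strip[OF that] by simp
  have cu: "continuous_on D u" using u by (auto simp: C_class_def dest: spec[of _ 0])
  note c = C_class_continuous[OF u, simplified]
  \<comment> \<open>Integrated over \<open>t\<close> from 0 to \<open>a\<close>, this is the
    integral of \<open>ddx u - ddy u\<close> over the square of side \<open>a\<close> with lower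
    left corner \<open>(x + \<sigma>, y + \<sigma>)\<close>, written with values of \<open>u\<close>
    on the edges only.\<close>
  define G where "G = (\<lambda>a \<sigma> t. (u (x + \<sigma> + a, y + \<sigma> + t) - u (x + \<sigma>, y + \<sigma> + t))
     - (u (x + \<sigma> + t, y + \<sigma> + a) - u (x + \<sigma> + t, y + \<sigma>)))"
  define S where "S = (\<lambda>z. ddx u z + ddy u z)"
  have cS: "continuous_on D S" unfolding S_def by (intro continuous_intros c)
  define G' where "G' = (\<lambda>a \<sigma> t. (S (x + \<sigma> + a, y + \<sigma> + t) - S (x + \<sigma>, y + \<sigma> + t))
     - (S (x + \<sigma> + t, y + \<sigma> + a) - S (x + \<sigma> + t, y + \<sigma>)))"
  have shift: "((\<lambda>\<sigma>. u (x + \<sigma> + r, y + \<sigma> + t)) has_real_derivative S (x + \<sigma> + r, y + \<sigma> + t)) (at \<sigma> within A)"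
    if "\<sigma> \<in> {0..L}" "r \<in> {0..a0}" "t \<in> {0..a0}" for \<sigma> r t A
    using C_class_directional_DERIV[OF D u, of "x + r" 1 \<sigma> "y + t" 1] inD[OF that]
    by (auto simp: S_def algebra_simps intro: has_field_derivative_at_within)
  \<comment> \<open>The derivative of \<open>G\<close> along the characteristic involves u_x + u_y
    on the four edges. The tangential derivatives integrate to the same alternating sum of corner
    values of \<open>u\<close> and cancel; the normal derivatives give the integrals of u_xx and
    u_yy over the square, which agree by the wave equation.\<close>
  have zero: "integral {0..a} (G' a \<sigma>) = 0" if a: "a \<in> {0..a0}" and \<sigma>: "\<sigma> \<in> {0..L}" for a \<sigma>
  proof -
    define X where "X = x + \<sigma>"
    define Y where "Y = y + \<sigma>"
    have XY: "(X + r, Y + t) \<in> D" if "r \<in> {0..a}" "t \<in> {0..a}" for r t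
      using inD[OF \<sigma>, of r t] that a by (simp add: X_def Y_def)
    have XY0: "(X, Y + t) \<in> D" "(X + t, Y) \<in> D" if "t \<in> {0..a}" for t
      using XY[of 0 t] XY[of t 0] that a by auto
    have cont: "continuous_on {0..a} (\<lambda>t. h (X + r, Y + t))" "continuous_on {0..a} (\<lambda>t. h (X + t, Y + r))"
       "continuous_on {0..a} (\<lambda>t. h (X, Y + t))" "continuous_on {0..a} (\<lambda>t. h (X + t, Y))"
      if "continuous_on D h" "r \<in> {0..a}" for h :: "real \<times> real \<Rightarrow> real" and r
      using XY XY0 that by (auto intro!: continuous_on_compose2[OF that(1)] continuous_intros)
    have ix: "integral {0..a} (\<lambda>t. ddx h (X + t, Y + r)) = h (X + a, Y + r) - h (X, Y + r)"
      if "r \<in> {0..a}" and h: "\<And>x y. (x, y) \<in> D \<Longrightarrow> ((\<lambda>t. h (t, y)) has_real_derivative ddx h (x, y)) (at x)" for h r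
    proof -
      have "((\<lambda>t. ddx h (X + t, Y + r)) has_integral (h (X + a, Y + r) - h (X + 0, Y + r))) {0..a}"
      proof (rule fundamental_theorem_of_calculus)
        show "((\<lambda>t. h (X + t, Y + r)) has_vector_derivative ddx h (X + t, Y + r)) (at t within {0..a})"
          if t: "t \<in> {0..a}" for t
          using h[OF XY[OF t \<open>r \<in> {0..a}\<close>]] DERIV_at_within_shift[of "\<lambda>t. h (t, Y + r)" "ddx h (X + t, Y + r)" X t UNIV]
          by (auto intro: has_field_derivative_at_within simp flip: has_real_derivative_iff_has_vector_derivative)
      qed (use a in auto)
      then show ?thesis by (simp add: integral_unique)
    qed
    have iy: "integral {0..a} (\<lambda>t. ddy h (X + r, Y + t)) = h (X + r, Y + a) - h (X + r, Y)"
      if "r \<in> {0..a}" and h: "\<And>x y. (x, y) \<in> D \<Longrightarrow> ((\<lambda>t. h (x, t)) has_real_derivative ddy h (x, y)) (at y)" for h r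
    proof -
      have "((\<lambda>t. ddy h (X + r, Y + t)) has_integral (h (X + r, Y + a) - h (X + r, Y + 0))) {0..a}"
      proof (rule fundamental_theorem_of_calculus)
        show "((\<lambda>t. h (X + r, Y + t)) has_vector_derivative ddy h (X + r, Y + t)) (at t within {0..a})"
          if t: "t \<in> {0..a}" for t
          using h[OF XY[OF \<open>r \<in> {0..a}\<close> t]] DERIV_at_within_shift[of "\<lambda>t. h (X + r, t)" "ddy h (X + r, Y + t)" Y t UNIV]
          by (auto intro: has_field_derivative_at_within simp flip: has_real_derivative_iff_has_vector_derivative)
      qed (use a in auto)
      then show ?thesis by (simp add: integral_unique)
    qed
    have a': "a \<in> {0..a}" "0 \<in> {0..a}" using a by auto
    note ux = C_class_DERIV_x[OF u, simplified] and uy = C_class_DERIV_y[OF u, simplified]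
      and uxx = C_class_DERIV_xx[OF u, simplified] and uyy = C_class_DERIV_yy[OF u, simplified]
    let ?i = "\<lambda>f. integral {0..a} (f :: real \<Rightarrow> real)"
    have ii: "f integrable_on {0..a}" if "continuous_on {0..a} f" for f :: "real \<Rightarrow> real"
      using that by (rule integrable_continuous_real)
    have dx: "?i (\<lambda>t. ddx u (X + a, Y + t)) - ?i (\<lambda>t. ddx u (X, Y + t)) = ?i (\<lambda>t. ?i (\<lambda>r. ddx (ddx u) (X + r, Y + t)))"
    proof -
      have "?i (\<lambda>t. ?i (\<lambda>r. ddx (ddx u) (X + r, Y + t))) = ?i (\<lambda>t. ddx u (X + a, Y + t) - ddx u (X, Y + t))"
        by (intro integral_cong ix uxx)
      then show ?thesis by (subst integral_diff[symmetric]) (auto intro!: ii cont c a')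
    qed
    have dy: "?i (\<lambda>t. ddy u (X + t, Y + a)) - ?i (\<lambda>t. ddy u (X + t, Y)) = ?i (\<lambda>r. ?i (\<lambda>t. ddy (ddy u) (X + r, Y + t)))"
    proof -
      have "?i (\<lambda>r. ?i (\<lambda>t. ddy (ddy u) (X + r, Y + t))) = ?i (\<lambda>r. ddy u (X + r, Y + a) - ddy u (X + r, Y))"
        by (intro integral_cong iy uyy)
      then show ?thesis by (subst integral_diff[symmetric]) (auto intro!: ii cont c a')
    qed
    have "?i (\<lambda>t. ?i (\<lambda>r. ddx (ddx u) (X + r, Y + t))) = ?i (\<lambda>t. ?i (\<lambda>r. ddy (ddy u) (X + r, Y + t)))"
      by (intro integral_cong) (use strip[OF \<sigma>] a in \<open>auto simp: X_def Y_def\<close>)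
    also have "\<dots> = ?i (\<lambda>r. ?i (\<lambda>t. ddy (ddy u) (X + r, Y + t)))"
    proof -
      have "continuous_on (cbox (0, 0) (a, a)) (\<lambda>(t, r). ddy (ddy u) (X + r, Y + t))"
        unfolding case_prod_beta using XY
        by (intro continuous_on_compose2[OF c(4)] continuous_intros) (auto simp: cbox_Pair_eq)
      from integral_swap_continuous[OF this] show ?thesis by simp
    qed
    finally have main: "?i (\<lambda>t. ddx u (X + a, Y + t)) - ?i (\<lambda>t. ddx u (X, Y + t)) =
       ?i (\<lambda>t. ddy u (X + t, Y + a)) - ?i (\<lambda>t. ddy u (X + t, Y))"
      using dx dy by simp
    have "?i (G' a \<sigma>) = (?i (\<lambda>t. S (X + a, Y + t)) - ?i (\<lambda>t. S (X, Y + t))) - (?i (\<lambda>t. S (X + t, Y + a)) - ?i (\<lambda>t. S (X + t, Y)))"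
      unfolding G'_def X_def[symmetric] Y_def[symmetric]
      by (simp only: integral_diff integrable_diff ii cont[OF cS a'(1)])
    moreover have "?i (\<lambda>t. S (X + a, Y + t)) = ?i (\<lambda>t. ddx u (X + a, Y + t)) + (u (X + a, Y + a) - u (X + a, Y))"
      using iy[OF a'(1) uy] unfolding S_def by (subst integral_add) (auto intro!: ii cont c a')
    moreover have "?i (\<lambda>t. S (X, Y + t)) = ?i (\<lambda>t. ddx u (X, Y + t)) + (u (X, Y + a) - u (X, Y))"
      using iy[OF a'(2) uy] unfolding S_def by (subst integral_add) (auto intro!: ii cont c a')
    moreover have "?i (\<lambda>t. S (X + t, Y + a)) = (u (X + a, Y + a) - u (X, Y + a)) + ?i (\<lambda>t. ddy u (X + t, Y + a))"
      using ix[OF a'(1) ux] unfolding S_def by (subst integral_add) (auto intro!: ii cont c a')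
    moreover have "?i (\<lambda>t. S (X + t, Y)) = (u (X + a, Y) - u (X, Y)) + ?i (\<lambda>t. ddy u (X + t, Y))"
      using ix[OF a'(2) ux] unfolding S_def by (subst integral_add) (auto intro!: ii cont c a')
    ultimately show ?thesis using main by simp
  qed
  have inD0: "(x + \<sigma>, y + \<sigma> + t) \<in> D" "(x + \<sigma> + t, y + \<sigma>) \<in> D" if "\<sigma> \<in> {0..L}" "t \<in> {0..a0}" for \<sigma> t
    using inD[OF that(1), of 0 t] inD[OF that(1), of t 0] that(2) a0 by auto
  have const: "integral {0..a} (G a L) = integral {0..a} (G a 0)" if a: "a \<in> {0..a0}" for a
  proof (cases "L = 0")
    case False
    have deriv: "((\<lambda>\<sigma>. integral {0..a} (G a \<sigma>)) has_real_derivative 0) (at \<sigma> within {0..L})" if \<sigma>: "\<sigma> \<in> {0..L}" for \<sigma>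
    proof -
      have "((\<lambda>\<sigma>. integral {0..a} (G a \<sigma>)) has_real_derivative integral {0..a} (G' a \<sigma>)) (at \<sigma> within {0..L})"
      proof (rule leibniz_rule_field_derivative[where a=0 and b=a, simplified])
      show "((\<lambda>\<sigma>. G a \<sigma> t) has_real_derivative G' a \<sigma> t) (at \<sigma> within {0..L})"
        if "\<sigma> \<in> {0..L}" "0 \<le> t \<and> t \<le> a" for \<sigma> t
        unfolding G_def G'_def using that a shift[of \<sigma> 0 t] shift[of \<sigma> t 0] shift[of \<sigma> a t] shift[of \<sigma> t a]
        by (intro DERIV_diff) auto
      show "G a \<sigma> integrable_on {0..a}" if "\<sigma> \<in> {0..L}" for \<sigma>
        unfolding G_def using that a inD inD0
        by (intro integrable_continuous_real continuous_intros continuous_on_compose2[OF cu]) auto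
      show "continuous_on ({0..L} \<times> {0..a}) (\<lambda>(\<sigma>, t). G' a \<sigma> t)"
        unfolding G'_def case_prod_beta using a inD inD0
        by (intro continuous_intros continuous_on_compose2[OF cS]) auto
      qed (use \<sigma> in auto)
      then show ?thesis using zero[OF a \<sigma>] by simp
    qed
    have "continuous_on {0..L} (\<lambda>\<sigma>. integral {0..a} (G a \<sigma>))"
      using deriv by (meson DERIV_continuous continuous_on_eq_continuous_within)
    then show ?thesis
    proof (rule DERIV_isconst_end[rotated])
      show "DERIV (\<lambda>\<sigma>. integral {0..a} (G a \<sigma>)) \<sigma> :> 0" if "0 < \<sigma>" "\<sigma> < L" for \<sigma>
        using deriv[of \<sigma>] that at_within_Icc_at[of 0 \<sigma> L] by simp
    qed (use False L in auto)
  qed auto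
  have lim: "((\<lambda>a. integral {0..a} (G a \<sigma>) / a\<^sup>2) \<longlongrightarrow> ddx u (x + \<sigma>, y + \<sigma>) - ddy u (x + \<sigma>, y + \<sigma>)) (at_right 0)"
    if \<sigma>: "\<sigma> \<in> {0..L}" for \<sigma>
  proof -
    define X where "X = x + \<sigma>"
    define Y where "Y = y + \<sigma>"
    have XY: "(X + r, Y + t) \<in> D" if "r \<in> {0..a0}" "t \<in> {0..a0}" for r t
      using inD[OF \<sigma>, of r t] that by (simp add: X_def Y_def)
    have XY0: "(X, Y + t) \<in> D" "(X + t, Y) \<in> D" if "t \<in> {0..a0}" for t
      using XY[of 0 t] XY[of t 0] that a0 by auto
    have 1: "((\<lambda>a. integral {0..a} (\<lambda>t. u (X + a, Y + t) - u (X + 0, Y + t)) / a\<^sup>2) \<longlongrightarrow> (\<lambda>(r, t). ddx u (X + r, Y + t)) (0, 0)) (at_right 0)"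
    proof (rule corner_average_limit[OF a0])
      show "((\<lambda>r. u (X + r, Y + t)) has_real_derivative (\<lambda>(r, t). ddx u (X + r, Y + t)) (r, t)) (at r within {0..a0})"
        if "r \<in> {0..a0}" "t \<in> {0..a0}" for r t
        using C_class_directional_DERIV[OF D u, of X 1 r "Y + t" 0] XY[OF that]
        by (auto intro: has_field_derivative_at_within)
      show "continuous_on {0..a0} (\<lambda>t. u (X + r, Y + t))" if "r \<in> {0..a0}" for r
        using XY that by (intro continuous_on_compose2[OF cu] continuous_intros) auto
      show "continuous_on ({0..a0} \<times> {0..a0}) (\<lambda>(r, t). ddx u (X + r, Y + t))"
        unfolding case_prod_beta using XY by (intro continuous_on_compose2[OF c(1)] continuous_intros) auto
    qed
    have 2: "((\<lambda>a. integral {0..a} (\<lambda>t. u (X + t, Y + a) - u (X + t, Y + 0)) / a\<^sup>2) \<longlongrightarrow> (\<lambda>(r, t). ddy u (X + t, Y + r)) (0, 0)) (at_right 0)"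
    proof (rule corner_average_limit[OF a0])
      show "((\<lambda>r. u (X + t, Y + r)) has_real_derivative (\<lambda>(r, t). ddy u (X + t, Y + r)) (r, t)) (at r within {0..a0})"
        if "r \<in> {0..a0}" "t \<in> {0..a0}" for r t
        using C_class_directional_DERIV[OF D u, of "X + t" 0 r "Y" 1] XY[OF that(2,1)]
        by (auto intro: has_field_derivative_at_within)
      show "continuous_on {0..a0} (\<lambda>t. u (X + t, Y + r))" if "r \<in> {0..a0}" for r
        using XY that by (intro continuous_on_compose2[OF cu] continuous_intros) auto
      show "continuous_on ({0..a0} \<times> {0..a0}) (\<lambda>(r, t). ddy u (X + t, Y + r))"
        unfolding case_prod_beta using XY by (intro continuous_on_compose2[OF c(3)] continuous_intros) auto
    qed
    have "\<forall>\<^sub>F a in at_right 0. integral {0..a} (\<lambda>t. u (X + a, Y + t) - u (X + 0, Y + t)) / a\<^sup>2 -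
        integral {0..a} (\<lambda>t. u (X + t, Y + a) - u (X + t, Y + 0)) / a\<^sup>2 = integral {0..a} (G a \<sigma>) / a\<^sup>2"
      unfolding eventually_at_right_field
    proof (intro exI[of _ a0] conjI allI impI)
      fix a :: real assume a: "0 < a" "a < a0"
      have "integral {0..a} (G a \<sigma>) = integral {0..a} (\<lambda>t. u (X + a, Y + t) - u (X + 0, Y + t)) -
         integral {0..a} (\<lambda>t. u (X + t, Y + a) - u (X + t, Y + 0))"
        unfolding G_def X_def[symmetric] Y_def[symmetric] add_0_right using a XY XY0
        by (intro integral_diff integrable_continuous_real continuous_intros continuous_on_compose2[OF cu]) auto
      then show "integral {0..a} (\<lambda>t. u (X + a, Y + t) - u (X + 0, Y + t)) / a\<^sup>2 -
        integral {0..a} (\<lambda>t. u (X + t, Y + a) - u (X + t, Y + 0)) / a\<^sup>2 = integral {0..a} (G a \<sigma>) / a\<^sup>2"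
        by (simp add: diff_divide_distrib)
    qed (rule a0)
    from Lim_transform_eventually[OF tendsto_diff[OF 1 2] this] show ?thesis
      by (simp add: X_def Y_def)
  qed
  have "\<forall>\<^sub>F a in at_right 0. integral {0..a} (G a L) / a\<^sup>2 = integral {0..a} (G a 0) / a\<^sup>2"
    unfolding eventually_at_right_field using const a0 by (intro exI[of _ a0]) auto
  from Lim_transform_eventually[OF lim[of L] this] L
  have "((\<lambda>a. integral {0..a} (G a 0) / a\<^sup>2) \<longlongrightarrow> ddx u (x + L, y + L) - ddy u (x + L, y + L)) (at_right 0)" by simp
  from tendsto_unique[OF _ this lim[of 0]] L show ?thesis by simp
qed

section \<open>The domain and a consequence of unique solvability\<close>

lemma C_class_mono: "C_class i j D u \<Longrightarrow> i' \<le> i \<Longrightarrow> j' \<le> j \<Longrightarrow> C_class i' j' D u"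
  unfolding C_class_def by (meson le_trans order.strict_trans2)

lemma boundary_value_eq:
  assumes p: "continuous_on S p" and eq: "\<And>z. z \<in> D \<Longrightarrow> p z = g z" and "D \<subseteq> S" "z \<in> S" "z islimpt D"
  shows "boundary_value D g z = p z"
proof -
  have "(p \<longlongrightarrow> p z) (at z within D)"
    using p assms(3,4) by (meson continuous_on_def tendsto_within_subset)
  then have "(g \<longlongrightarrow> p z) (at z within D)"
    by (rule Lim_transform_eventually) (auto simp: eventually_at_filter eq)
  then show ?thesis
    unfolding boundary_value_def using assms(5) by (intro tendsto_Lim) (auto simp: trivial_limit_within)
qed

section \<open>Geometry of the domain and its boundary arcs\<close>

locale curved_domain =
  fixes l :: real and \<gamma> :: "real \<Rightarrow> real"
  assumes admissible: "admissible_curve l \<gamma>"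
begin

lemma l: "1 / 2 < l" "l < 1"
  using admissible by (auto simp: admissible_curve_def)

lemma gamma_0: "\<gamma> 0 = 0" and gamma_l: "\<gamma> l = 1 - l" and gamma_pos: "0 < x \<Longrightarrow> x < l \<Longrightarrow> 0 < \<gamma> x"
  and gamma_mono: "mono_on {0..l} \<gamma>" and gamma_strict: "strict_mono_on {0..l} (\<lambda>x. x + \<gamma> x)"
  using admissible by (auto simp: admissible_curve_def)

lemma continuous_gamma: "continuous_on {0..l} \<gamma>"
  using admissible unfolding admissible_curve_def continuous_on_eq_continuous_within
  by (meson DERIV_continuous)

text \<open>AC and BC as one graph over \<open>{0..1}\<close>; the branches agree at
  \<open>l\<close> because \<open>\<gamma> l = 1 - l\<close>.\<close>

definition depth :: "real \<Rightarrow> real" where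
  "depth x = (if x \<le> l then \<gamma> x else 1 - x)"

lemma continuous_depth: "continuous_on {0..1} depth"
proof -
  have "continuous_on ({0..l} \<union> {l..1}) depth"
    unfolding depth_def
    by (rule continuous_on_cases) (auto simp: gamma_l intro!: continuous_gamma continuous_intros)
  then show ?thesis using l by (simp add: ivl_disj_un_two_touch)
qed

lemma Omega1_iff: "(x, y) \<in> Omega1 l \<gamma> \<longleftrightarrow> 0 < x \<and> x < 1 \<and> y < 0 \<and> - depth x < y"
  by (auto simp: Omega1_def depth_def)

lemma add_depth_le: "x \<in> {0..1} \<Longrightarrow> x + depth x \<le> 1"
  using strict_mono_onD[OF gamma_strict, of x l] l
  by (cases "x = l") (auto simp: depth_def gamma_l)

lemma depth_nonneg: "x \<in> {0..1} \<Longrightarrow> 0 \<le> depth x"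
  using mono_onD[OF gamma_mono, of 0 x] l by (auto simp: depth_def gamma_0)

lemma depth_pos: "0 < x \<Longrightarrow> x < 1 \<Longrightarrow> 0 < depth x"
  using gamma_pos[of x] l by (cases "x = l") (auto simp: depth_def gamma_l)

lemma open_Omega1: "open (Omega1 l \<gamma>)"
proof -
  have "open ({0<..<1} \<times> {..<0} \<inter> (\<lambda>z. snd z + depth (fst z)) -` {0<..})"
    by (intro continuous_open_preimage continuous_intros continuous_on_compose2[OF continuous_depth] open_Times) auto
  also have "({0<..<1} \<times> {..<0} \<inter> (\<lambda>z. snd z + depth (fst z)) -` {0<..}) = Omega1 l \<gamma>"
    by (auto simp: Omega1_iff)
  finally show ?thesis .
qed

lemma Omega0_eq: "Omega0 = {0<..<1} \<times> {0<..<1}"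
  by (auto simp: Omega0_def)

lemma open_Omega0: "open Omega0"
  by (simp add: Omega0_eq open_Times)

lemma square_subset_closure: "{0..1} \<times> {0..1} \<subseteq> closure (Omega l \<gamma>)"
proof -
  have "closure Omega0 = {0..1} \<times> {0..1}"
    by (simp add: Omega0_eq closure_Times)
  then show ?thesis using closure_mono[of Omega0 "Omega l \<gamma>"] by (auto simp: Omega_def)
qed

lemma closure_Omega_bound:
  assumes "(x, y) \<in> closure (Omega l \<gamma>)"
  shows "0 \<le> x" "x \<le> 1" "- depth x \<le> y"
proof -
  have "closed ({0..1} \<times> UNIV \<inter> (\<lambda>z. snd z + depth (fst z)) -` {0..})"
    by (intro continuous_closed_preimage continuous_intros continuous_on_compose2[OF continuous_depth] closed_Times) auto
  moreover have "Omega l \<gamma> \<subseteq> {0..1} \<times> UNIV \<inter> (\<lambda>z. snd z + depth (fst z)) -` {0..}"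
    using depth_nonneg by (auto simp: Omega_def Omega0_def segment_AB_def Omega1_iff add_nonneg_nonneg less_imp_le)
  ultimately have "(x, y) \<in> {0..1} \<times> UNIV \<inter> (\<lambda>z. snd z + depth (fst z)) -` {0..}"
    using assms closure_minimal by blast
  then show "0 \<le> x" "x \<le> 1" "- depth x \<le> y" by auto
qed

lemma islimpt_vertical:
  fixes x y c d :: real
  assumes "0 < d" "\<And>t. 0 < t \<Longrightarrow> t < d \<Longrightarrow> (x, y + c * t) \<in> D" "c \<noteq> 0"
  shows "(x, y) islimpt D"
proof (rule islimptI)
  fix T assume T: "(x, y) \<in> T" "open T"
  have "((\<lambda>t. (x, y + c * t)) \<longlongrightarrow> (x, y + c * 0)) (at_right 0)"
    by (intro tendsto_intros)
  then have "\<forall>\<^sub>F t in at_right 0. (x, y + c * t) \<in> T"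
    using T by (intro topological_tendstoD) auto
  moreover have "\<forall>\<^sub>F t in at_right 0. 0 < t \<and> t < d"
    using assms(1) by (auto simp: eventually_at_right_field)
  ultimately have "\<forall>\<^sub>F t in at_right (0::real). (x, y + c * t) \<in> T \<and> 0 < t \<and> t < d"
    by (rule eventually_conj)
  then obtain t where "(x, y + c * t) \<in> T" "0 < t" "t < d"
    using eventually_happens' trivial_limit_at_right_real by (metis (mono_tags, lifting))
  then show "\<exists>z\<in>D. z \<in> T \<and> z \<noteq> (x, y)"
    using assms(2,3) by (intro bexI[of _ "(x, y + c * t)"]) auto
qed

lemma islimpt_Omega0: "0 < x \<Longrightarrow> x < 1 \<Longrightarrow> (x, 0) islimpt Omega0"
  by (rule islimpt_vertical[of 1 _ _ 1]) (auto simp: Omega0_def)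

lemma islimpt_Omega1_AB: "0 < x \<Longrightarrow> x < 1 \<Longrightarrow> (x, 0) islimpt Omega1 l \<gamma>"
  by (rule islimpt_vertical[of "depth x" _ _ "-1"]) (auto simp: Omega1_iff depth_pos)

lemma islimpt_Omega1_AC: "z \<in> curve_AC l \<gamma> \<Longrightarrow> z islimpt Omega1 l \<gamma>"
proof (cases z)
  case (Pair x y)
  assume "z \<in> curve_AC l \<gamma>"
  then have x: "0 < x" "x < l" "y = - \<gamma> x" using Pair by (auto simp: curve_AC_def)
  show "z islimpt Omega1 l \<gamma>"
    unfolding Pair by (rule islimpt_vertical[of "\<gamma> x" _ _ 1])
      (use x l gamma_pos in \<open>auto simp: Omega1_iff depth_def\<close>)
qed

section \<open>Homogeneous solutions that travel along \<open>x + y = const\<close>\<close>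

abbreviation Omega1_bar :: "(real \<times> real) set" where
  "Omega1_bar \<equiv> Omega1 l \<gamma> \<union> curve_AC l \<gamma> \<union> segment_AB"

text \<open>Tailored to functions of \<open>x + y\<close>: both first derivatives equal
  \<open>p\<close>, so the condition on AC is automatic, and since \<open>p\<close> vanishes for
  \<open>y = 0\<close>, both gluing conditions read 0 = 0 whatever \<open>\<alpha>\<close>,
  \<open>\<beta>\<close> and \<open>Q\<close> are.\<close>

lemma regular_solutionI:
  assumes "continuous_on (closure (Omega l \<gamma>)) u"
    and u0: "C_class 2 2 Omega0 u" and u1: "C_class 2 2 (Omega1 l \<gamma>) u"
    and p: "continuous_on (closure (Omega l \<gamma>)) p"
    and p0: "\<And>z. z \<in> Omega0 \<Longrightarrow> p z = ddx u z" "\<And>z. z \<in> Omega0 \<Longrightarrow> p z = ddy u z"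
    and p1: "\<And>z. z \<in> Omega1 l \<gamma> \<Longrightarrow> p z = ddx u z" "\<And>z. z \<in> Omega1 l \<gamma> \<Longrightarrow> p z = ddy u z"
    and pAB: "\<And>x. p (x, 0) = 0"
    and "\<And>z. z \<in> Omega0 \<Longrightarrow> ddx u z - ddy (ddy u) z = f z"
    and "\<And>z. z \<in> Omega1 l \<gamma> \<Longrightarrow> ddx (ddx u) z - ddy (ddy u) z = f z"
    and "\<And>y. y \<in> {0..1} \<Longrightarrow> u (0, y) = 0" "\<And>x. x \<in> {0..1} \<Longrightarrow> u (x, 1) = 0"
  shows "regular_solution l \<gamma> \<alpha> \<beta> Q f u"
proof -
  have AB: "segment_AB \<subseteq> closure (Omega l \<gamma>)" "curve_AC l \<gamma> \<subseteq> closure (Omega l \<gamma>)"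
    "Omega0 \<subseteq> closure (Omega l \<gamma>)" "Omega1 l \<gamma> \<subseteq> closure (Omega l \<gamma>)"
  proof -
    show "segment_AB \<subseteq> closure (Omega l \<gamma>)" "Omega0 \<subseteq> closure (Omega l \<gamma>)" "Omega1 l \<gamma> \<subseteq> closure (Omega l \<gamma>)"
      using closure_subset[of "Omega l \<gamma>"] by (auto simp: Omega_def)
    show "curve_AC l \<gamma> \<subseteq> closure (Omega l \<gamma>)"
      using islimpt_Omega1_AC islimpt_subset[of _ "Omega1 l \<gamma>" "Omega l \<gamma>"]
      by (auto simp: closure_def Omega_def)
  qed
  have S0: "continuous_on (Omega0 \<union> segment_AB) h" and S1: "continuous_on Omega1_bar h"
    if "continuous_on (closure (Omega l \<gamma>)) h" for h :: "real \<times> real \<Rightarrow> real"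
    using AB that by (auto intro: continuous_on_subset)
  have bv0: "boundary_value Omega0 (ddx u) (x, 0) = 0" "boundary_value Omega0 (ddy u) (x, 0) = 0"
    if "0 < x" "x < 1" for x
    using that pAB[of x] boundary_value_eq[OF S0[OF p] p0(1), where z="(x, 0)"]
      boundary_value_eq[OF S0[OF p] p0(2), where z="(x, 0)"] islimpt_Omega0[of x]
    by (auto simp: segment_AB_def)
  have bv1: "boundary_value (Omega1 l \<gamma>) (ddx u) (x, 0) = 0" "boundary_value (Omega1 l \<gamma>) (ddy u) (x, 0) = 0"
    if "0 < x" "x < 1" for x
    using that pAB[of x] boundary_value_eq[OF S1[OF p] p1(1), where z="(x, 0)"]
      boundary_value_eq[OF S1[OF p] p1(2), where z="(x, 0)"] islimpt_Omega1_AB[of x]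
    by (auto simp: segment_AB_def)
  have bvC: "boundary_value (Omega1 l \<gamma>) (ddx u) z = p z" "boundary_value (Omega1 l \<gamma>) (ddy u) z = p z"
    if "z \<in> curve_AC l \<gamma>" for z
    using that boundary_value_eq[OF S1[OF p] p1(1), where z=z] boundary_value_eq[OF S1[OF p] p1(2), where z=z]
      islimpt_Omega1_AC[of z] by auto
  \<comment> \<open>The boundary value at \<open>t = 0\<close> belongs to a point outside the open
    segment AB and is unknown; a single point does not affect the integral.\<close>
  have int: "((\<lambda>t. boundary_value (Omega1 l \<gamma>) (ddy u) (t, 0) * Q (x, t)) has_integral 0) {0..x}"
    if "0 < x" "x < 1" for x
  proof (rule has_integral_spike_finite)
    show "((\<lambda>_. 0) has_integral (0::real)) {0..x}" by simp
    show "finite {0::real}" by simp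
  qed (use that bv1 in auto)
  have "C1_upto Omega0 (Omega0 \<union> segment_AB) u" "C1_upto (Omega1 l \<gamma>) Omega1_bar u"
    unfolding C1_upto_def using assms(1) C_class_mono[OF u0] C_class_mono[OF u1] S0 S1 p p0 p1
    by (metis numeral_le_one_iff one_le_numeral semiring_norm(69))+
  then show ?thesis
    unfolding regular_solution_def
    using assms C_class_mono[OF u0, of 1 2] bv0 bv1 bvC int has_integral_integrable[OF int]
    by (auto simp: integral_unique)
qed

text \<open>A wave along the characteristics \<open>x + y = const\<close>, cut off along the line
  \<open>x = a\<close>. It stays smooth in Omega when \<open>h\<close> vanishes from
  \<open>a - \<gamma> a\<close> on, since points of Omega on that line satisfy
  \<open>x + y > a - \<gamma> a\<close>.\<close>

definition one_sided :: "real \<Rightarrow> (real \<Rightarrow> real) \<Rightarrow> real \<times> real \<Rightarrow> real" where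
  "one_sided a h = (\<lambda>(x, y). if x \<le> a then 0 else h (x + y))"

lemma one_sided_DERIV:
  assumes h: "\<And>t. (h has_real_derivative h' t) (at t)" and zero: "\<And>t. c \<le> t \<Longrightarrow> h t = 0" "\<And>t. c \<le> t \<Longrightarrow> h' t = 0"
    and V: "x = a \<longrightarrow> c < x + y"
  shows "((\<lambda>t. one_sided a h (t, y)) has_real_derivative one_sided a h' (x, y)) (at x)"
    and "((\<lambda>t. one_sided a h (x, t)) has_real_derivative one_sided a h' (x, y)) (at y)"
proof -
  have hx: "((\<lambda>t. h (t + y)) has_real_derivative h' (x + y)) (at x)"
    using DERIV_shift[of h "h' (x + y)" x y] h by simp
  consider "x < a" | "a < x" | "x = a" "c < x + y" using V by fastforce
  then show "((\<lambda>t. one_sided a h (t, y)) has_real_derivative one_sided a h' (x, y)) (at x)"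
  proof cases
    case 1
    have "((\<lambda>t. one_sided a h (t, y)) has_real_derivative 0) (at x)"
      by (rule has_field_derivative_transform_within_open[of "\<lambda>_. 0" _ _ "{..<a}"])
        (use 1 in \<open>auto simp: one_sided_def\<close>)
    then show ?thesis using 1 by (simp add: one_sided_def)
  next
    case 2
    have "((\<lambda>t. one_sided a h (t, y)) has_real_derivative h' (x + y)) (at x)"
      by (rule has_field_derivative_transform_within_open[OF hx, of "{a<..}"])
        (use 2 in \<open>auto simp: one_sided_def\<close>)
    then show ?thesis using 2 by (simp add: one_sided_def)
  next
    case 3
    have "((\<lambda>t. one_sided a h (t, y)) has_real_derivative 0) (at x)"
      by (rule has_field_derivative_transform_within_open[of "\<lambda>_. 0" _ _ "{c - y<..}"])
        (use 3 zero in \<open>auto simp: one_sided_def\<close>)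
    then show ?thesis using 3 by (simp add: one_sided_def)
  qed
  have "((\<lambda>t. h (x + t)) has_real_derivative h' (x + y)) (at y)"
    using DERIV_shift[of h "h' (x + y)" y x] h by (simp add: add.commute)
  then show "((\<lambda>t. one_sided a h (x, t)) has_real_derivative one_sided a h' (x, y)) (at y)"
    by (auto simp: one_sided_def)
qed

lemma one_sided_continuous:
  assumes h: "continuous_on UNIV h" and zero: "\<And>t. c \<le> t \<Longrightarrow> h t = 0"
    and S: "\<And>x y. (x, y) \<in> S \<Longrightarrow> x = a \<Longrightarrow> c \<le> x + y"
  shows "continuous_on S (one_sided a h)"
proof -
  have "continuous_on S (\<lambda>z. if fst z \<le> a then 0 else h (fst z + snd z))"
    by (rule continuous_on_cases_le)
      (auto intro!: continuous_intros continuous_on_compose2[OF h] zero S)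
  then show ?thesis by (simp add: one_sided_def case_prod_beta)
qed

lemma one_sided_regular:
  assumes h: "\<And>t. (h has_real_derivative h' t) (at t)" "\<And>t. (h' has_real_derivative h'' t) (at t)"
    and ch: "continuous_on UNIV h''"
    and zero: "\<And>t. c \<le> t \<Longrightarrow> h t = 0" "\<And>t. c \<le> t \<Longrightarrow> h' t = 0" "\<And>t. c \<le> t \<Longrightarrow> h'' t = 0"
    and a: "a \<in> {0..l}" and c: "c = a - \<gamma> a"
  shows "regular_solution l \<gamma> \<alpha> \<beta> Q (\<lambda>_. 0) (one_sided a h)"
proof -
  have a1: "depth a = \<gamma> a" and ga: "0 \<le> \<gamma> a"
    using a l depth_nonneg[of a] by (auto simp: depth_def)
  \<comment> \<open>The complement of the ray on which the cut is visible. On the rest of the line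
    \<open>x = a\<close> both branches vanish nearby.\<close>
  define V where "V = - ({a} \<times> {..c - a})"
  have V: "open V" unfolding V_def by (intro open_Compl closed_Times closed_atMost) auto
  have V_iff: "(x, y) \<in> V \<longleftrightarrow> (x = a \<longrightarrow> c < x + y)" for x y
    by (auto simp: V_def)
  have O0: "Omega0 \<subseteq> V" and O1: "Omega1 l \<gamma> \<subseteq> V"
    using a1 c ga by (auto simp: V_iff Omega0_def Omega1_iff)
  note D1 = one_sided_DERIV[of h h' c, OF h(1) zero(1,2)] and D2 = one_sided_DERIV[of h' h'' c, OF h(2) zero(2,3)]
  have x1: "ddx (one_sided a h) z = one_sided a h' z" and y1: "ddy (one_sided a h) z = one_sided a h' z" if "z \<in> V" for z
    using that D1 by (cases z; auto simp: ddx_def ddy_def V_iff intro!: DERIV_imp_deriv)+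
  have near: "\<forall>\<^sub>F t in nhds x. (t, y) \<in> V" "\<forall>\<^sub>F t in nhds y. (x, t) \<in> V" if "(x, y) \<in> V" for x y
  proof -
    have "open ((\<lambda>t. (t, y)) -` V)" "open ((\<lambda>t. (x, t)) -` V)"
      by (intro open_vimage V continuous_intros)+
    then show "\<forall>\<^sub>F t in nhds x. (t, y) \<in> V" "\<forall>\<^sub>F t in nhds y. (x, t) \<in> V"
      using that unfolding eventually_nhds by auto
  qed
  have d2x: "((\<lambda>t. ddx (one_sided a h) (t, y)) has_real_derivative one_sided a h'' (x, y)) (at x)" if "(x, y) \<in> V" for x y
  proof -
    have "\<forall>\<^sub>F t in nhds x. ddx (one_sided a h) (t, y) = one_sided a h' (t, y)"
      using near(1)[OF that] by (rule eventually_mono) (rule x1)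
    from DERIV_cong_ev[OF refl this refl] D2(1)[of x a y] that show ?thesis by (simp add: V_iff)
  qed
  have d2y: "((\<lambda>t. ddy (one_sided a h) (x, t)) has_real_derivative one_sided a h'' (x, y)) (at y)" if "(x, y) \<in> V" for x y
  proof -
    have "\<forall>\<^sub>F t in nhds y. ddy (one_sided a h) (x, t) = one_sided a h' (x, t)"
      using near(2)[OF that] by (rule eventually_mono) (rule y1)
    from DERIV_cong_ev[OF refl this refl] D2(2)[of x a y] that show ?thesis by (simp add: V_iff)
  qed
  have x2: "ddx (ddx (one_sided a h)) z = one_sided a h'' z" and y2: "ddy (ddy (one_sided a h)) z = one_sided a h'' z" if "z \<in> V" for z
    using that d2x d2y by (cases z; auto simp: ddx_def[of "ddx _"] ddy_def[of "ddy _"] intro!: DERIV_imp_deriv)+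
  have c0: "continuous_on UNIV h" "continuous_on UNIV h'"
    using h by (auto simp: continuous_on_eq_continuous_at intro: DERIV_isCont)
  have cont: "continuous_on S (one_sided a h)" "continuous_on S (one_sided a h')" "continuous_on S (one_sided a h'')"
    if "\<And>x y. (x, y) \<in> S \<Longrightarrow> x = a \<Longrightarrow> c \<le> x + y" for S
    using one_sided_continuous[OF c0(1) zero(1) that] one_sided_continuous[OF c0(2) zero(2) that]
      one_sided_continuous[OF ch zero(3) that] by blast+
  have cl: "c \<le> x + y" if "(x, y) \<in> closure (Omega l \<gamma>)" "x = a" for x y
    using closure_Omega_bound(3)[OF that(1)] that(2) a1 c by simp
  have CC: "C_class 2 2 D (one_sided a h)" if D: "D \<subseteq> V" for D
  proof -
    have cV: "continuous_on D (one_sided a h)" "continuous_on D (one_sided a h')" "continuous_on D (one_sided a h'')"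
      by (rule cont; use D V_iff in \<open>force intro: less_imp_le\<close>)+
    have cd: "continuous_on D (ddx (one_sided a h))" "continuous_on D (ddy (one_sided a h))"
      "continuous_on D (ddx (ddx (one_sided a h)))" "continuous_on D (ddy (ddy (one_sided a h)))"
    proof -
      show "continuous_on D (ddx (one_sided a h))" "continuous_on D (ddy (one_sided a h))"
        using D x1 y1 by (auto intro!: continuous_on_eq[OF cV(2)])
      show "continuous_on D (ddx (ddx (one_sided a h)))" "continuous_on D (ddy (ddy (one_sided a h)))"
        using D x2 y2 by (auto intro!: continuous_on_eq[OF cV(3)])
    qed
    have m: "m = 0 \<or> m = 1 \<or> m = 2" if "m \<le> 2" for m :: nat using that by auto
    have m': "m = 0 \<or> m = 1" if "m < 2" for m :: nat using that by auto
    have "continuous_on D ((ddx ^^ m) (one_sided a h))" "continuous_on D ((ddy ^^ m) (one_sided a h))" if "m \<le> 2" for m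
      using m[OF that] cV cd by (auto simp: numeral_2_eq_2)
    moreover have "(\<lambda>t. (ddx ^^ m) (one_sided a h) (t, y)) differentiable (at x)"
      "(\<lambda>t. (ddy ^^ m) (one_sided a h) (x, t)) differentiable (at y)" if "m < 2" "(x, y) \<in> D" for m x y
    proof -
      have V: "(x, y) \<in> V" using that D by auto
      then show "(\<lambda>t. (ddx ^^ m) (one_sided a h) (t, y)) differentiable (at x)"
        "(\<lambda>t. (ddy ^^ m) (one_sided a h) (x, t)) differentiable (at y)"
        using m'[OF that(1)] D1[OF _ _ V[unfolded V_iff]] d2x[OF V] d2y[OF V]
        unfolding real_differentiable_def by auto
    qed
    ultimately show ?thesis
      unfolding C_class_def by blast
  qed
  \<comment> \<open>For \<open>y \<ge> 0\<close> the wave is absent, since to the right of the line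
    \<open>x + y \<ge> a \<ge> c\<close>.\<close>
  have AB0: "one_sided a g (x, y) = 0" if "\<And>t. c \<le> t \<Longrightarrow> g t = 0" "0 \<le> y" for g x y
    using that ga c by (auto simp: one_sided_def)
  show ?thesis
  proof (rule regular_solutionI[where p="one_sided a h'"])
    show "one_sided a h (0, y) = 0" for y using a by (simp add: one_sided_def)
    show "ddx (one_sided a h) z - ddy (ddy (one_sided a h)) z = 0" if "z \<in> Omega0" for z
      using that O0 by (cases z) (auto simp: x1 y2 AB0 zero Omega0_def subset_iff)
  qed (use O0 O1 cl in \<open>auto intro!: CC cont simp: x1 y1 x2 y2 AB0 zero subset_iff\<close>)
qed

text \<open>If \<open>x - \<gamma> x < a - \<gamma> a\<close> for some \<open>x > a\<close>, then
  the characteristics \<open>x + y = const\<close> with a constant between these two values run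
  through Omega to the right of \<open>a\<close>, but leave it through AC instead of reaching AB. A
  wave confined to them is a nonzero solution of the homogeneous problem.\<close>

theorem unique_imp_mono:
  assumes unique: "\<And>u v. regular_solution l \<gamma> \<alpha> \<beta> Q (\<lambda>_. 0) u \<Longrightarrow> regular_solution l \<gamma> \<alpha> \<beta> Q (\<lambda>_. 0) v \<Longrightarrow>
     (\<forall>z\<in>closure (Omega l \<gamma>). u z = v z)"
  shows "mono_on {0..l} (\<lambda>x. x - \<gamma> x)"
proof (rule ccontr)
  assume "\<not> ?thesis"
  then obtain a x where ax: "a \<in> {0..l}" "x \<in> {0..l}" "a \<le> x" "x - \<gamma> x < a - \<gamma> a"
    by (auto simp: mono_on_def not_le)
  then have ax': "a < x" by (cases "a = x") auto
  define c where "c = a - \<gamma> a"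
  \<comment> \<open>The exponent 3 chosen below is the least for which the truncated power is twice
    continuously differentiable.\<close>
  define h :: "nat \<Rightarrow> real \<Rightarrow> real" where "h = (\<lambda>n t. if t \<le> c then (c - t) ^ n else 0)"
  have cont: "continuous_on UNIV (h (Suc n))" for n
  proof -
    have "continuous_on ({..c} \<union> {c..}) (h (Suc n))"
      unfolding h_def by (rule continuous_on_cases) (auto intro!: continuous_intros)
    moreover have "{..c} \<union> {c..} = UNIV" by auto
    ultimately show ?thesis by simp
  qed
  have deriv: "(h (Suc (Suc n)) has_real_derivative - real (n + 2) * h (Suc n) t) (at t)" for n t
  proof -
    have p: "((\<lambda>t. (c - t) ^ Suc (Suc n)) has_real_derivative - real (n + 2) * (c - t) ^ Suc n) (at t within A)" for A t
    proof -
      have "((\<lambda>t. c - t) has_real_derivative -1) (at t within A)" by (auto intro!: derivative_eq_intros)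
      from DERIV_power[OF this, of "Suc (Suc n)"] show ?thesis
        by (rule DERIV_cong) (simp add: algebra_simps)
    qed
    have "((\<lambda>t. if t \<in> {..c} then (c - t) ^ Suc (Suc n) else 0) has_vector_derivative
        (if t \<in> {..c} then - real (n + 2) * (c - t) ^ Suc n else 0)) (at t within UNIV)"
    proof (rule has_vector_derivative_If_within_closures[where T="{c..}"])
      show "((\<lambda>t. (c - t) ^ Suc (Suc n)) has_vector_derivative - real (n + 2) * (c - t) ^ Suc n) (at t within A)" for A
        using p by (simp only: has_real_derivative_iff_has_vector_derivative)
    qed auto
    then have "(h (Suc (Suc n)) has_vector_derivative (if t \<in> {..c} then - real (n + 2) * (c - t) ^ Suc n else 0)) (at t)"
      by (simp add: h_def)
    then have "(h (Suc (Suc n)) has_real_derivative (if t \<in> {..c} then - real (n + 2) * (c - t) ^ Suc n else 0)) (at t)"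
      by (simp only: has_real_derivative_iff_has_vector_derivative)
    then show ?thesis by (auto simp: h_def)
  qed
  have z: "h (Suc n) t = 0" if "c \<le> t" for n t using that by (simp add: h_def)
  have "regular_solution l \<gamma> \<alpha> \<beta> Q (\<lambda>_. 0) (one_sided a (h 3))"
  proof (rule one_sided_regular)
    show "(h 3 has_real_derivative - 3 * h 2 t) (at t)" for t
      using deriv[of 1 t] by (simp add: numeral_3_eq_3 numeral_2_eq_2)
    show "((\<lambda>t. - 3 * h 2 t) has_real_derivative 6 * h 1 t) (at t)" for t
      using deriv[of 0 t] by (auto intro!: derivative_eq_intros simp: numeral_2_eq_2)
    show "continuous_on UNIV (\<lambda>t. 6 * h 1 t)"
      using cont[of 0] by (auto intro!: continuous_intros)
  qed (use ax z[of _ 0] z[of _ 1] z[of _ 2] in \<open>auto simp: c_def numeral_3_eq_3 numeral_2_eq_2\<close>)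
  moreover have "regular_solution l \<gamma> \<alpha> \<beta> Q (\<lambda>_. 0) (one_sided a (\<lambda>_. 0))"
    by (rule one_sided_regular[where c=c]) (use ax in \<open>auto simp: c_def\<close>)
  ultimately have eq: "one_sided a (h 3) z = one_sided a (\<lambda>_. 0) z" if "z \<in> closure (Omega l \<gamma>)" for z
    using unique that by blast
  \<comment> \<open>Small enough that \<open>(x, - \<gamma> x + \<epsilon>)\<close> lies in the
    lower part and its coordinates still add up to less than \<open>c\<close>, where
    \<open>h 3\<close> is positive.\<close>
  define \<epsilon> where "\<epsilon> = min (\<gamma> x) (c - (x - \<gamma> x)) / 2"
  have "\<gamma> a < \<gamma> x" using ax ax' by auto
  then have gx: "0 < \<gamma> x" using depth_nonneg[of a] ax l by (auto simp: depth_def)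
  then have \<epsilon>: "0 < \<epsilon>" "\<epsilon> < \<gamma> x" "\<epsilon> < c - (x - \<gamma> x)" using ax(4) by (auto simp: \<epsilon>_def c_def)
  have "(x, - \<gamma> x + \<epsilon>) \<in> Omega1 l \<gamma>"
    using ax ax' l \<epsilon> by (auto simp: Omega1_iff depth_def)
  then have "(x, - \<gamma> x + \<epsilon>) \<in> closure (Omega l \<gamma>)"
    using closure_subset[of "Omega l \<gamma>"] by (auto simp: Omega_def)
  from eq[OF this] show False
    using ax' \<epsilon> by (auto simp: one_sided_def h_def split: if_splits)
qed

end

section \<open>Causality\<close>

text \<open>The function \<phi> of the overview. The maximum selects \<open>x - y\<close> exactly
  for \<open>y < 0\<close> and makes continuity across AB evident.\<close>

definition clock :: "real \<times> real \<Rightarrow> real" where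
  "clock z = max (fst z) (fst z - snd z)"

lemma continuous_clock: "continuous_on A clock"
  unfolding clock_def by (intro continuous_intros)

context curved_domain begin

lemma clock_less_1:
  assumes "z \<in> Omega l \<gamma>" shows "clock z < 1"
  using assms add_depth_le[of "fst z"] by (cases z) (auto simp: Omega_def Omega0_def segment_AB_def Omega1_iff clock_def)

lemma clock_Omega1: "(x, y) \<in> Omega1 l \<gamma> \<Longrightarrow> clock (x, y) = x - y"
  by (auto simp: Omega1_iff clock_def)

text \<open>On AC the function \<open>x - y\<close> equals \<open>x + \<gamma> x\<close>. The
  intermediate value theorem yields the foot of the characteristic, and strict monotonicity shows
  that the characteristic lies in the lower part exactly from there up to AB.\<close>

lemma foot_on_AC:
  assumes "0 < \<eta>" "\<eta> < 1"
  obtains c where "0 < c" "c < l" "c < \<eta>" "c + \<gamma> c = \<eta>"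
    "\<And>x. c < x \<Longrightarrow> x < \<eta> \<Longrightarrow> (x, x - \<eta>) \<in> Omega1 l \<gamma>"
    "\<And>x. (x, x - \<eta>) \<in> Omega1 l \<gamma> \<Longrightarrow> c < x"
proof -
  have "\<exists>c\<ge>0. c \<le> l \<and> c + \<gamma> c = \<eta>"
    using assms l by (intro IVT') (auto simp: gamma_0 gamma_l intro!: continuous_intros continuous_gamma)
  then obtain c where c: "0 \<le> c" "c \<le> l" "c + \<gamma> c = \<eta>" by blast
  have c': "0 < c" "c < l" using c assms by (auto simp: gamma_0 gamma_l less_le)
  have strict: "x + \<gamma> x < x' + \<gamma> x'" if "0 \<le> x" "x < x'" "x' \<le> l" for x x'
    using strict_mono_onD[OF gamma_strict, of x x'] that by auto
  show ?thesis
  proof (rule that[OF c' _ c(3)])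
    show "c < \<eta>" using c gamma_pos[OF c'] by simp
    show "(x, x - \<eta>) \<in> Omega1 l \<gamma>" if "c < x" "x < \<eta>" for x
      using that c c' assms l strict[of c x] by (auto simp: Omega1_iff depth_def)
    show "c < x" if "(x, x - \<eta>) \<in> Omega1 l \<gamma>" for x
    proof (rule ccontr)
      assume "\<not> c < x"
      then show False using that c c' strict[of x c] by (cases "x = c") (auto simp: Omega1_iff depth_def)
    qed
  qed
qed

text \<open>In the characteristic coordinates \<open>x + y\<close> and \<open>x - y\<close>, the
  function u_x - u_y is twice the derivative in the second, whence the name.
  \<open>wave_invariant\<close> works only inside the domain, so both ends of the segment, the foot
  on AC and the point on AB, are reached through the extensions \<open>p\<close> and
  \<open>q\<close>.\<close>

lemma u_eta_vanishes:
  assumes s: "s \<le> 1"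
    and u: "regular_solution l \<gamma> \<alpha> \<beta> Q f u"
    and f: "\<And>z. z \<in> Omega l \<gamma> \<Longrightarrow> clock z < s \<Longrightarrow> f z = 0"
    and p: "continuous_on Omega1_bar p" "\<And>z. z \<in> Omega1 l \<gamma> \<Longrightarrow> p z = ddx u z"
    and q: "continuous_on Omega1_bar q" "\<And>z. z \<in> Omega1 l \<gamma> \<Longrightarrow> q z = ddy u z"
    and \<eta>: "0 < \<eta>" "\<eta> < s" and x: "(x, x - \<eta>) \<in> Omega1 l \<gamma> \<or> x = \<eta>"
  shows "p (x, x - \<eta>) = q (x, x - \<eta>)"
proof -
  have u2: "C_class 2 2 (Omega1 l \<gamma>) u"
    and wave: "\<And>z. z \<in> Omega1 l \<gamma> \<Longrightarrow> ddx (ddx u) z - ddy (ddy u) z = f z"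
    and AC: "\<And>z. z \<in> curve_AC l \<gamma> \<Longrightarrow> boundary_value (Omega1 l \<gamma>) (ddx u) z - boundary_value (Omega1 l \<gamma>) (ddy u) z = 0"
    using u by (auto simp: regular_solution_def)
  obtain c where c: "0 < c" "c < l" "c < \<eta>" "c + \<gamma> c = \<eta>"
    and seg: "\<And>x. c < x \<Longrightarrow> x < \<eta> \<Longrightarrow> (x, x - \<eta>) \<in> Omega1 l \<gamma>"
    and seg': "\<And>x. (x, x - \<eta>) \<in> Omega1 l \<gamma> \<Longrightarrow> c < x"
    using foot_on_AC[of \<eta> thesis] \<eta> s by simp
  \<comment> \<open>The part of the lower domain that comes before \<open>s\<close>, where
    \<open>f\<close> vanishes.\<close>
  define G where "G = Omega1 l \<gamma> \<inter> {z. fst z - snd z < s}"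
  have G: "open G"
    unfolding G_def by (intro open_Int open_Omega1 open_Collect_less continuous_intros)
  define D where "D = (\<lambda>x. p (x, x - \<eta>) - q (x, x - \<eta>))"
  have c_AC: "(c, c - \<eta>) \<in> curve_AC l \<gamma>" using c by (auto simp: curve_AC_def)
  have Dc: "D c = 0"
  proof -
    have sub: "Omega1 l \<gamma> \<subseteq> Omega1_bar" by blast
    have "(c, c - \<eta>) \<in> Omega1_bar" using c_AC by blast
    then have "boundary_value (Omega1 l \<gamma>) (ddx u) (c, c - \<eta>) = p (c, c - \<eta>)"
      "boundary_value (Omega1 l \<gamma>) (ddy u) (c, c - \<eta>) = q (c, c - \<eta>)"
      using sub islimpt_Omega1_AC[OF c_AC]
      by (metis boundary_value_eq[OF p(1)] p(2), metis boundary_value_eq[OF q(1)] q(2))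
    then show ?thesis using AC[OF c_AC] by (simp add: D_def)
  qed
  have bar: "(x, x - \<eta>) \<in> Omega1_bar" if xr: "x \<in> {c..\<eta>}" for x
  proof -
    consider "x = c" | "x = \<eta>" | "c < x" "x < \<eta>" using xr by fastforce
    then show ?thesis
    proof cases
      case 1
      then show ?thesis using c_AC by blast
    next
      case 2
      then show ?thesis using \<eta> s by (simp add: segment_AB_def)
    next
      case 3
      then show ?thesis using seg by blast
    qed
  qed
  then have im: "(\<lambda>x. (x, x - \<eta>)) ` {c..\<eta>} \<subseteq> Omega1_bar" by blast
  have cD: "continuous_on {c..\<eta>} D"
    unfolding D_def
    by (intro continuous_on_diff continuous_on_compose2[OF p(1) _ im] continuous_on_compose2[OF q(1) _ im] continuous_intros)
  have const: "D x2 = D x1" if x12: "c < x1" "x1 \<le> x2" "x2 < \<eta>" for x1 x2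
  proof -
    have segG: "(x1 + \<sigma>, x1 - \<eta> + \<sigma>) \<in> G" if "\<sigma> \<in> {0..x2 - x1}" for \<sigma>
      using seg[of "x1 + \<sigma>"] that x12 \<eta> by (auto simp: G_def algebra_simps)
    \<comment> \<open>A compact segment in the open set \<open>G\<close> has a uniform neighbourhood
      of some radius \<open>e\<close>. Squares of side \<open>e / 3\<close> fit into it, because
      their points are at distance at most 2 e / 3 from the segment.\<close>
    define K where "K = (\<lambda>\<sigma>. (x1 + \<sigma>, x1 - \<eta> + \<sigma>)) ` {0..x2 - x1}"
    have "compact K" unfolding K_def by (intro compact_continuous_image continuous_intros) auto
    moreover have "K \<subseteq> G" using segG by (auto simp: K_def)
    ultimately obtain e where e: "e > 0" "(\<Union>z\<in>K. ball z e) \<subseteq> G"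
      using compact_subset_open_imp_ball_epsilon_subset[OF _ G] by metis
    have strip: "(x1 + \<sigma> + r, x1 - \<eta> + \<sigma> + t) \<in> G" if "\<sigma> \<in> {0..x2 - x1}" "r \<in> {0..e/3}" "t \<in> {0..e/3}" for \<sigma> r t
    proof -
      have "dist (x1 + \<sigma>, x1 - \<eta> + \<sigma>) (x1 + \<sigma> + r, x1 - \<eta> + \<sigma> + t) \<le> \<bar>r\<bar> + \<bar>t\<bar>"
        using sqrt_sum_squares_le_sum_abs[of r t] by (simp add: dist_prod_def dist_real_def)
      also have "\<dots> < e" using that e by auto
      finally have "(x1 + \<sigma> + r, x1 - \<eta> + \<sigma> + t) \<in> ball (x1 + \<sigma>, x1 - \<eta> + \<sigma>) e" by simp
      moreover have "(x1 + \<sigma>, x1 - \<eta> + \<sigma>) \<in> K" using that(1) by (auto simp: K_def)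
      ultimately show ?thesis using e(2) by blast
    qed
    have "ddx u (x1 + (x2 - x1), x1 - \<eta> + (x2 - x1)) - ddy u (x1 + (x2 - x1), x1 - \<eta> + (x2 - x1)) = ddx u (x1, x1 - \<eta>) - ddy u (x1, x1 - \<eta>)"
    proof (rule wave_invariant[OF open_Omega1 u2, of "e / 3"])
      fix \<sigma> r t assume "\<sigma> \<in> {0..x2 - x1}" "r \<in> {0..e/3}" "t \<in> {0..e/3}"
      note z = strip[OF this]
      then have "f (x1 + \<sigma> + r, x1 - \<eta> + \<sigma> + t) = 0"
        using clock_Omega1[of "x1 + \<sigma> + r" "x1 - \<eta> + \<sigma> + t"] by (intro f) (auto simp: G_def Omega_def)
      then show "(x1 + \<sigma> + r, x1 - \<eta> + \<sigma> + t) \<in> Omega1 l \<gamma> \<and>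
       ddx (ddx u) (x1 + \<sigma> + r, x1 - \<eta> + \<sigma> + t) = ddy (ddy u) (x1 + \<sigma> + r, x1 - \<eta> + \<sigma> + t)"
        using z wave[of "(x1 + \<sigma> + r, x1 - \<eta> + \<sigma> + t)"] by (auto simp: G_def)
    qed (use e x12 in auto)
    then show ?thesis
      using seg[of x1] seg[of x2] x12 p(2) q(2) by (simp add: D_def algebra_simps)
  qed
  have interior: "D x = 0" if x: "c < x" "x < \<eta>" for x
  proof -
    have "D c = D x"
    proof (rule constant_extends_left[of c x D "D x"])
      show "continuous_on {c..x} D" using cD x by (auto elim: continuous_on_subset)
      show "D y = D x" if "c < y" "y \<le> x" for y using const[of y x] that x by simp
    qed (use x in auto)
    then show ?thesis using Dc by simp
  qed
  have "D \<eta> = 0"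
  proof -
    \<comment> \<open>Reflection turns the right end into a left one, so that
      \<open>constant_extends_left\<close> applies.\<close>
    have "(\<lambda>x. D (- x)) (- \<eta>) = 0"
    proof (rule constant_extends_left[of _ "- ((c + \<eta>) / 2)" "\<lambda>x. D (- x)" 0])
      show "continuous_on {- \<eta>..- ((c + \<eta>) / 2)} (\<lambda>x. D (- x))"
        using c by (intro continuous_on_compose2[OF cD] continuous_intros) (auto simp: field_simps)
      show "- \<eta> < - ((c + \<eta>) / 2)" using c by simp
      show "D (- y) = 0" if "- \<eta> < y" "y \<le> - ((c + \<eta>) / 2)" for y
        using that c by (intro interior) (auto simp: field_simps)
    qed
    then show ?thesis by simp
  qed
  moreover have "D x = 0" if "(x, x - \<eta>) \<in> Omega1 l \<gamma>"
    using interior[of x] seg'[OF that] that by (auto simp: Omega1_iff)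
  ultimately show ?thesis using x by (auto simp: D_def)
qed

theorem causality:
  assumes s: "s \<le> 1" and mono: "mono_on {0..l} (\<lambda>x. x - \<gamma> x)"
    and Q: "C1_upto ({0<..<1} \<times> {0<..<1}) ({0..1} \<times> {0..1}) Q"
    and u: "regular_solution l \<gamma> \<alpha> \<beta> Q f u"
    and f: "\<And>z. z \<in> Omega l \<gamma> \<Longrightarrow> clock z < s \<Longrightarrow> f z = 0"
    and z: "z \<in> Omega l \<gamma>" "clock z < s"
  shows "u z = 0"
proof -
  have s0: "0 < s" using z by (cases z) (auto simp: Omega_def Omega0_def segment_AB_def Omega1_iff clock_def)
  have cu: "continuous_on (closure (Omega l \<gamma>)) u"
    and u12: "C_class 1 2 Omega0 u" and u22: "C_class 2 2 (Omega1 l \<gamma>) u"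
    and up0: "C1_upto Omega0 (Omega0 \<union> segment_AB) u" and up1: "C1_upto (Omega1 l \<gamma>) Omega1_bar u"
    and heat: "\<And>z. z \<in> Omega0 \<Longrightarrow> ddx u z - ddy (ddy u) z = f z"
    and left: "\<And>y. y \<in> {0..1} \<Longrightarrow> u (0, y) = 0" and top: "\<And>x. x \<in> {0..1} \<Longrightarrow> u (x, 1) = 0"
    and glue: "\<And>x. x \<in> {0<..<1} \<Longrightarrow>
        boundary_value Omega0 (ddx u) (x, 0) = boundary_value (Omega1 l \<gamma>) (ddx u) (x, 0)"
    and int: "\<And>x. x \<in> {0<..<1} \<Longrightarrow>
        (\<lambda>t. boundary_value (Omega1 l \<gamma>) (ddy u) (t, 0) * Q (x, t)) integrable_on {0..x}"
    and glue': "\<And>x. x \<in> {0<..<1} \<Longrightarrow> boundary_value Omega0 (ddy u) (x, 0) =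
          \<alpha> * boundary_value (Omega1 l \<gamma>) (ddy u) (x, 0) +
          \<beta> * integral {0..x} (\<lambda>t. boundary_value (Omega1 l \<gamma>) (ddy u) (t, 0) * Q (x, t))"
    using u unfolding regular_solution_def by blast+
  obtain p0 q0 where p0: "continuous_on (Omega0 \<union> segment_AB) p0" "\<And>z. z \<in> Omega0 \<Longrightarrow> p0 z = ddx u z"
    and q0: "continuous_on (Omega0 \<union> segment_AB) q0" "\<And>z. z \<in> Omega0 \<Longrightarrow> q0 z = ddy u z"
    using up0 unfolding C1_upto_def by blast
  obtain p q where p: "continuous_on Omega1_bar p" "\<And>z. z \<in> Omega1 l \<gamma> \<Longrightarrow> p z = ddx u z"
    and q: "continuous_on Omega1_bar q" "\<And>z. z \<in> Omega1 l \<gamma> \<Longrightarrow> q z = ddy u z"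
    using up1 unfolding C1_upto_def by blast
  note pq = u_eta_vanishes[OF s u f p q]
  have bv0: "boundary_value Omega0 (ddx u) (x, 0) = p0 (x, 0)" "boundary_value Omega0 (ddy u) (x, 0) = q0 (x, 0)"
    if "0 < x" "x < s" for x
    using that s boundary_value_eq[OF p0, where D=Omega0 and z="(x, 0)"] boundary_value_eq[OF q0, where D=Omega0 and z="(x, 0)"] islimpt_Omega0[of x]
    by (auto simp: segment_AB_def)
  have bv1: "boundary_value (Omega1 l \<gamma>) (ddx u) (x, 0) = p (x, 0)" "boundary_value (Omega1 l \<gamma>) (ddy u) (x, 0) = q (x, 0)"
    if "0 < x" "x < s" for x
    using that s boundary_value_eq[OF p, where D="Omega1 l \<gamma>" and z="(x, 0)"] boundary_value_eq[OF q, where D="Omega1 l \<gamma>" and z="(x, 0)"] islimpt_Omega1_AB[of x]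
    by (auto simp: segment_AB_def)
  have square: "u (x, y) = 0" if "0 \<le> x" "x < s" "y \<in> {0..1}" for x y
  proof (rule parabolic_vanishes[where \<rho>="\<lambda>x. boundary_value (Omega1 l \<gamma>) (ddy u) (x, 0)" and \<alpha>=\<alpha> and \<beta>=\<beta>, OF s0 s _ u12 p0 q0 _ left top Q])
    show "continuous_on ({0..1} \<times> {0..1}) u"
      using cu square_subset_closure by (rule continuous_on_subset)
    show "ddx u (x, y) = ddy (ddy u) (x, y)" if "0 < x" "x < s" "0 < y" "y < 1" for x y
      using heat[of "(x, y)"] f[of "(x, y)"] that s by (auto simp: Omega0_def Omega_def clock_def)
    \<comment> \<open>The point \<open>(x, 0)\<close> is the upper end of the characteristic with
      \<open>\<eta> = x\<close>, so \<open>u_eta_vanishes\<close> gives \<open>p = q\<close> there;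
      the first gluing condition passes this on to \<open>p0\<close>.\<close>
    show "p0 (x, 0) = boundary_value (Omega1 l \<gamma>) (ddy u) (x, 0)" if "0 < x" "x < s" for x
      using bv0[OF that] bv1[OF that] glue[of x] pq[of x x] that s by auto
    show "(\<lambda>t. boundary_value (Omega1 l \<gamma>) (ddy u) (t, 0) * Q (x, t)) integrable_on {0..x}" if "0 < x" "x < s" for x
      using int[of x] that s by auto
    show "q0 (x, 0) = \<alpha> * boundary_value (Omega1 l \<gamma>) (ddy u) (x, 0) +
          \<beta> * integral {0..x} (\<lambda>t. boundary_value (Omega1 l \<gamma>) (ddy u) (t, 0) * Q (x, t))" if "0 < x" "x < s" for x
      using bv0[OF that] glue'[of x] that s by auto
  qed (use that in auto)
  \<comment> \<open>Beyond \<open>l\<close> the lower boundary is BC, where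
    \<open>x - depth x = 2 * x - 1\<close> increases in any case.\<close>
  have dmono: "x' - depth x' \<le> x - depth x" if "0 \<le> x'" "x' \<le> x" "x < 1" for x x'
    using that l mono_onD[OF mono, of x' x] mono_onD[OF mono, of x' l] by (auto simp: depth_def gamma_l)
  have hyp: "u (x, y) = 0" if xy: "(x, y) \<in> Omega1 l \<gamma>" "x - y < s" for x y
  proof -
    have x: "0 < x" "x < 1" "y < 0" "- depth x < y" using xy by (auto simp: Omega1_iff)
    \<comment> \<open>\<open>x + y\<close> is the abscissa at which the second characteristic
      through \<open>(x, y)\<close> meets AB.\<close>
    have pos: "0 < x + y" using dmono[of 0 x] x l by (simp add: depth_def gamma_0)
    \<comment> \<open>Moving by \<open>(-1, 1)\<close> keeps \<open>x + y\<close> and lowers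
      \<open>x - y\<close>, so the whole path stays before \<open>s\<close> and ends on AB, where
      \<open>u\<close> is already known to vanish.\<close>
    have path: "(x + (-1) * \<sigma>, y + 1 * \<sigma>) \<in> Omega1 l \<gamma>" if "0 \<le> \<sigma>" "\<sigma> < - y" for \<sigma>
      using that x pos dmono[of "x - \<sigma>" x] by (auto simp: Omega1_iff)
    have d0: "((\<lambda>\<sigma>. u (x + (-1) * \<sigma>, y + 1 * \<sigma>)) has_real_derivative 0) (at \<sigma>)" if \<sigma>: "0 < \<sigma>" "\<sigma> < - y" for \<sigma>
    proof -
      have P: "(x + (-1) * \<sigma>, y + 1 * \<sigma>) \<in> Omega1 l \<gamma>" using path \<sigma> by auto
      have "p (x - \<sigma>, (x - \<sigma>) - (x - y - 2 * \<sigma>)) = q (x - \<sigma>, (x - \<sigma>) - (x - y - 2 * \<sigma>))"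
        by (rule pq) (use P \<sigma> x pos xy in \<open>auto simp: algebra_simps\<close>)
      then have "ddx u (x + (-1) * \<sigma>, y + 1 * \<sigma>) = ddy u (x + (-1) * \<sigma>, y + 1 * \<sigma>)"
        using P p(2) q(2) by (simp add: algebra_simps)
      then show ?thesis
        using C_class_directional_DERIV[OF open_Omega1 u22 _ _ P] by simp
    qed
    have clos: "(x + (-1) * \<sigma>, y + 1 * \<sigma>) \<in> closure (Omega l \<gamma>)" if "0 \<le> \<sigma>" "\<sigma> \<le> - y" for \<sigma>
    proof (cases "\<sigma> = - y")
      case True
      then have "(x + (-1) * \<sigma>, y + 1 * \<sigma>) \<in> {0..1} \<times> {0..1}" using x pos by auto
      then show ?thesis using square_subset_closure by blast
    next
      case False
      then show ?thesis using path[of \<sigma>] that closure_subset[of "Omega l \<gamma>"] by (auto simp: Omega_def)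
    qed
    have "u (x + (-1) * (- y), y + 1 * (- y)) = u (x + (-1) * 0, y + 1 * 0)"
    proof (rule DERIV_isconst_end[where f="\<lambda>\<sigma>. u (x + (-1) * \<sigma>, y + 1 * \<sigma>)" and a=0 and b="- y"])
      show "continuous_on {0..- y} (\<lambda>\<sigma>. u (x + (-1) * \<sigma>, y + 1 * \<sigma>))"
        using clos by (intro continuous_on_compose2[OF cu] continuous_intros) auto
    qed (use x d0 in auto)
    then show ?thesis using square[of "x + y" 0] pos x xy by simp
  qed
  show ?thesis
    using z square hyp clock_Omega1 by (cases z) (auto simp: Omega_def Omega0_def segment_AB_def clock_def)
qed

end

section \<open>Hilbert--Schmidt operators on functions over a Borel set\<close>

text \<open>If the product is not integrable, its Bochner integral is 0 and the bound is trivial;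
  otherwise this is Cauchy-Schwarz. In this form it can be applied even when the right-hand side is
  infinite.\<close>

lemma square_integral_le:
  fixes f g :: "'a \<Rightarrow> real"
  assumes [measurable]: "f \<in> borel_measurable M" "g \<in> borel_measurable M"
  shows "ennreal ((LINT x|M. f x * g x)\<^sup>2) \<le> (\<integral>\<^sup>+x. ennreal ((f x)\<^sup>2) \<partial>M) * (\<integral>\<^sup>+x. ennreal ((g x)\<^sup>2) \<partial>M)"
proof (cases "integrable M (\<lambda>x. f x * g x)")
  case True
  have "ennreal ((LINT x|M. f x * g x)\<^sup>2) = (ennreal (norm (LINT x|M. f x * g x)))\<^sup>2"
    by (simp add: ennreal_power)
  also have "\<dots> \<le> (\<integral>\<^sup>+x. norm (f x * g x) \<partial>M)\<^sup>2"
    by (intro power_mono integral_norm_bound_ennreal True) auto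
  also have "\<dots> = (\<integral>\<^sup>+x. ennreal \<bar>f x\<bar> * ennreal \<bar>g x\<bar> \<partial>M)\<^sup>2"
    by (simp add: abs_mult ennreal_mult)
  also have "\<dots> \<le> (\<integral>\<^sup>+x. ennreal \<bar>f x\<bar> ^ 2 \<partial>M) * (\<integral>\<^sup>+x. ennreal \<bar>g x\<bar> ^ 2 \<partial>M)"
    by (rule Cauchy_Schwarz_nn_integral) auto
  finally show ?thesis by (simp add: ennreal_power)
next
  case False
  then show ?thesis by (simp add: not_integrable_integral_eq)
qed

lemma integrable_mult_square:
  fixes f g :: "'a \<Rightarrow> real"
  assumes [measurable]: "f \<in> borel_measurable M" "g \<in> borel_measurable M"
    and fin: "(\<integral>\<^sup>+x. ennreal ((f x)\<^sup>2) \<partial>M) < \<infinity>" "(\<integral>\<^sup>+x. ennreal ((g x)\<^sup>2) \<partial>M) < \<infinity>"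
  shows "integrable M (\<lambda>x. f x * g x)"
proof (rule integrableI_bounded)
  have "(\<integral>\<^sup>+x. norm (f x * g x) \<partial>M)\<^sup>2 = (\<integral>\<^sup>+x. ennreal \<bar>f x\<bar> * ennreal \<bar>g x\<bar> \<partial>M)\<^sup>2"
    by (simp add: abs_mult ennreal_mult)
  also have "\<dots> \<le> (\<integral>\<^sup>+x. ennreal \<bar>f x\<bar> ^ 2 \<partial>M) * (\<integral>\<^sup>+x. ennreal \<bar>g x\<bar> ^ 2 \<partial>M)"
    by (rule Cauchy_Schwarz_nn_integral) auto
  also have "\<dots> < \<infinity>"
    using fin by (simp add: ennreal_power ennreal_mult_less_top)
  finally show "(\<integral>\<^sup>+x. norm (f x * g x) \<partial>M) < \<infinity>"
    by (cases "(\<integral>\<^sup>+x. norm (f x * g x) \<partial>M) = top") (auto simp: power2_eq_square top.not_eq_extremum)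
qed measurable

section \<open>Squared norms in \<open>[0, \<infinity>]\<close> and Borel representatives\<close>

definition sq :: "('a::euclidean_space \<Rightarrow> real) \<Rightarrow> ennreal" where
  "sq f = (\<integral>\<^sup>+x. ennreal ((f x)\<^sup>2) \<partial>lborel)"

text \<open>Functions in \<open>L2_space (lebesgue_on D)\<close> are measurable for the completed
  measure only. A Borel representative that is 0 outside \<open>D\<close> allows integration over
  the whole space with \<open>lborel\<close>, where Tonelli's theorem is at hand for
  products.\<close>

definition represents :: "'a::euclidean_space set \<Rightarrow> ('a \<Rightarrow> real) \<Rightarrow> ('a \<Rightarrow> real) \<Rightarrow> bool" where
  "represents D f g \<longleftrightarrow> g \<in> borel_measurable borel \<and> (\<forall>x. x \<notin> D \<longrightarrow> g x = 0) \<and>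
     (AE x in lborel. x \<in> D \<longrightarrow> f x = g x)"

lemma AE_lebesgue_on_iff:
  assumes "D \<in> sets borel"
  shows "(AE x in lebesgue_on D. P x) \<longleftrightarrow> (AE x in lborel. x \<in> D \<longrightarrow> P x)"
  using assms by (subst AE_restrict_space_iff) (auto simp: AE_completion_iff)

lemma borel_measurable_completion_cong_AE:
  fixes f g :: "'a \<Rightarrow> real"
  assumes f: "f \<in> borel_measurable (completion M)" and eq: "AE x in completion M. f x = g x"
  shows "g \<in> borel_measurable (completion M)"
proof (rule measurableI)
  fix A :: "real set" assume "A \<in> sets borel"
  then have "f -` A \<inter> space M \<in> sets (completion M)"
    using measurable_sets[OF f] by simp
  moreover have "AE x in completion M. x \<in> f -` A \<inter> space M \<longleftrightarrow> x \<in> g -` A \<inter> space M"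
    using eq by (auto elim!: AE_mp)
  ultimately show "g -` A \<inter> space (completion M) \<in> sets (completion M)"
    using completion.in_sets_AE[of "f -` A \<inter> space M" "g -` A \<inter> space M" M] by simp
qed simp

lemma borel_measurable_lebesgue_on_iff:
  fixes f :: "'a::euclidean_space \<Rightarrow> real"
  assumes D: "D \<in> sets borel"
  shows "f \<in> borel_measurable (lebesgue_on D) \<longleftrightarrow> (\<exists>g. represents D f g)"
proof
  assume "f \<in> borel_measurable (lebesgue_on D)"
  then have "(\<lambda>x. indicator D x *\<^sub>R f x) \<in> borel_measurable lebesgue"
    using D by (subst (asm) borel_measurable_restrict_space_iff) auto
  then obtain g where [measurable]: "g \<in> borel_measurable lborel" and g: "AE x in lborel. indicator D x *\<^sub>R f x = g x"
    using completion_ex_borel_measurable_real by blast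
  have "represents D f (\<lambda>x. indicator D x * g x)"
    unfolding represents_def using g D by (auto elim: AE_mp)
  then show "\<exists>g. represents D f g" by blast
next
  assume "\<exists>g. represents D f g"
  then obtain g where g: "g \<in> borel_measurable borel" "AE x in lborel. x \<in> D \<longrightarrow> f x = g x"
    by (auto simp: represents_def)
  have "g \<in> borel_measurable lebesgue" using g(1) by (simp add: measurable_completion)
  then have 1: "(\<lambda>x. indicator D x *\<^sub>R g x) \<in> borel_measurable lebesgue"
    using D by (intro borel_measurable_scaleR borel_measurable_indicator) auto
  have "AE x in lebesgue. indicator D x *\<^sub>R g x = indicator D x *\<^sub>R f x"
    using g(2) by (auto simp: AE_completion_iff indicator_def)
  with 1 have "(\<lambda>x. indicator D x *\<^sub>R f x) \<in> borel_measurable lebesgue"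
    by (rule borel_measurable_completion_cong_AE)
  then show "f \<in> borel_measurable (lebesgue_on D)"
    using D by (subst borel_measurable_restrict_space_iff) auto
qed

lemma represents_nn_integral:
  assumes D: "D \<in> sets borel" and g: "represents D f g"
  shows "(\<integral>\<^sup>+x. ennreal ((f x)\<^sup>2) \<partial>lebesgue_on D) = sq g"
proof -
  have "(\<integral>\<^sup>+x. ennreal ((f x)\<^sup>2) \<partial>lebesgue_on D) = (\<integral>\<^sup>+x. ennreal ((g x)\<^sup>2) \<partial>lebesgue_on D)"
    using g D by (intro nn_integral_cong_AE) (auto simp: AE_lebesgue_on_iff represents_def elim: eventually_mono)
  also have "\<dots> = (\<integral>\<^sup>+x. ennreal ((g x)\<^sup>2) * indicator D x \<partial>lebesgue)"
    using D by (subst nn_integral_restrict_space) auto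
  also have "\<dots> = (\<integral>\<^sup>+x. ennreal ((g x)\<^sup>2) \<partial>lebesgue)"
    using g by (intro nn_integral_cong) (auto simp: represents_def indicator_def)
  finally show ?thesis by (simp add: nn_integral_completion sq_def)
qed

lemma L2_space_lebesgue_on_iff:
  assumes D: "D \<in> sets borel"
  shows "f \<in> L2_space (lebesgue_on D) \<longleftrightarrow> (\<exists>g. represents D f g \<and> sq g < \<infinity>)"
proof
  assume f: "f \<in> L2_space (lebesgue_on D)"
  then obtain g where g: "represents D f g"
    using borel_measurable_lebesgue_on_iff[OF D] by (auto simp: L2_space_def)
  have "(\<integral>\<^sup>+x. ennreal ((f x)\<^sup>2) \<partial>lebesgue_on D) < \<infinity>"
    using f by (auto simp: L2_space_def integrable_iff_bounded)
  with g show "\<exists>g. represents D f g \<and> sq g < \<infinity>"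
    using represents_nn_integral[OF D g] by auto
next
  assume "\<exists>g. represents D f g \<and> sq g < \<infinity>"
  then obtain g where g: "represents D f g" "sq g < \<infinity>" by blast
  then have f: "f \<in> borel_measurable (lebesgue_on D)" using borel_measurable_lebesgue_on_iff[OF D] by blast
  moreover have "integrable (lebesgue_on D) (\<lambda>x. (f x)\<^sup>2)"
    using f g(2) represents_nn_integral[OF D g(1)] by (intro integrableI_bounded) auto
  ultimately show "f \<in> L2_space (lebesgue_on D)" by (simp add: L2_space_def)
qed

lemma L2_nrm_represents:
  assumes D: "D \<in> sets borel" and g: "represents D f g"
  shows "L2_nrm (lebesgue_on D) f = sqrt (enn2real (sq g))"
proof -
  have f: "f \<in> borel_measurable (lebesgue_on D)" using borel_measurable_lebesgue_on_iff[OF D] g by blast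
  have "(LINT x|lebesgue_on D. (f x)\<^sup>2) = enn2real (\<integral>\<^sup>+x. ennreal ((f x)\<^sup>2) \<partial>lebesgue_on D)"
    by (rule integral_eq_nn_integral) (use f in auto)
  then show ?thesis
    by (simp add: L2_nrm_def represents_nn_integral[OF D g])
qed

lemma represents_add:
  assumes "represents D f f'" "represents D g g'"
  shows "represents D (\<lambda>x. a * f x + b * g x) (\<lambda>x. a * f' x + b * g' x)"
  using assms by (auto simp: represents_def elim!: AE_mp)

text \<open>\<open>k\<close> is a Borel representative of \<open>K\<close>. A null set of the
  product is controlled only on almost every section, hence the nested form of \<open>k_AE\<close>:
  for exceptional \<open>p\<close> the row of \<open>K\<close> may even fail to be
  measurable.\<close>

locale hs_kernel =
  fixes D :: "'a::euclidean_space set" and K k :: "'a \<times> 'a \<Rightarrow> real"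
  assumes D: "D \<in> sets borel" and finD: "emeasure lborel D < \<infinity>"
    and k_meas [measurable]: "k \<in> borel_measurable borel"
    and k_zero: "\<And>p q. p \<notin> D \<or> q \<notin> D \<Longrightarrow> k (p, q) = 0"
    and k_fin: "sq k < \<infinity>"
    and k_AE: "AE p in lborel. p \<in> D \<longrightarrow> (AE q in lborel. q \<in> D \<longrightarrow> K (p, q) = k (p, q))"
begin

definition S :: "('a \<Rightarrow> real) \<Rightarrow> 'a \<Rightarrow> real" where
  "S f = (\<lambda>p. LINT q|lborel. k (p, q) * f q)"

definition row :: "'a \<Rightarrow> ennreal" where
  "row p = (\<integral>\<^sup>+q. ennreal ((k (p, q))\<^sup>2) \<partial>lborel)"

lemma k_pair [measurable]: "k \<in> borel_measurable (lborel \<Otimes>\<^sub>M lborel)"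
  using k_meas by (simp add: lborel_prod)

lemma row_meas [measurable]: "row \<in> borel_measurable borel"
  unfolding row_def by measurable

lemma row_integral: "(\<integral>\<^sup>+p. row p \<partial>lborel) = sq k"
  unfolding row_def sq_def
  by (subst lborel.nn_integral_fst) (auto simp: lborel_prod)

lemma row_AE: "AE p in lborel. row p < \<infinity>"
  using nn_integral_noteq_infinite[of row lborel] k_fin
  by (auto simp: row_integral less_top[symmetric])

lemma S_meas [measurable]: "f \<in> borel_measurable borel \<Longrightarrow> S f \<in> borel_measurable borel"
proof -
  assume [measurable]: "f \<in> borel_measurable borel"
  have "(\<lambda>p. LINT q|lborel. k (p, q) * f q) \<in> borel_measurable lborel"
    by (rule lborel.borel_measurable_lebesgue_integral) measurable
  then show "S f \<in> borel_measurable borel" by (simp add: S_def)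
qed

lemma S_outside: "p \<notin> D \<Longrightarrow> S f p = 0"
  by (simp add: S_def k_zero)

lemma S_square_le:
  assumes [measurable]: "f \<in> borel_measurable borel"
  shows "ennreal ((S f p)\<^sup>2) \<le> row p * sq f"
  unfolding S_def row_def sq_def by (rule square_integral_le) auto

text \<open>Inserting \<open>w q / w q\<close> turns the weighted image into the operator with
  kernel \<open>w p * k (p, q) / w q\<close> applied to the weighted function; then Cauchy-Schwarz
  in \<open>q\<close> and Tonelli. The weight 1 gives the usual Hilbert-Schmidt bound.\<close>

lemma S_weighted:
  assumes [measurable]: "f \<in> borel_measurable borel" "w \<in> borel_measurable borel" and w: "\<And>q. w q > 0"
  shows "sq (\<lambda>p. w p * S f p) \<le> sq (\<lambda>(p, q). w p * k (p, q) / w q) * sq (\<lambda>q. w q * f q)"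
proof -
  have "ennreal ((w p * S f p)\<^sup>2) \<le> (\<integral>\<^sup>+q. ennreal ((w p * k (p, q) / w q)\<^sup>2) \<partial>lborel) * sq (\<lambda>q. w q * f q)" for p
  proof -
    have eq: "w p * S f p = (LINT q|lborel. (w p * k (p, q) / w q) * (w q * f q))"
      unfolding S_def integral_mult_right_zero[symmetric] using w
      by (intro Bochner_Integration.integral_cong) (auto simp: less_imp_neq[symmetric])
    show ?thesis unfolding eq sq_def by (rule square_integral_le) auto
  qed
  then have "sq (\<lambda>p. w p * S f p) \<le> (\<integral>\<^sup>+p. (\<integral>\<^sup>+q. ennreal ((w p * k (p, q) / w q)\<^sup>2) \<partial>lborel) * sq (\<lambda>q. w q * f q) \<partial>lborel)"
    unfolding sq_def[of "\<lambda>p. w p * S f p"] by (intro nn_integral_mono) auto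
  also have "\<dots> = (\<integral>\<^sup>+p. (\<integral>\<^sup>+q. ennreal ((w p * k (p, q) / w q)\<^sup>2) \<partial>lborel) \<partial>lborel) * sq (\<lambda>q. w q * f q)"
    by (rule nn_integral_multc) measurable
  also have "(\<integral>\<^sup>+p. (\<integral>\<^sup>+q. ennreal ((w p * k (p, q) / w q)\<^sup>2) \<partial>lborel) \<partial>lborel) = sq (\<lambda>(p, q). w p * k (p, q) / w q)"
    unfolding sq_def lborel_prod[symmetric]
    by (subst lborel.nn_integral_fst[symmetric]) (auto simp: case_prod_beta)
  finally show ?thesis .
qed

lemma S_sq: "f \<in> borel_measurable borel \<Longrightarrow> sq (S f) \<le> sq k * sq f"
  using S_weighted[of f "\<lambda>_. 1"] by (simp add: case_prod_beta)

lemma represents_S: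
  assumes f: "represents D f f'"
  shows "represents D (kernel_operator D K f) (S f')"
  unfolding represents_def
proof (intro conjI allI impI)
  have [measurable]: "f' \<in> borel_measurable borel" using f by (simp add: represents_def)
  show "S f' \<in> borel_measurable borel" by measurable
  show "S f' x = 0" if "x \<notin> D" for x using that by (rule S_outside)
  show "AE p in lborel. p \<in> D \<longrightarrow> kernel_operator D K f p = S f' p"
    using k_AE
  proof (rule AE_mp, intro AE_I2 impI)
    fix p assume "p \<in> D \<longrightarrow> (AE q in lborel. q \<in> D \<longrightarrow> K (p, q) = k (p, q))" and p: "p \<in> D"
    then have *: "AE q in lborel. q \<in> D \<longrightarrow> K (p, q) = k (p, q)" by blast
    have r: "represents D (\<lambda>q. K (p, q) * f q) (\<lambda>q. k (p, q) * f' q)"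
      using f * k_zero by (auto simp: represents_def elim!: AE_mp)
    then have "(\<lambda>q. K (p, q) * f q) \<in> borel_measurable (lebesgue_on D)"
      using borel_measurable_lebesgue_on_iff[OF D] by blast
    then have "kernel_operator D K f p = (LINT q|lebesgue_on D. k (p, q) * f' q)"
      unfolding kernel_operator_def using r D
      by (intro integral_cong_AE) (auto simp: AE_lebesgue_on_iff represents_def measurable_restrict_space1 measurable_completion)
    also have "\<dots> = (LINT q|lebesgue. indicator D q *\<^sub>R (k (p, q) * f' q))"
      using D by (subst integral_restrict_space) auto
    also have "\<dots> = (LINT q|lebesgue. k (p, q) * f' q)"
      using k_zero by (intro Bochner_Integration.integral_cong) (auto simp: indicator_def)
    also have "\<dots> = S f' p"
      unfolding S_def by (rule integral_completion) measurable
    finally show "kernel_operator D K f p = S f' p" .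
  qed
qed

lemma kernel_operator_L2: "f \<in> L2_space (lebesgue_on D) \<Longrightarrow> kernel_operator D K f \<in> L2_space (lebesgue_on D)"
proof -
  assume "f \<in> L2_space (lebesgue_on D)"
  then obtain g where g: "represents D f g" "sq g < \<infinity>"
    using L2_space_lebesgue_on_iff[OF D] by blast
  then have "sq (S g) < \<infinity>"
    using S_sq[of g] k_fin by (auto simp: represents_def ennreal_mult_less_top intro: le_less_trans)
  then show ?thesis using L2_space_lebesgue_on_iff[OF D] represents_S[OF g(1)] by blast
qed

lemma S_linear:
  assumes [measurable]: "f \<in> borel_measurable borel" "g \<in> borel_measurable borel" and fin: "sq f < \<infinity>" "sq g < \<infinity>"
    and p: "row p < \<infinity>"
  shows "S (\<lambda>x. a * f x + b * g x) p = a * S f p + b * S g p"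
proof -
  have i: "integrable lborel (\<lambda>q. k (p, q) * f q)" "integrable lborel (\<lambda>q. k (p, q) * g q)"
    using fin p unfolding row_def sq_def by (auto intro!: integrable_mult_square)
  have "S (\<lambda>x. a * f x + b * g x) p = (LINT q|lborel. a * (k (p, q) * f q) + b * (k (p, q) * g q))"
    unfolding S_def by (intro Bochner_Integration.integral_cong) (auto simp: algebra_simps)
  also have "\<dots> = a * S f p + b * S g p"
    unfolding S_def using i by simp
  finally show ?thesis .
qed

lemma AE_represents_eq:
  assumes "represents D f h" "represents D g h'" "AE p in lborel. h p = h' p"
  shows "AE x in lebesgue_on D. f x = g x"
  using assms D by (auto simp: AE_lebesgue_on_iff represents_def elim!: AE_mp)

lemma L2_linear_kernel_operator: "L2_linear (lebesgue_on D) (kernel_operator D K)"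
  unfolding L2_linear_def
proof (intro conjI ballI allI impI)
  fix f assume "f \<in> L2_space (lebesgue_on D)"
  then show "kernel_operator D K f \<in> L2_space (lebesgue_on D)" by (rule kernel_operator_L2)
next
  fix f g assume "f \<in> L2_space (lebesgue_on D)" "g \<in> L2_space (lebesgue_on D)" and eq: "AE x in lebesgue_on D. f x = g x"
  then obtain f' where f': "represents D f f'" using L2_space_lebesgue_on_iff[OF D] by blast
  then have "represents D g f'" using eq D by (auto simp: represents_def AE_lebesgue_on_iff elim!: AE_mp)
  then show "AE x in lebesgue_on D. kernel_operator D K f x = kernel_operator D K g x"
    using AE_represents_eq[OF represents_S[OF f'] represents_S] by simp
next
  fix f g a b assume "f \<in> L2_space (lebesgue_on D)" "g \<in> L2_space (lebesgue_on D)"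
  then obtain f' g' where r: "represents D f f'" "represents D g g'" "sq f' < \<infinity>" "sq g' < \<infinity>"
    using L2_space_lebesgue_on_iff[OF D] by blast
  have "AE p in lborel. S (\<lambda>x. a * f' x + b * g' x) p = a * S f' p + b * S g' p"
    using row_AE by (rule AE_mp) (use r in \<open>auto simp: represents_def intro!: S_linear\<close>)
  then show "AE x in lebesgue_on D. kernel_operator D K (\<lambda>z. a * f z + b * g z) x =
      a * kernel_operator D K f x + b * kernel_operator D K g x"
    by (rule AE_represents_eq[OF represents_S[OF represents_add[OF r(1,2)]] represents_add[OF represents_S[OF r(1)] represents_S[OF r(2)]]])
qed

end

lemma hs_kernel_exists:
  fixes D :: "'a::euclidean_space set"
  assumes D: "D \<in> sets borel" "emeasure lborel D < \<infinity>" and K: "K \<in> L2_space (lebesgue_on (D \<times> D))"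
  obtains k where "hs_kernel D K k"
proof -
  have DD: "D \<times> D \<in> sets borel" using D(1) by (intro borel_Times)
  obtain k where k: "represents (D \<times> D) K k" "sq k < \<infinity>"
    using K L2_space_lebesgue_on_iff[OF DD] by blast
  have "AE z in lborel \<Otimes>\<^sub>M lborel. z \<in> D \<times> D \<longrightarrow> K z = k z"
    using k(1) unfolding represents_def by (subst lborel_prod) simp
  then have "AE p in lborel. AE q in lborel. (p, q) \<in> D \<times> D \<longrightarrow> K (p, q) = k (p, q)"
    by (rule lborel_pair.AE_pair)
  then have "hs_kernel D K k"
    using k D by unfold_locales (auto simp: represents_def elim!: AE_mp)
  then show ?thesis by (rule that)
qed

section \<open>Quasi-nilpotence of causal Hilbert--Schmidt operators\<close>

context hs_kernel begin

lemma represents_iterate: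
  "represents D f f' \<Longrightarrow> represents D ((kernel_operator D K ^^ n) f) ((S ^^ n) f')"
  by (induction n) (auto intro: represents_S)

lemma weighted_iterate:
  assumes [measurable]: "w \<in> borel_measurable borel" and w: "\<And>q. w q > 0" and f: "represents D f f'"
  shows "sq (\<lambda>p. w p * (S ^^ n) f' p) \<le> sq (\<lambda>(p, q). w p * k (p, q) / w q) ^ n * sq (\<lambda>p. w p * f' p)"
proof (induction n)
  case (Suc n)
  have [measurable]: "(S ^^ n) f' \<in> borel_measurable borel"
    using represents_iterate[OF f, of n] by (simp add: represents_def)
  have "sq (\<lambda>p. w p * (S ^^ Suc n) f' p) \<le> sq (\<lambda>(p, q). w p * k (p, q) / w q) * sq (\<lambda>p. w p * (S ^^ n) f' p)"
    using S_weighted[of "(S ^^ n) f'" w] w by simp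
  also have "\<dots> \<le> sq (\<lambda>(p, q). w p * k (p, q) / w q) * (sq (\<lambda>(p, q). w p * k (p, q) / w q) ^ n * sq (\<lambda>p. w p * f' p))"
    by (intro mult_left_mono Suc.IH) auto
  finally show ?case by (simp add: mult.assoc)
qed simp

text \<open>On \<open>D\<close> the weight lies between \<open>exp (- t)\<close> and 1, and the
  iterates vanish outside \<open>D\<close>; so the factor \<open>exp t\<close> is paid once and not
  once for each power. The square root appears because \<open>\<kappa>\<close> is a squared
  norm.\<close>

lemma iterate_norm_le:
  fixes \<phi> :: "'a \<Rightarrow> real"
  assumes \<phi> [measurable]: "\<phi> \<in> borel_measurable borel" and \<phi>01: "\<And>x. x \<in> D \<Longrightarrow> 0 \<le> \<phi> x \<and> \<phi> x \<le> 1"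
    and \<kappa>: "sq (\<lambda>(p, q). exp (- (t * \<phi> p)) * k (p, q) / exp (- (t * \<phi> q))) = ennreal \<kappa>" "0 \<le> \<kappa>" and t: "0 \<le> t"
    and f: "f \<in> L2_space (lebesgue_on D)"
  shows "L2_nrm (lebesgue_on D) ((kernel_operator D K ^^ n) f) \<le> exp t * sqrt \<kappa> ^ n * L2_nrm (lebesgue_on D) f"
proof -
  obtain f' where f': "represents D f f'" and fin: "sq f' < \<infinity>"
    using f L2_space_lebesgue_on_iff[OF D] by blast
  define g where "g = (S ^^ n) f'"
  have g: "represents D ((kernel_operator D K ^^ n) f) g"
    unfolding g_def by (rule represents_iterate[OF f'])
  have [measurable]: "g \<in> borel_measurable borel" "f' \<in> borel_measurable borel"
    using g f' by (auto simp: represents_def)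
  let ?w = "\<lambda>x. exp (- (t * \<phi> x))"
  have "sq g \<le> (\<integral>\<^sup>+x. ennreal (exp (2 * t)) * ennreal ((?w x * g x)\<^sup>2) \<partial>lborel)"
    unfolding sq_def
  proof (rule nn_integral_mono)
    fix x
    have "(g x)\<^sup>2 \<le> exp (2 * t) * (?w x * g x)\<^sup>2"
    proof (cases "x \<in> D")
      case True
      then have "t * \<phi> x \<le> t" using \<phi>01[OF True] t by (simp add: mult_left_le)
      then have "1 \<le> exp (2 * t) * (?w x)\<^sup>2"
        by (simp add: exp_double[symmetric] exp_add[symmetric] power2_eq_square)
      then have "1 * (g x)\<^sup>2 \<le> (exp (2 * t) * (?w x)\<^sup>2) * (g x)\<^sup>2"
        by (rule mult_right_mono) auto
      then show ?thesis by (simp add: power_mult_distrib mult.assoc)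
    qed (use g in \<open>auto simp: represents_def\<close>)
    then show "ennreal ((g x)\<^sup>2) \<le> ennreal (exp (2 * t)) * ennreal ((?w x * g x)\<^sup>2)"
      by (simp add: ennreal_mult[symmetric] ennreal_leI)
  qed
  also have "\<dots> = ennreal (exp (2 * t)) * sq (\<lambda>x. ?w x * g x)"
    unfolding sq_def by (rule nn_integral_cmult) measurable
  also have "\<dots> \<le> ennreal (exp (2 * t)) * (ennreal \<kappa> ^ n * sq (\<lambda>x. ?w x * f' x))"
    using weighted_iterate[of ?w f f' n] f' unfolding g_def \<kappa>(1)[symmetric]
    by (intro mult_left_mono) auto
  also have "\<dots> \<le> ennreal (exp (2 * t)) * (ennreal \<kappa> ^ n * sq f')"
  proof (intro mult_left_mono)
    show "sq (\<lambda>x. ?w x * f' x) \<le> sq f'"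
      unfolding sq_def
    proof (rule nn_integral_mono, rule ennreal_leI)
      fix x
      show "(?w x * f' x)\<^sup>2 \<le> (f' x)\<^sup>2"
      proof (cases "x \<in> D")
        case True
        then have "?w x \<le> 1" using \<phi>01[OF True] t by simp
        then have "\<bar>?w x * f' x\<bar> \<le> \<bar>f' x\<bar>" by (simp add: abs_mult mult_left_le_one_le)
        then show ?thesis by (simp add: abs_le_square_iff)
      qed (use f' in \<open>auto simp: represents_def\<close>)
    qed
  qed auto
  finally have "sq g \<le> ennreal (exp (2 * t)) * (ennreal \<kappa> ^ n * sq f')" .
  moreover have "sq f' = ennreal (enn2real (sq f'))" using fin by simp
  ultimately have "sq g \<le> ennreal (exp (2 * t) * (\<kappa> ^ n * enn2real (sq f')))"
    using \<kappa>(2) by (simp add: ennreal_mult ennreal_power)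
  then have "enn2real (sq g) \<le> exp (2 * t) * (\<kappa> ^ n * enn2real (sq f'))"
    using \<kappa>(2) by (intro enn2real_leI) auto
  then have "sqrt (enn2real (sq g)) \<le> sqrt (exp (2 * t) * (\<kappa> ^ n * enn2real (sq f')))"
    by (rule real_sqrt_le_mono)
  also have "\<dots> = exp t * sqrt \<kappa> ^ n * sqrt (enn2real (sq f'))"
    by (simp add: real_sqrt_mult real_sqrt_power exp_double)
  finally show ?thesis
    by (simp add: L2_nrm_represents[OF D g] L2_nrm_represents[OF D f'])
qed

text \<open>Causality makes the exponential factor at most 1 wherever \<open>k\<close> is nonzero,
  so k^2 dominates. The factor tends to 0 only where \<open>\<phi>\<close> differs at the two
  points; this is almost everywhere because the level sets of \<open>\<phi>\<close> are
  null.\<close>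

lemma weighted_kernel_tendsto_0:
  fixes \<phi> :: "'a \<Rightarrow> real"
  assumes \<phi> [measurable]: "\<phi> \<in> borel_measurable borel"
    and causal: "AE (p, q) in lborel. \<phi> p < \<phi> q \<longrightarrow> k (p, q) = 0"
    and level: "\<And>c. AE q in lborel. \<phi> q \<noteq> c"
  shows "(\<lambda>j. sq (\<lambda>(p, q). exp (- (real j * \<phi> p)) * k (p, q) / exp (- (real j * \<phi> q)))) \<longlonglongrightarrow> 0"
proof -
  have eq: "exp (- (real j * \<phi> p)) * r / exp (- (real j * \<phi> q)) = r * exp (- (\<phi> p - \<phi> q)) ^ j" for j p q r
    by (simp add: exp_diff[symmetric] exp_of_nat_mult[symmetric] exp_minus field_simps flip: exp_add)
  have f1: "(\<lambda>z::'a \<times> 'a. \<phi> (fst z)) \<in> borel_measurable borel" and f2: "(\<lambda>z::'a \<times> 'a. \<phi> (snd z)) \<in> borel_measurable borel"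
    by (rule measurable_compose[OF _ \<phi>]; intro borel_measurable_continuous_onI continuous_intros)+
  have "AE z in lborel \<Otimes>\<^sub>M lborel. \<phi> (snd z) \<noteq> \<phi> (fst z)"
  proof (rule lborel_pair.AE_pair_measure)
    show "{x \<in> space (lborel \<Otimes>\<^sub>M lborel). \<phi> (snd x) \<noteq> \<phi> (fst x)} \<in> sets (lborel \<Otimes>\<^sub>M lborel)"
      by measurable
  qed (use level in auto)
  then have ne: "AE z in lborel. \<phi> (snd z) \<noteq> \<phi> (fst z)" by (subst (asm) lborel_prod)
  have "(\<lambda>j. sq (\<lambda>(p, q). exp (- (real j * \<phi> p)) * k (p, q) / exp (- (real j * \<phi> q)))) \<longlonglongrightarrow> (\<integral>\<^sup>+z. 0 \<partial>(lborel :: ('a \<times> 'a) measure))"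
    unfolding sq_def eq case_prod_beta prod.collapse
  proof (rule nn_integral_dominated_convergence[where w="\<lambda>z. ennreal ((k z)\<^sup>2)"])
    show "(\<integral>\<^sup>+z. ennreal ((k z)\<^sup>2) \<partial>lborel) < \<infinity>" using k_fin by (simp add: sq_def)
    show "AE z in lborel. ennreal ((k z * exp (- (\<phi> (fst z) - \<phi> (snd z))) ^ j)\<^sup>2) \<le> ennreal ((k z)\<^sup>2)" for j
      using causal
    proof (rule AE_mp, intro AE_I2 impI)
      fix z assume z: "case z of (p, q) \<Rightarrow> \<phi> p < \<phi> q \<longrightarrow> k (p, q) = 0"
      show "ennreal ((k z * exp (- (\<phi> (fst z) - \<phi> (snd z))) ^ j)\<^sup>2) \<le> ennreal ((k z)\<^sup>2)"
      proof (cases "k z = 0")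
        case False
        then have "\<phi> (snd z) \<le> \<phi> (fst z)" using z by (cases z) (auto simp: not_less)
        then have "exp (- (\<phi> (fst z) - \<phi> (snd z))) ^ j \<le> 1" by (intro power_le_one) auto
        then have "\<bar>k z * exp (- (\<phi> (fst z) - \<phi> (snd z))) ^ j\<bar> \<le> \<bar>k z\<bar>"
          by (simp add: abs_mult mult_left_le)
        then show ?thesis by (simp add: abs_le_square_iff ennreal_leI)
      qed simp
    qed
    show "AE z in lborel. (\<lambda>j. ennreal ((k z * exp (- (\<phi> (fst z) - \<phi> (snd z))) ^ j)\<^sup>2)) \<longlonglongrightarrow> 0"
      using AE_conjI[OF causal ne]
    proof (rule AE_mp, intro AE_I2 impI)
      fix z assume z: "(case z of (p, q) \<Rightarrow> \<phi> p < \<phi> q \<longrightarrow> k (p, q) = 0) \<and> \<phi> (snd z) \<noteq> \<phi> (fst z)"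
      have "(\<lambda>j. (k z * exp (- (\<phi> (fst z) - \<phi> (snd z))) ^ j)\<^sup>2) \<longlonglongrightarrow> 0"
      proof (cases "k z = 0")
        case False
        then have "\<phi> (snd z) < \<phi> (fst z)" using z by (cases z) auto
        then have "(\<lambda>j. exp (- (\<phi> (fst z) - \<phi> (snd z))) ^ j) \<longlonglongrightarrow> 0"
          by (intro LIMSEQ_power_zero) auto
        from tendsto_power[OF tendsto_mult[OF tendsto_const this], of "k z" 2] show ?thesis by simp
      qed simp
      then show "(\<lambda>j. ennreal ((k z * exp (- (\<phi> (fst z) - \<phi> (snd z))) ^ j)\<^sup>2)) \<longlonglongrightarrow> 0"
        using tendsto_ennrealI by fastforce
    qed
    show "(\<lambda>z. ennreal ((k z * exp (- (\<phi> (fst z) - \<phi> (snd z))) ^ j)\<^sup>2)) \<in> borel_measurable lborel" for j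
      using f1 f2 k_meas
      by (intro measurable_compose[OF _ measurable_ennreal] borel_measurable_power borel_measurable_times
          borel_measurable_exp borel_measurable_uminus borel_measurable_diff) simp_all
    show "(\<lambda>z. ennreal ((k z)\<^sup>2)) \<in> borel_measurable lborel"
      using k_meas by (intro measurable_compose[OF _ measurable_ennreal] borel_measurable_power) simp
  qed simp
  then show ?thesis by simp
qed

theorem quasinilpotent:
  fixes \<phi> :: "'a \<Rightarrow> real"
  assumes \<phi>: "\<phi> \<in> borel_measurable borel" "\<And>x. x \<in> D \<Longrightarrow> 0 \<le> \<phi> x \<and> \<phi> x \<le> 1"
    and causal: "AE (p, q) in lborel. \<phi> p < \<phi> q \<longrightarrow> k (p, q) = 0"
    and level: "\<And>c. AE q in lborel. \<phi> q \<noteq> c"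
  shows "L2_quasinilpotent (lebesgue_on D) (kernel_operator D K)"
  unfolding L2_quasinilpotent_def
proof (rule LIMSEQ_I)
  fix \<epsilon> :: real assume \<epsilon>: "0 < \<epsilon>"
  let ?M = "lebesgue_on D" and ?T = "kernel_operator D K"
  let ?\<kappa> = "\<lambda>j. sq (\<lambda>(p, q). exp (- (real j * \<phi> p)) * k (p, q) / exp (- (real j * \<phi> q)))"
  have "\<forall>\<^sub>F j in sequentially. ?\<kappa> j < ennreal ((\<epsilon> / 2)\<^sup>2)"
    using \<epsilon> by (intro order_tendstoD(2)[OF weighted_kernel_tendsto_0[OF \<phi>(1) causal level]]) auto
  then obtain j where j: "?\<kappa> j < ennreal ((\<epsilon> / 2)\<^sup>2)"
    by (auto simp: eventually_sequentially)
  define \<kappa> where "\<kappa> = enn2real (?\<kappa> j)"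
  have \<kappa>: "?\<kappa> j = ennreal \<kappa>" "0 \<le> \<kappa>"
    using order.strict_trans[OF j ennreal_less_top] by (simp_all add: \<kappa>_def)
  then have "\<kappa> < (\<epsilon> / 2)\<^sup>2" using j by (simp add: ennreal_less_iff)
  then have sq\<kappa>: "sqrt \<kappa> < \<epsilon> / 2" using \<epsilon> real_sqrt_less_mono[of \<kappa> "(\<epsilon> / 2)\<^sup>2"] by simp
  \<comment> \<open>\<open>j\<close> is now fixed. Its cost \<open>exp j\<close> disappears under
    the \<open>n\<close>-th root, leaving a factor below 2 beside
    \<open>sqrt \<kappa> < \<epsilon> / 2\<close>.\<close>
  have "(\<lambda>n. exp (real j / real n)) \<longlonglongrightarrow> exp 0"
    by (intro tendsto_intros lim_const_over_n)
  then have "\<forall>\<^sub>F n in sequentially. exp (real j / real n) < 2"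
    by (rule order_tendstoD(2)) auto
  then obtain N where N: "\<And>n. N \<le> n \<Longrightarrow> exp (real j / real n) < 2"
    by (auto simp: eventually_sequentially)
  have "norm (root n (L2_onorm ?M (?T ^^ n)) - 0) < \<epsilon>" if n: "max N 1 \<le> n" for n
  proof -
    define c where "c = exp (real j) * sqrt \<kappa> ^ n"
    have c0: "0 \<le> c" using \<kappa>(2) by (simp add: c_def)
    \<comment> \<open>For a function of norm 0 the quotient is 0, because division by zero yields
      0.\<close>
    have ratio: "L2_nrm ?M ((?T ^^ n) f) / L2_nrm ?M f \<le> c" if "f \<in> L2_space ?M" for f
    proof (cases "L2_nrm ?M f = 0")
      case False
      moreover have "0 \<le> L2_nrm ?M f" by (simp add: L2_nrm_def)
      ultimately show ?thesis
        using iterate_norm_le[OF \<phi> \<kappa> _ that, of n] by (simp add: c_def divide_le_eq)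
    qed (use c0 in simp)
    \<comment> \<open>The zero function makes the set under the supremum nonempty and shows that the
      supremum is nonnegative.\<close>
    have z: "(\<lambda>_. 0) \<in> L2_space ?M" by (simp add: L2_space_def)
    have "L2_onorm ?M (?T ^^ n) \<le> c"
      unfolding L2_onorm_def using z by (intro cSUP_least ratio) auto
    moreover have "0 \<le> L2_onorm ?M (?T ^^ n)"
    proof -
      have "L2_nrm ?M ((?T ^^ n) (\<lambda>_. 0)) / L2_nrm ?M (\<lambda>_. 0) \<le> L2_onorm ?M (?T ^^ n)"
        unfolding L2_onorm_def by (intro cSUP_upper z bdd_aboveI2[where M=c] ratio)
      then show ?thesis by (simp add: L2_nrm_def)
    qed
    ultimately have "norm (root n (L2_onorm ?M (?T ^^ n)) - 0) \<le> root n c"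
      using n by simp
    also have "root n c = exp (real j / real n) * sqrt \<kappa>"
    proof -
      have "exp (real j) = exp (real j / real n) ^ n"
        using n by (simp add: exp_of_nat_mult[symmetric])
      then show ?thesis
        using n \<kappa>(2) by (simp add: c_def real_root_mult real_root_power_cancel)
    qed
    also have "\<dots> \<le> 2 * sqrt \<kappa>"
      using N[of n] n \<kappa>(2) by (intro mult_right_mono) auto
    also have "\<dots> < \<epsilon>" using sq\<kappa> by simp
    finally show ?thesis .
  qed
  then show "\<exists>no. \<forall>n\<ge>no. norm (root n (L2_onorm ?M (?T ^^ n)) - 0) < \<epsilon>" by blast
qed

end

section \<open>Compactness of Hilbert--Schmidt operators\<close>

text \<open>A Dynkin argument for functions: indicators of Borel sets follow from the
  intersection-stable generator by disjoint induction, bounded functions as uniformly bounded limits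
  of simple ones. The common bound in the limit hypothesis is what dominated convergence requires in
  the applications.\<close>

lemma functional_monotone_class:
  fixes P :: "('a::topological_space \<Rightarrow> real) \<Rightarrow> bool"
  assumes E: "Int_stable E" "sigma_sets UNIV E = sets borel" "UNIV \<in> E"
    and ind: "\<And>A. A \<in> E \<Longrightarrow> P (indicator A)"
    and lin: "\<And>f g a b. P f \<Longrightarrow> P g \<Longrightarrow> P (\<lambda>x. a * f x + b * g x)"
    and lim: "\<And>f h B. (\<And>j. P (f j)) \<Longrightarrow> h \<in> borel_measurable borel \<Longrightarrow> (\<And>j x. \<bar>f j x\<bar> \<le> B) \<Longrightarrow>
       (\<And>x. (\<lambda>j. f j x) \<longlonglongrightarrow> h x) \<Longrightarrow> P h"
    and h: "h \<in> borel_measurable borel" "\<And>x. \<bar>h x\<bar> \<le> B"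
  shows "P h"
proof -
  have zero: "P (\<lambda>_. 0)" using lin[OF ind[OF E(3)] ind[OF E(3)], of 0 0] by simp
  have sum: "finite I \<Longrightarrow> (\<And>i. i \<in> I \<Longrightarrow> P (f i)) \<Longrightarrow> P (\<lambda>x. \<Sum>i\<in>I. c i * f i x)" for I :: "'i set" and f and c :: "'i \<Rightarrow> real"
  proof (induction I rule: finite_induct)
    case (insert i I)
    then show ?case using lin[of "f i" "\<lambda>x. \<Sum>i\<in>I. c i * f i x" "c i" 1] by simp
  qed (simp add: zero)
  have sets: "P (indicator A)" if A: "A \<in> sets borel" for A
  proof -
    have "E \<subseteq> Pow UNIV" "A \<in> sigma_sets UNIV E" using A E(2) by simp_all
    then show ?thesis 
    proof (induction A rule: sigma_sets_induct_disjoint[OF E(1), consumes 2, case_names basic empty compl union])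
      case (basic A)
      then show ?case by (rule ind)
    next
      case empty
      then show ?case using zero by (simp add: indicator_def)
    next
      case (compl A)
      have "indicator (UNIV - A) = (\<lambda>x. 1 * indicator UNIV x + (-1) * indicator A x :: real)"
        by (auto simp: indicator_def fun_eq_iff)
      then show ?case using lin[OF ind[OF E(3)] compl(2), of 1 "-1"] by simp
    next
      case (union A)
      have fin: "indicator (\<Union>i<j. A i) x = (\<Sum>i<j. 1 * indicator (A i) x :: real)" for j x
        using union(1) by (simp add: indicator_UN_disjoint disjoint_family_on_mono[of _ UNIV])
      show ?case
      proof (rule lim[where B=1])
        show "P (\<lambda>x. indicator (\<Union>i<j. A i) x)" for j
          unfolding fin by (rule sum) (use union in auto)
        show "indicator (\<Union>i. A i) \<in> borel_measurable borel"
          using union(2) E(2) by (intro borel_measurable_indicator) auto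
        show "(\<lambda>j. indicator (\<Union>i<j. A i) x) \<longlonglongrightarrow> (indicator (\<Union>i. A i) x :: real)" for x
          by (rule LIMSEQ_indicator_UN)
      qed (auto simp: indicator_def)
    qed
  qed
  obtain F where F: "\<And>i. simple_function borel (F i)" "\<And>x. (\<lambda>i. F i x) \<longlonglongrightarrow> h x" "\<And>i x. dist (F i x) 0 \<le> 2 * dist (h x) 0"
    using borel_measurable_implies_sequence_metric[OF h(1), of 0] by auto
  show ?thesis
  proof (rule lim[where f=F and B="2 * B"])
    fix j
    have eq: "F j = (\<lambda>x. \<Sum>y\<in>F j ` UNIV. y * indicator (F j -` {y}) x)"
    proof
      fix x
      have "(\<Sum>y\<in>F j ` UNIV. y * indicator (F j -` {y}) x) = (\<Sum>y\<in>F j ` UNIV. if y = F j x then y else 0)"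
        by (intro sum.cong) (auto simp: indicator_def)
      then show "F j x = (\<Sum>y\<in>F j ` UNIV. y * indicator (F j -` {y}) x)"
        using simple_functionD(1)[OF F(1), of j] by simp
    qed
    have "P (\<lambda>x. \<Sum>y\<in>F j ` UNIV. y * indicator (F j -` {y}) x)"
      using simple_functionD[OF F(1), of j] by (intro sum sets) auto
    then show "P (F j)" by (simp only: eq[symmetric])
    show "\<bar>F j x\<bar> \<le> 2 * B" for x
      using F(3)[of j x] h(2)[of x] by (simp add: dist_real_def)
  qed (use F h in auto)
qed

text \<open>Finite intersections of a countable basis. Countability serves the diagonal argument,
  stability under intersections the Dynkin argument, and the whole space is the empty
  intersection.\<close>

lemma countable_borel_generator:
  obtains E :: "'a::second_countable_topology set set" where
    "countable E" "Int_stable E" "sigma_sets UNIV E = sets borel" "UNIV \<in> E"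
proof -
  obtain B :: "'a set set" where B: "countable B" "topological_basis B"
    using ex_countable_basis by blast
  define E where "E = Inter ` {F. finite F \<and> F \<subseteq> B}"
  show ?thesis
  proof (rule that)
    show "countable E" unfolding E_def using B(1) by (intro countable_image countable_Collect_finite_subset)
    show "Int_stable E"
    proof (rule Int_stableI)
      fix a b assume "a \<in> E" "b \<in> E"
      then obtain F G where "finite F" "F \<subseteq> B" "a = \<Inter>F" "finite G" "G \<subseteq> B" "b = \<Inter>G" by (auto simp: E_def)
      then show "a \<inter> b \<in> E" unfolding E_def by (intro image_eqI[of _ _ "F \<union> G"]) auto
    qed
    have "sets borel = sigma_sets UNIV B"
      using borel_eq_countable_basis[OF B] by (metis sets_measure_of subset_UNIV Pow_UNIV)
    moreover have "sigma_sets UNIV E = sigma_sets UNIV B"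
    proof (rule sigma_sets_eqI)
      fix a assume "a \<in> E"
      then obtain F where "finite F" "F \<subseteq> B" "a = \<Inter>F" by (auto simp: E_def)
      then have "open a" using topological_basis_open[OF B(2)] by (auto intro!: open_Inter)
      then have "a \<in> sets borel" by (rule borel_open)
      then show "a \<in> sigma_sets UNIV B" using \<open>sets borel = sigma_sets UNIV B\<close> by (simp only:)
    next
      fix b assume "b \<in> B"
      then have "b \<in> E" unfolding E_def by (intro image_eqI[of _ _ "{b}"]) auto
      then show "b \<in> sigma_sets UNIV E" by auto
    qed
    ultimately show "sigma_sets UNIV E = sets borel" by simp
    show "UNIV \<in> E" unfolding E_def by (intro image_eqI[of _ _ "{}"]) auto
  qed
qed

text \<open>A three-epsilon argument: by dominated convergence \<open>f j\<close> tends to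
  \<open>h\<close> in the square norm on \<open>D\<close>, and the bound on \<open>F n\<close> makes
  the error uniform in \<open>n\<close>. The dominating function \<open>H\<close> is a constant in
  one application and the absolute value of \<open>h\<close> in the other.\<close>

lemma tendsto_inner_products:
  fixes h :: "'a::euclidean_space \<Rightarrow> real"
  assumes [measurable]: "\<And>n. F n \<in> borel_measurable borel" "D \<in> sets borel" "h \<in> borel_measurable borel" "\<And>j. f j \<in> borel_measurable borel"
    and F0: "\<And>n x. x \<notin> D \<Longrightarrow> F n x = 0" and FC: "\<And>n. sq (F n) \<le> ennreal C"
    and H [measurable]: "H \<in> borel_measurable borel" and Hfin: "sq (\<lambda>x. indicator D x * H x) < \<infinity>"
    and dom: "\<And>j x. \<bar>f j x\<bar> \<le> H x" and lim: "\<And>x. (\<lambda>j. f j x) \<longlonglongrightarrow> h x"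
    and conv: "\<And>j. convergent (\<lambda>n. LINT q|lborel. f j q * F n q)"
  shows "convergent (\<lambda>n. LINT q|lborel. h q * F n q)"
proof -
  have hH: "\<bar>h x\<bar> \<le> H x" for x
    using dom lim by (intro LIMSEQ_le_const2[OF tendsto_rabs[OF lim]]) auto
  have H0: "0 \<le> H x" for x using hH[of x] by linarith
  have sq_dom: "sq (\<lambda>x. indicator D x * g x) < \<infinity>" if "\<And>x. \<bar>g x\<bar> \<le> H x" for g
  proof -
    have "sq (\<lambda>x. indicator D x * g x) \<le> sq (\<lambda>x. indicator D x * H x)"
      unfolding sq_def
      by (intro nn_integral_mono ennreal_leI)
        (auto simp: abs_le_square_iff[symmetric] abs_mult H0 intro!: mult_left_mono that)
    then show ?thesis using Hfin by (rule le_less_trans)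
  qed
  have Ffin: "sq (F n) < \<infinity>" for n using FC[of n] by (rule le_less_trans) auto
  have ind: "g q * F n q = (indicator D q * g q) * F n q" for g :: "'a \<Rightarrow> real" and q n
    using F0[of q n] by (auto simp: indicator_def)
  have int: "integrable lborel (\<lambda>q. g q * F n q)" if "\<And>x. \<bar>g x\<bar> \<le> H x" "g \<in> borel_measurable borel" for g n
    unfolding ind[of g] using sq_dom[OF that(1)] Ffin[of n] that(2) unfolding sq_def
    by (intro integrable_mult_square) auto
  define d where "d = (\<lambda>j. sq (\<lambda>x. indicator D x * (h x - f j x)))"
  have "d \<longlonglongrightarrow> (\<integral>\<^sup>+x. 0 \<partial>(lborel :: 'a measure))"
    unfolding d_def sq_def
  proof (rule nn_integral_dominated_convergence[where w="\<lambda>x. ennreal ((2 * (indicator D x * H x))\<^sup>2)"])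
    have "(\<integral>\<^sup>+x. ennreal ((2 * (indicator D x * H x))\<^sup>2) \<partial>lborel) = (\<integral>\<^sup>+x. 4 * ennreal ((indicator D x * H x)\<^sup>2) \<partial>lborel)"
      by (simp add: power_mult_distrib ennreal_mult)
    also have "\<dots> = 4 * sq (\<lambda>x. indicator D x * H x)" unfolding sq_def by (rule nn_integral_cmult) measurable
    finally show "(\<integral>\<^sup>+x. ennreal ((2 * (indicator D x * H x))\<^sup>2) \<partial>lborel) < \<infinity>"
      using Hfin by (simp add: ennreal_mult_less_top)
    show "AE x in lborel. ennreal ((indicator D x * (h x - f j x))\<^sup>2) \<le> ennreal ((2 * (indicator D x * H x))\<^sup>2)" for j
    proof (intro AE_I2 ennreal_leI)
      fix x
      have "\<bar>h x - f j x\<bar> \<le> 2 * H x" using hH[of x] dom[of j x] by linarith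
      then show "(indicator D x * (h x - f j x))\<^sup>2 \<le> (2 * (indicator D x * H x))\<^sup>2"
        using H0[of x] by (subst power2_le_iff_abs_le) (auto simp: indicator_def)
    qed
    show "AE x in lborel. (\<lambda>j. ennreal ((indicator D x * (h x - f j x))\<^sup>2)) \<longlonglongrightarrow> 0"
    proof (rule AE_I2)
      fix x
      have "(\<lambda>j. (indicator D x * (h x - f j x))\<^sup>2) \<longlonglongrightarrow> (indicator D x * (h x - h x))\<^sup>2"
        by (intro tendsto_intros lim)
      then show "(\<lambda>j. ennreal ((indicator D x * (h x - f j x))\<^sup>2)) \<longlonglongrightarrow> 0"
        using tendsto_ennrealI by fastforce
    qed
  qed measurable
  then have d: "d \<longlonglongrightarrow> 0" by simp
  have diff: "ennreal (((LINT q|lborel. h q * F n q) - (LINT q|lborel. f j q * F n q))\<^sup>2) \<le> d j * ennreal C" for n j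
  proof -
    have "(LINT q|lborel. h q * F n q) - (LINT q|lborel. f j q * F n q) = (LINT q|lborel. h q * F n q - f j q * F n q)"
      by (intro Bochner_Integration.integral_diff[symmetric] int hH dom) auto
    also have "\<dots> = (LINT q|lborel. (indicator D q * (h q - f j q)) * F n q)"
      unfolding left_diff_distrib[symmetric] ind[of "\<lambda>q. h q - f j q"] ..
    finally have "ennreal (((LINT q|lborel. h q * F n q) - (LINT q|lborel. f j q * F n q))\<^sup>2) \<le> d j * sq (F n)"
      unfolding d_def sq_def by simp (rule square_integral_le, auto)
    also have "\<dots> \<le> d j * ennreal C" by (intro mult_left_mono FC) auto
    finally show ?thesis .
  qed
  have "Cauchy (\<lambda>n. LINT q|lborel. h q * F n q)"
  proof (rule metric_CauchyI)
    fix \<epsilon> :: real assume \<epsilon>: "0 < \<epsilon>"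
    have "(\<lambda>j. d j * ennreal C) \<longlonglongrightarrow> 0 * ennreal C"
      by (intro tendsto_mult_ennreal d) auto
    then have "\<forall>\<^sub>F j in sequentially. d j * ennreal C < ennreal ((\<epsilon> / 3)\<^sup>2)"
      using \<epsilon> by (intro order_tendstoD(2)) auto
    then obtain j where "d j * ennreal C < ennreal ((\<epsilon> / 3)\<^sup>2)"
      by (auto simp: eventually_sequentially)
    then have "ennreal (((LINT q|lborel. h q * F n q) - (LINT q|lborel. f j q * F n q))\<^sup>2) < ennreal ((\<epsilon> / 3)\<^sup>2)" for n
      using diff by (rule le_less_trans[rotated])
    then have close: "dist (LINT q|lborel. h q * F n q) (LINT q|lborel. f j q * F n q) < \<epsilon> / 3" for n
      using \<epsilon> power_less_imp_less_base[of "dist (LINT q|lborel. h q * F n q) (LINT q|lborel. f j q * F n q)" 2 "\<epsilon> / 3"]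
      by (simp add: dist_real_def ennreal_less_iff)
    have "Cauchy (\<lambda>n. LINT q|lborel. f j q * F n q)"
      using conv by (simp add: Cauchy_convergent_iff)
    from metric_CauchyD[OF this, of "\<epsilon> / 3"] \<epsilon>
    obtain N where N: "\<And>m n. m \<ge> N \<Longrightarrow> n \<ge> N \<Longrightarrow> dist (LINT q|lborel. f j q * F m q) (LINT q|lborel. f j q * F n q) < \<epsilon> / 3"
      by auto
    have "dist (LINT q|lborel. h q * F m q) (LINT q|lborel. h q * F n q) < \<epsilon>" if "m \<ge> N" "n \<ge> N" for m n
      using close[of m] close[of n] N[OF that] unfolding dist_real_def by linarith
    then show "\<exists>N. \<forall>m\<ge>N. \<forall>n\<ge>N. dist (LINT q|lborel. h q * F m q) (LINT q|lborel. h q * F n q) < \<epsilon>" by blast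
  qed
  then show ?thesis by (simp add: Cauchy_convergent_iff)
qed

text \<open>Weak sequential compactness of bounded sets, proved directly: a diagonal subsequence for
  the indicators of a countable generator, then bounded Borel functions by
  \<open>functional_monotone_class\<close>, then square-integrable ones by truncation.\<close>

lemma weakly_convergent_subsequence:
  fixes F :: "nat \<Rightarrow> 'a::euclidean_space \<Rightarrow> real"
  assumes F [measurable]: "\<And>n. F n \<in> borel_measurable borel" and D [measurable]: "D \<in> sets borel" and finD: "emeasure lborel D < \<infinity>"
    and F0: "\<And>n x. x \<notin> D \<Longrightarrow> F n x = 0" and FC: "\<And>n. sq (F n) \<le> ennreal C"
  shows "\<exists>r. strict_mono r \<and> (\<forall>h. h \<in> borel_measurable borel \<longrightarrow> sq h < \<infinity> \<longrightarrow>
     convergent (\<lambda>n. LINT q|lborel. h q * F (r n) q))"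
proof -
  obtain E :: "'a set set" where E: "countable E" "Int_stable E" "sigma_sets UNIV E = sets borel" "UNIV \<in> E"
    by (rule countable_borel_generator)
  have EB [measurable]: "A \<in> sets borel" if "A \<in> E" for A
    using E(3) that by auto
  have sqD: "sq (\<lambda>x. indicator D x * (B::real)) < \<infinity>" for B
  proof -
    have "sq (\<lambda>x. indicator D x * B) = (\<integral>\<^sup>+x. ennreal (B\<^sup>2) * indicator D x \<partial>lborel)"
      unfolding sq_def by (intro nn_integral_cong) (auto simp: indicator_def)
    also have "\<dots> < \<infinity>" using finD by (simp add: nn_integral_cmult_indicator ennreal_mult_less_top)
    finally show ?thesis .
  qed
  define c where "c = (\<lambda>A n. LINT q|lborel. indicator A q * F n q)"
  have bounded: "Bseq (c A)" if A: "A \<in> E" for A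
  proof -
    define M where "M = enn2real (sq (\<lambda>x. indicator D x * (1::real)) * ennreal C)"
    have fin: "sq (\<lambda>x. indicator D x * (1::real)) * ennreal C < \<infinity>"
      using sqD[of 1] by (simp add: ennreal_mult_less_top)
    have "(c A n)\<^sup>2 \<le> M" for n
    proof -
      have "c A n = (LINT q|lborel. (indicator D q * indicator A q) * F n q)"
        unfolding c_def using F0[of _ n] by (intro Bochner_Integration.integral_cong) (auto simp: indicator_def)
      then have "ennreal ((c A n)\<^sup>2) \<le> sq (\<lambda>q. indicator D q * indicator A q) * sq (F n)"
        unfolding sq_def using A by simp (rule square_integral_le, auto)
      also have "\<dots> \<le> sq (\<lambda>x. indicator D x * (1::real)) * ennreal C"
        unfolding sq_def[of "\<lambda>q. indicator D q * _ q"] sq_def[of "\<lambda>q. indicator D q * 1"]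
        by (intro mult_mono FC nn_integral_mono) (auto simp: indicator_def)
      also have "\<dots> = ennreal M" using fin by (simp add: M_def)
      finally show ?thesis by (simp add: M_def)
    qed
    then have "norm (c A n) \<le> sqrt M" for n
      by (metis real_norm_def real_sqrt_abs real_sqrt_le_mono)
    then show ?thesis by (intro BseqI') auto
  qed
  define e where "e = from_nat_into E"
  have e: "e i \<in> E" for i unfolding e_def using E(4) by (intro from_nat_into) auto
  have surj: "\<exists>i. e i = A" if "A \<in> E" for A
    unfolding e_def using from_nat_into_surj[OF E(1) that] by blast
  interpret subseqs "\<lambda>i r. convergent (\<lambda>n. c (e i) (r n))"
  proof
    fix i and s :: "nat \<Rightarrow> nat"
    have "bounded (range (\<lambda>n. c (e i) (s n)))"
      using bounded[OF e, of i] by (auto simp: Bseq_eq_bounded intro: bounded_subset)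
    then obtain l r where "strict_mono r" "((\<lambda>n. c (e i) (s n)) \<circ> r) \<longlonglongrightarrow> l"
      using bounded_imp_convergent_subsequence by blast
    then show "\<exists>r. strict_mono r \<and> convergent (\<lambda>n. c (e i) ((s \<circ> r) n))"
      by (auto simp: convergent_def o_def)
  qed
  \<comment> \<open>What is selected at stage \<open>i\<close> passes to the diagonal sequence from
    index \<open>Suc i\<close> on; a finite initial segment does not affect convergence.\<close>
  have conv_e: "convergent (\<lambda>n. c (e i) (diagseq n))" for i
  proof -
    have "convergent (\<lambda>n. c (e i) ((diagseq \<circ> (+) (Suc i)) n))"
    proof (rule diagseq_holds)
      fix r s :: "nat \<Rightarrow> nat" and n assume "strict_mono r" "convergent (\<lambda>m. c (e n) (s m))"
      then show "convergent (\<lambda>m. c (e n) ((s \<circ> r) m))"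
        using convergent_subseq_convergent[of "\<lambda>m. c (e n) (s m)" r] by (simp add: o_def)
    qed
    then show ?thesis
      using convergent_ignore_initial_segment[of "\<lambda>n. c (e i) (diagseq n)" "Suc i"] by (simp add: o_def add.commute)
  qed
  let ?I = "\<lambda>h n. LINT q|lborel. h q * F (diagseq n) q"
  have Fi: "integrable lborel (\<lambda>q. h q * F n q)" if h [measurable]: "h \<in> borel_measurable borel" and B: "\<And>x. \<bar>h x\<bar> \<le> B" for h n B
  proof -
    have "integrable lborel (\<lambda>q. (indicator D q * h q) * F n q)"
    proof (rule integrable_mult_square)
      have "(\<integral>\<^sup>+x. ennreal ((indicator D x * h x)\<^sup>2) \<partial>lborel) \<le> sq (\<lambda>x. indicator D x * B)"
        unfolding sq_def using B by (intro nn_integral_mono ennreal_leI) (auto simp: indicator_def abs_le_square_iff[symmetric] intro: order_trans[OF _ abs_ge_self])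
      then show "(\<integral>\<^sup>+x. ennreal ((indicator D x * h x)\<^sup>2) \<partial>lborel) < \<infinity>" using sqD by (rule le_less_trans)
      show "(\<integral>\<^sup>+x. ennreal ((F n x)\<^sup>2) \<partial>lborel) < \<infinity>" using FC[of n] unfolding sq_def by (rule le_less_trans) auto
    qed measurable
    also have "(\<lambda>q. (indicator D q * h q) * F n q) = (\<lambda>q. h q * F n q)"
      using F0 by (auto simp: indicator_def fun_eq_iff)
    finally show ?thesis .
  qed
  \<comment> \<open>Boundedness is part of \<open>P\<close> so that products with \<open>F n\<close>
    are integrable, by the finite measure of \<open>D\<close>; linearity of the integral relies on
    this.\<close>
  define P where "P = (\<lambda>h. h \<in> borel_measurable borel \<and> (\<exists>B. \<forall>x. \<bar>h x\<bar> \<le> B) \<and> convergent (?I h))"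
  have P: "P h" if "h \<in> borel_measurable borel" "\<And>x. \<bar>h x\<bar> \<le> B" for h B
  proof (rule functional_monotone_class[OF E(2,3,4) _ _ _ that])
    show "P (indicator A)" if "A \<in> E" for A
      using surj[OF that] conv_e EB[OF that] unfolding P_def c_def
      by (auto intro!: exI[of _ 1] simp: indicator_def)
  next
    fix f g a b assume "P f" "P g"
    then obtain B1 B2 where fg: "f \<in> borel_measurable borel" "g \<in> borel_measurable borel" "\<And>x. \<bar>f x\<bar> \<le> B1" "\<And>x. \<bar>g x\<bar> \<le> B2"
       "convergent (?I f)" "convergent (?I g)"
      by (auto simp: P_def)
    have "?I (\<lambda>x. a * f x + b * g x) = (\<lambda>n. a * ?I f n + b * ?I g n)"
    proof
      fix n
      have "?I (\<lambda>x. a * f x + b * g x) n = (LINT q|lborel. a * (f q * F (diagseq n) q) + b * (g q * F (diagseq n) q))"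
        by (simp add: algebra_simps)
      also have "\<dots> = a * ?I f n + b * ?I g n"
        using Fi[OF fg(1,3)] Fi[OF fg(2,4)] by simp
      finally show "?I (\<lambda>x. a * f x + b * g x) n = a * ?I f n + b * ?I g n" .
    qed
    then have "convergent (?I (\<lambda>x. a * f x + b * g x))"
      using fg(5,6) by (auto intro!: convergent_add convergent_mult convergent_const)
    moreover have "\<bar>a * f x + b * g x\<bar> \<le> \<bar>a\<bar> * B1 + \<bar>b\<bar> * B2" for x
      using fg(3,4)[of x] by (intro order_trans[OF abs_triangle_ineq] add_mono) (auto simp: abs_mult mult_left_mono)
    ultimately show "P (\<lambda>x. a * f x + b * g x)"
      unfolding P_def using fg(1,2) by auto
  next
    fix f :: "nat \<Rightarrow> 'a \<Rightarrow> real" and h B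
    assume f: "\<And>j. P (f j)" and h: "h \<in> borel_measurable borel" and fB: "\<And>j x. \<bar>f j x\<bar> \<le> B" and lim: "\<And>x. (\<lambda>j. f j x) \<longlonglongrightarrow> h x"
    have "convergent (?I h)"
      by (rule tendsto_inner_products[where f=f and H="\<lambda>_. B" and D=D and C=C])
        (use f h fB lim FC F0 sqD in \<open>auto simp: P_def\<close>)
    moreover have "\<bar>h x\<bar> \<le> B" for x
      using fB lim by (intro LIMSEQ_le_const2[OF tendsto_rabs[OF lim]]) auto
    ultimately show "P h" unfolding P_def using h by blast
  qed
  show ?thesis
  proof (intro exI[of _ diagseq] conjI allI impI subseq_diagseq)
    fix h :: "'a \<Rightarrow> real" assume h [measurable]: "h \<in> borel_measurable borel" and fin: "sq h < \<infinity>"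
    \<comment> \<open>Truncation at height \<open>j\<close>: bounded, dominated by the absolute
      value of \<open>h\<close>, and eventually equal to \<open>h\<close> at each point.\<close>
    define f where "f = (\<lambda>(j::nat) x. if \<bar>h x\<bar> \<le> real j then h x else 0)"
    have [measurable]: "f j \<in> borel_measurable borel" for j unfolding f_def by measurable
    have Pf: "P (f j)" for j by (rule P[where B="real j"]) (auto simp: f_def)
    show "convergent (?I h)"
    proof (rule tendsto_inner_products[where f=f and H="\<lambda>x. \<bar>h x\<bar>" and D=D and C=C])
      have "sq (\<lambda>x. indicator D x * \<bar>h x\<bar>) \<le> sq h"
        unfolding sq_def by (intro nn_integral_mono ennreal_leI) (auto simp: indicator_def)
      then show "sq (\<lambda>x. indicator D x * \<bar>h x\<bar>) < \<infinity>" using fin by (rule le_less_trans)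
      show "(\<lambda>j. f j x) \<longlonglongrightarrow> h x" for x
      proof (rule tendsto_eventually)
        obtain N where "\<bar>h x\<bar> \<le> real N" using real_arch_simple by blast
        then show "\<forall>\<^sub>F j in sequentially. f j x = h x"
          unfolding eventually_sequentially f_def by (intro exI[of _ N]) auto
      qed
    qed (use Pf in \<open>auto simp: P_def FC F0\<close>, simp add: f_def)
  qed
qed

context hs_kernel begin

text \<open>Almost every row of \<open>k\<close> is square integrable, so weak convergence tested
  against it is pointwise convergence of the images. Their squares are bounded by a multiple of the
  integrable function \<open>row\<close>, and dominated convergence upgrades this to convergence in
  norm.\<close>

theorem L2_compact_kernel_operator: "L2_compact (lebesgue_on D) (kernel_operator D K)"
  unfolding L2_compact_def
proof (intro conjI allI impI, rule L2_linear_kernel_operator, elim conjE exE)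
  fix F :: "nat \<Rightarrow> 'a \<Rightarrow> real" and C
  let ?M = "lebesgue_on D" and ?T = "kernel_operator D K"
  assume F: "\<forall>n. F n \<in> L2_space ?M" and C: "\<forall>n. L2_nrm ?M (F n) \<le> C"
  have "\<forall>n. \<exists>g. represents D (F n) g \<and> sq g < \<infinity>"
    using F L2_space_lebesgue_on_iff[OF D] by blast
  then obtain F' where F': "\<And>n. represents D (F n) (F' n)" "\<And>n. sq (F' n) < \<infinity>" by metis
  have C0: "0 \<le> C" using C L2_nrm_represents[OF D F'(1), of 0] by (metis dual_order.trans enn2real_nonneg real_sqrt_ge_zero)
  have FC: "sq (F' n) \<le> ennreal (C\<^sup>2)" for n
  proof -
    have "sqrt (enn2real (sq (F' n))) \<le> C" using C L2_nrm_represents[OF D F'(1), of n] by metis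
    then have "enn2real (sq (F' n)) \<le> C\<^sup>2" using C0 by (simp add: real_sqrt_le_iff' sqrt_le_D)
    then have "ennreal (enn2real (sq (F' n))) \<le> ennreal (C\<^sup>2)" by (rule ennreal_leI)
    moreover have "ennreal (enn2real (sq (F' n))) = sq (F' n)" using F'(2)[of n] by simp
    ultimately show ?thesis by (simp only:)
  qed
  have F'm [measurable]: "F' n \<in> borel_measurable borel" for n using F'(1)[of n] by (simp add: represents_def)
  have F'0: "F' n x = 0" if "x \<notin> D" for n x using F'(1)[of n] that by (simp add: represents_def)
  obtain r where r: "strict_mono r \<and> (\<forall>h. h \<in> borel_measurable borel \<longrightarrow> sq h < \<infinity> \<longrightarrow>
     convergent (\<lambda>n. LINT q|lborel. h q * F' (r n) q))"
    using weakly_convergent_subsequence[OF F'm D finD F'0 FC] by (rule exE)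
  \<comment> \<open>Where the sequence diverges, \<open>lim\<close> is a default value; this can
    happen only at \<open>p\<close> with infinite \<open>row p\<close>, a null set.\<close>
  define G where "G = (\<lambda>p. lim (\<lambda>n. S (F' (r n)) p))"
  have [measurable]: "G \<in> borel_measurable borel"
    unfolding G_def by (rule borel_measurable_lim_metric) measurable
  have G0: "G p = 0" if "p \<notin> D" for p
    using S_outside[OF that] by (simp add: G_def)
  have conv: "(\<lambda>n. S (F' (r n)) p) \<longlonglongrightarrow> G p" if "row p < \<infinity>" for p
  proof -
    have "convergent (\<lambda>n. S (F' (r n)) p)"
      unfolding S_def by (rule r[THEN conjunct2, rule_format]) (use that in \<open>simp_all add: row_def sq_def\<close>)
    then show ?thesis unfolding G_def by (simp only: convergent_LIMSEQ_iff)
  qed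
  have S_bound: "(S (F' n) p)\<^sup>2 \<le> enn2real (row p) * C\<^sup>2" if "row p < \<infinity>" for n p
  proof -
    have "ennreal ((S (F' n) p)\<^sup>2) \<le> row p * ennreal (C\<^sup>2)"
      using S_square_le[OF F'm, of n p] mult_left_mono[OF FC[of n], of "row p"] by (auto intro: order_trans)
    also have "\<dots> = ennreal (enn2real (row p) * C\<^sup>2)"
      using that by (simp add: ennreal_mult)
    finally show ?thesis by simp
  qed
  have G_bound: "(G p)\<^sup>2 \<le> enn2real (row p) * C\<^sup>2" if "row p < \<infinity>" for p
    using S_bound[OF that] by (intro LIMSEQ_le_const2[OF tendsto_power[OF conv[OF that]]]) auto
  \<comment> \<open>The factor 4 comes from (a - b)^2 \<le> 2 a^2 + 2 b^2, applied to an image and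
    to the limit \<open>G\<close>, whose squares both obey the bound without the factor.\<close>
  have bound_fin: "(\<integral>\<^sup>+p. ennreal (4 * (enn2real (row p) * C\<^sup>2)) \<partial>lborel) < \<infinity>"
  proof -
    have "(\<integral>\<^sup>+p. ennreal (4 * (enn2real (row p) * C\<^sup>2)) \<partial>lborel) = (\<integral>\<^sup>+p. ennreal (4 * C\<^sup>2) * row p \<partial>lborel)"
    proof (rule nn_integral_cong_AE, rule AE_mp[OF row_AE], intro AE_I2 impI)
      fix p assume "row p < \<infinity>"
      then have "row p = ennreal (enn2real (row p))" by simp
      then show "ennreal (4 * (enn2real (row p) * C\<^sup>2)) = ennreal (4 * C\<^sup>2) * row p"
        by (metis (no_types, opaque_lifting) enn2real_nonneg ennreal_mult' mult.assoc mult.commute)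
    qed
    also have "\<dots> = ennreal (4 * C\<^sup>2) * sq k" unfolding row_integral[symmetric] by (rule nn_integral_cmult) measurable
    also have "\<dots> < \<infinity>" using k_fin by (simp add: ennreal_mult_less_top)
    finally show ?thesis .
  qed
  have "sq G \<le> (\<integral>\<^sup>+p. ennreal (4 * (enn2real (row p) * C\<^sup>2)) \<partial>lborel)"
    unfolding sq_def
  proof (rule nn_integral_mono_AE, rule AE_mp[OF row_AE], intro AE_I2 impI ennreal_leI)
    fix p assume "row p < \<infinity>"
    then show "(G p)\<^sup>2 \<le> 4 * (enn2real (row p) * C\<^sup>2)"
      using G_bound[of p] by (auto intro: order_trans)
  qed
  then have Gfin: "sq G < \<infinity>" using bound_fin by (rule le_less_trans)
  have repG: "represents D G G" using G0 by (simp add: represents_def)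
  have G: "G \<in> L2_space ?M" using L2_space_lebesgue_on_iff[OF D] repG Gfin by blast
  have "(\<lambda>n. sq (\<lambda>p. 1 * S (F' (r n)) p + (-1) * G p)) \<longlonglongrightarrow> (\<integral>\<^sup>+p. 0 \<partial>(lborel :: 'a measure))"
    unfolding sq_def
  proof (rule nn_integral_dominated_convergence[OF _ _ _ _ bound_fin])
    show "AE p in lborel. ennreal ((1 * S (F' (r n)) p + (-1) * G p)\<^sup>2) \<le> ennreal (4 * (enn2real (row p) * C\<^sup>2))" for n
    proof (rule AE_mp[OF row_AE], intro AE_I2 impI ennreal_leI)
      fix p assume p: "row p < \<infinity>"
      have "(1 * S (F' (r n)) p + (-1) * G p)\<^sup>2 \<le> 2 * (S (F' (r n)) p)\<^sup>2 + 2 * (G p)\<^sup>2"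
        using zero_le_power2[of "S (F' (r n)) p + G p"] by (simp add: power2_eq_square algebra_simps)
      then show "(1 * S (F' (r n)) p + (-1) * G p)\<^sup>2 \<le> 4 * (enn2real (row p) * C\<^sup>2)"
        using S_bound[OF p, of "r n"] G_bound[OF p] by linarith
    qed
    show "AE p in lborel. (\<lambda>n. ennreal ((1 * S (F' (r n)) p + (-1) * G p)\<^sup>2)) \<longlonglongrightarrow> 0"
    proof (rule AE_mp[OF row_AE], intro AE_I2 impI)
      fix p assume "row p < \<infinity>"
      then have "(\<lambda>n. (1 * S (F' (r n)) p + (-1) * G p)\<^sup>2) \<longlonglongrightarrow> (1 * G p + (-1) * G p)\<^sup>2"
        by (intro tendsto_intros conv)
      then show "(\<lambda>n. ennreal ((1 * S (F' (r n)) p + (-1) * G p)\<^sup>2)) \<longlonglongrightarrow> 0"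
        using tendsto_ennrealI by fastforce
    qed
  qed measurable
  then have lim0: "(\<lambda>n. sq (\<lambda>p. 1 * S (F' (r n)) p + (-1) * G p)) \<longlonglongrightarrow> 0" by simp
  have "L2_nrm ?M (\<lambda>x. ?T (F (r n)) x - G x) = sqrt (enn2real (sq (\<lambda>p. 1 * S (F' (r n)) p + (-1) * G p)))" for n
    using L2_nrm_represents[OF D represents_add[OF represents_S[OF F'(1)] repG, of 1 "r n" "-1"]] by simp
  moreover have "(\<lambda>n. sqrt (enn2real (sq (\<lambda>p. 1 * S (F' (r n)) p + (-1) * G p)))) \<longlonglongrightarrow> sqrt 0"
    using lim0 by (intro tendsto_real_sqrt tendsto_enn2real) auto
  ultimately have "(\<lambda>n. L2_nrm ?M (\<lambda>x. ?T (F (r n)) x - G x)) \<longlonglongrightarrow> 0" by simp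
  then show "\<exists>r g. strict_mono r \<and> g \<in> L2_space ?M \<and> (\<lambda>n. L2_nrm ?M (\<lambda>x. ?T (F (r n)) x - g x)) \<longlonglongrightarrow> 0"
    using r G by blast
qed

end

section \<open>Localising the support of the kernel\<close>

text \<open>Rational corners keep the family countable, so that the null sets belonging to the test
  functions unite to a null set. \<open>UNIV\<close> is added to meet the requirements of
  \<open>functional_monotone_class\<close>.\<close>

lemma rational_boxes_generate_borel:
  defines "E \<equiv> insert UNIV {{a<..<b} \<times> {c<..<d} | a b c d :: real. a \<in> \<rat> \<and> b \<in> \<rat> \<and> c \<in> \<rat> \<and> d \<in> \<rat>}"
  shows "Int_stable E" "sigma_sets UNIV E = sets (borel :: (real \<times> real) measure)"
proof -
  let ?B = "{{a<..<b} \<times> {c<..<d} | a b c d :: real. a \<in> \<rat> \<and> b \<in> \<rat> \<and> c \<in> \<rat> \<and> d \<in> \<rat>}"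
  have eqB: "?B = (\<lambda>(a, b, c, d). {a<..<b} \<times> {c<..<d}) ` (\<rat> \<times> \<rat> \<times> \<rat> \<times> \<rat>)"
    by (auto simp: image_iff)
  have cB: "countable ?B"
    unfolding eqB by (intro countable_image countable_SIGMA countable_rat)
  show "Int_stable E"
  proof (rule Int_stableI)
    fix A B assume "A \<in> E" "B \<in> E"
    then consider "A = UNIV" | "B = UNIV" | a b c d a' b' c' d' where "A = {a<..<b} \<times> {c<..<d}" "B = {a'<..<b'} \<times> {c'<..<d'}"
      "{a, b, c, d, a', b', c', d'} \<subseteq> \<rat>"
      unfolding E_def by auto
    then show "A \<inter> B \<in> E"
    proof cases
      case 3
      have "A \<inter> B = {max a a'<..<min b b'} \<times> {max c c'<..<min d d'}"
        unfolding 3(1,2) by auto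
      then show ?thesis using 3(3) unfolding E_def by (auto simp: max_def min_def intro!: exI)
    qed (use \<open>A \<in> E\<close> \<open>B \<in> E\<close> in auto)
  qed
  have open_in: "U \<in> sigma_sets UNIV E" if U: "open U" for U :: "(real \<times> real) set"
  proof -
    have "U = \<Union>{R \<in> ?B. R \<subseteq> U}"
    proof
      show "U \<subseteq> \<Union>{R \<in> ?B. R \<subseteq> U}"
      proof
        fix z assume z: "z \<in> U"
        obtain A B where AB: "open A" "open B" "fst z \<in> A" "snd z \<in> B" "A \<times> B \<subseteq> U"
          using open_prod_elim[OF U z] by (metis mem_Times_iff)
        have rat: "\<exists>a b. a \<in> \<rat> \<and> b \<in> \<rat> \<and> t \<in> {a<..<b} \<and> {a<..<b} \<subseteq> T" if T: "open T" "t \<in> T" for T and t :: real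
        proof -
          obtain e where e: "e > 0" "\<And>y. dist y t < e \<Longrightarrow> y \<in> T"
            using T by (auto simp: open_dist)
          obtain a where a: "a \<in> \<rat>" "t - e < a" "a < t" using Rats_dense_in_real[of "t - e" t] e by auto
          obtain b where b: "b \<in> \<rat>" "t < b" "b < t + e" using Rats_dense_in_real[of t "t + e"] e by auto
          have "{a<..<b} \<subseteq> T" using a b by (auto intro!: e(2) simp: dist_real_def)
          then show ?thesis using a b by (intro exI[of _ a] exI[of _ b]) auto
        qed
        obtain a b where ab: "a \<in> \<rat>" "b \<in> \<rat>" "fst z \<in> {a<..<b}" "{a<..<b} \<subseteq> A" using rat[OF AB(1,3)] by blast
        obtain c d where cd: "c \<in> \<rat>" "d \<in> \<rat>" "snd z \<in> {c<..<d}" "{c<..<d} \<subseteq> B" using rat[OF AB(2,4)] by blast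
        have "z \<in> {a<..<b} \<times> {c<..<d}" using ab(3) cd(3) by (simp add: mem_Times_iff)
        moreover have "{a<..<b} \<times> {c<..<d} \<subseteq> U" using ab(4) cd(4) AB(5) by blast
        ultimately show "z \<in> \<Union>{R \<in> ?B. R \<subseteq> U}" using ab(1,2) cd(1,2) by blast
      qed
    qed auto
    moreover have "\<Union>{R \<in> ?B. R \<subseteq> U} \<in> sigma_sets UNIV E"
      by (rule sigma_sets_UNION) (use cB in \<open>auto simp: E_def intro: countable_subset[OF _ cB]\<close>)
    ultimately show ?thesis by simp
  qed
  have "sets (borel :: (real \<times> real) measure) = sigma_sets UNIV {S. open S}"
    by (simp add: borel_def)
  also have "\<dots> = sigma_sets UNIV E"
  proof (rule sigma_sets_eqI)
    fix b assume "b \<in> E"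
    then have "open b" by (auto simp: E_def intro!: open_Times)
    then show "b \<in> sigma_sets UNIV {S. open S}" by auto
  qed (use open_in in auto)
  finally show "sigma_sets UNIV E = sets (borel :: (real \<times> real) measure)" by simp
qed

text \<open>Orthogonality to \<open>g\<close> spreads from boxes to all bounded Borel functions, in
  particular to the sign of \<open>g\<close>, for which it says that the integral of the absolute
  value of \<open>g\<close> is 0.\<close>

lemma AE_zero_of_box_integrals:
  fixes g :: "real \<times> real \<Rightarrow> real"
  assumes g: "integrable lborel g"
    and box: "\<And>a b c d. a \<in> \<rat> \<Longrightarrow> b \<in> \<rat> \<Longrightarrow> c \<in> \<rat> \<Longrightarrow> d \<in> \<rat> \<Longrightarrow> (LINT q|lborel. indicator ({a<..<b} \<times> {c<..<d}) q * g q) = 0"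
    and univ: "(LINT q|lborel. g q) = 0"
  shows "AE q in lborel. g q = 0"
proof -
  note E = rational_boxes_generate_borel
  have gm [measurable]: "g \<in> borel_measurable borel" using g by auto
  have int: "integrable lborel (\<lambda>q. f q * g q)" if "f \<in> borel_measurable borel" "\<And>x. \<bar>f x\<bar> \<le> B" for f B
  proof (rule Bochner_Integration.integrable_bound[of _ "\<lambda>q. B * g q"])
    show "AE q in lborel. norm (f q * g q) \<le> norm (B * g q)"
      by (intro AE_I2) (simp add: abs_mult mult_right_mono order_trans[OF that(2) abs_ge_self])
    show "(\<lambda>q. f q * g q) \<in> borel_measurable lborel" using that(1) by measurable
  qed (use g in auto)
  define P where "P = (\<lambda>f. f \<in> borel_measurable borel \<and> (\<exists>B. \<forall>x. \<bar>f x\<bar> \<le> B) \<and> (LINT q|lborel. f q * g q) = 0)"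
  have "P (\<lambda>x. sgn (g x))"
  proof (rule functional_monotone_class[OF E, where B=1])
    fix A :: "(real \<times> real) set"
    assume A: "A \<in> insert UNIV {{a<..<b} \<times> {c<..<d} |a b c d. a \<in> \<rat> \<and> b \<in> \<rat> \<and> c \<in> \<rat> \<and> d \<in> \<rat>}"
    then have "A \<in> sets borel" by (auto intro!: borel_open open_Times)
    moreover have "(LINT q|lborel. indicator A q * g q) = 0"
      using A univ box by auto
    ultimately show "P (indicator A)" unfolding P_def by (auto intro!: exI[of _ 1] simp: indicator_def)
  next
    fix f h a b assume "P f" "P h"
    then obtain B1 B2 where fh: "f \<in> borel_measurable borel" "h \<in> borel_measurable borel" "\<And>x. \<bar>f x\<bar> \<le> B1" "\<And>x. \<bar>h x\<bar> \<le> B2"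
       "(LINT q|lborel. f q * g q) = 0" "(LINT q|lborel. h q * g q) = 0"
      by (auto simp: P_def)
    have "(LINT q|lborel. (a * f q + b * h q) * g q) = (LINT q|lborel. a * (f q * g q) + b * (h q * g q))"
      by (simp add: algebra_simps)
    also have "\<dots> = 0" using int[OF fh(1,3)] int[OF fh(2,4)] fh(5,6) by simp
    finally have "(LINT q|lborel. (a * f q + b * h q) * g q) = 0" .
    moreover have "\<bar>a * f x + b * h x\<bar> \<le> \<bar>a\<bar> * B1 + \<bar>b\<bar> * B2" for x
      using fh(3,4)[of x] by (intro order_trans[OF abs_triangle_ineq] add_mono) (auto simp: abs_mult mult_left_mono)
    ultimately show "P (\<lambda>x. a * f x + b * h x)"
      unfolding P_def using fh(1,2) by auto
  next
    fix f :: "nat \<Rightarrow> real \<times> real \<Rightarrow> real" and h B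
    assume f: "\<And>j. P (f j)" and h: "h \<in> borel_measurable borel" and fB: "\<And>j x. \<bar>f j x\<bar> \<le> B" and lim: "\<And>x. (\<lambda>j. f j x) \<longlonglongrightarrow> h x"
    have fm: "f j \<in> borel_measurable borel" for j using f by (simp add: P_def)
    have "(\<lambda>j. LINT q|lborel. f j q * g q) \<longlonglongrightarrow> (LINT q|lborel. h q * g q)"
    proof (rule integral_dominated_convergence[where w="\<lambda>q. B * \<bar>g q\<bar>"])
      show "AE q in lborel. (\<lambda>j. f j q * g q) \<longlonglongrightarrow> h q * g q"
        by (intro AE_I2 tendsto_intros lim)
      show "AE q in lborel. norm (f j q * g q) \<le> B * \<bar>g q\<bar>" for j
        using fB by (intro AE_I2) (auto simp: abs_mult intro!: mult_right_mono)
    qed (use fm h g in auto)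
    then have "(LINT q|lborel. h q * g q) = 0"
      using f by (simp add: P_def LIMSEQ_const_iff)
    moreover have "\<bar>h x\<bar> \<le> B" for x
      using fB lim by (intro LIMSEQ_le_const2[OF tendsto_rabs[OF lim]]) auto
    ultimately show "P h" unfolding P_def using h by blast
  next
    show "(\<lambda>x. sgn (g x)) \<in> borel_measurable borel" by measurable
    show "\<bar>sgn (g x)\<bar> \<le> 1" for x by (simp add: sgn_if)
  qed simp
  then have "(LINT q|lborel. \<bar>g q\<bar>) = 0"
    by (simp add: P_def abs_sgn[symmetric] mult.commute)
  then show ?thesis
    using integral_nonneg_eq_0_iff_AE[of lborel "\<lambda>q. \<bar>g q\<bar>"] g by auto
qed

section \<open>Smooth approximations of indicator functions\<close>

definition smooth1 :: "(real \<times> real \<Rightarrow> real) \<Rightarrow> bool" where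
  "smooth1 f \<longleftrightarrow> (\<exists>p q. continuous_on UNIV f \<and> continuous_on UNIV p \<and> continuous_on UNIV q \<and>
     (\<forall>x y. ((\<lambda>t. f (t, y)) has_real_derivative p (x, y)) (at x)) \<and>
     (\<forall>x y. ((\<lambda>t. f (x, t)) has_real_derivative q (x, y)) (at y)))"

lemma smooth1_mult:
  assumes "smooth1 f" "smooth1 g" shows "smooth1 (\<lambda>z. f z * g z)"
proof -
  obtain p q where f: "continuous_on UNIV f" "continuous_on UNIV p" "continuous_on UNIV q"
     "\<And>x y. ((\<lambda>t. f (t, y)) has_real_derivative p (x, y)) (at x)" "\<And>x y. ((\<lambda>t. f (x, t)) has_real_derivative q (x, y)) (at y)"
    using assms(1) unfolding smooth1_def by blast
  obtain p' q' where g: "continuous_on UNIV g" "continuous_on UNIV p'" "continuous_on UNIV q'"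
     "\<And>x y. ((\<lambda>t. g (t, y)) has_real_derivative p' (x, y)) (at x)" "\<And>x y. ((\<lambda>t. g (x, t)) has_real_derivative q' (x, y)) (at y)"
    using assms(2) unfolding smooth1_def by blast
  show ?thesis unfolding smooth1_def
    by (rule exI[of _ "\<lambda>z. p z * g z + p' z * f z"], rule exI[of _ "\<lambda>z. q z * g z + q' z * f z"])
      (use f g in \<open>auto intro!: continuous_intros DERIV_mult\<close>)
qed

lemma smooth1_one_minus:
  assumes "smooth1 f" shows "smooth1 (\<lambda>z. 1 - f z)"
proof -
  obtain p q where f: "continuous_on UNIV f" "continuous_on UNIV p" "continuous_on UNIV q"
     "\<And>x y. ((\<lambda>t. f (t, y)) has_real_derivative p (x, y)) (at x)" "\<And>x y. ((\<lambda>t. f (x, t)) has_real_derivative q (x, y)) (at y)"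
    using assms(1) unfolding smooth1_def by blast
  show ?thesis unfolding smooth1_def
    by (rule exI[of _ "\<lambda>z. 0 - p z"], rule exI[of _ "\<lambda>z. 0 - q z"])
      (use f in \<open>auto intro!: continuous_intros DERIV_diff DERIV_const simp del: diff_0\<close>)
qed

lemma smooth1_affine:
  assumes h: "\<And>t. (h has_real_derivative h' t) (at t)" and h': "continuous_on UNIV h'"
  shows "smooth1 (\<lambda>z. h (a * fst z + b * snd z + c))"
proof -
  have ch: "continuous_on UNIV h" using h by (auto simp: continuous_on_eq_continuous_at intro: DERIV_isCont)
  show ?thesis unfolding smooth1_def
  proof (intro exI conjI allI)
    show "((\<lambda>t. h (a * fst (t, y) + b * snd (t, y) + c)) has_real_derivative (\<lambda>z. h' (a * fst z + b * snd z + c) * a) (x, y)) (at x)" for x y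
      by (auto intro!: DERIV_chain2[OF h] derivative_eq_intros)
    show "((\<lambda>t. h (a * fst (x, t) + b * snd (x, t) + c)) has_real_derivative (\<lambda>z. h' (a * fst z + b * snd z + c) * b) (x, y)) (at y)" for x y
      by (auto intro!: DERIV_chain2[OF h] derivative_eq_intros)
  qed (auto intro!: continuous_intros continuous_on_compose2[OF ch] continuous_on_compose2[OF h'])
qed

text \<open>Derivatives that are continuous on the whole plane serve as their own extension to the
  boundary, so these functions are admissible right-hand sides in
  \<open>solution_kernel\<close>.\<close>

lemma smooth1_C1_upto:
  assumes "smooth1 f" shows "C1_upto D S f"
proof -
  obtain p q where f: "continuous_on UNIV f" "continuous_on UNIV p" "continuous_on UNIV q"
     "\<And>x y. ((\<lambda>t. f (t, y)) has_real_derivative p (x, y)) (at x)" "\<And>x y. ((\<lambda>t. f (x, t)) has_real_derivative q (x, y)) (at y)"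
    using assms(1) unfolding smooth1_def by blast
  have eq: "ddx f = p" "ddy f = q"
    using f(4,5) by (auto simp: ddx_def ddy_def fun_eq_iff intro!: DERIV_imp_deriv)
  have m: "m = 0 \<or> m = 1" if "m \<le> 1" for m :: nat using that by auto
  have "continuous_on A ((ddx ^^ m) f)" "continuous_on A ((ddy ^^ m) f)" if "m \<le> 1" for m A
    using m[OF that] f(1-3) eq by (auto intro: continuous_on_subset)
  moreover have "(\<lambda>t. f (t, y)) differentiable (at x)" "(\<lambda>t. f (x, t)) differentiable (at y)" for x y
    using f(4,5) real_differentiable_def by blast+
  ultimately have "C_class 1 1 D f"
    unfolding C_class_def by auto
  then show ?thesis unfolding C1_upto_def eq
    using f(1-3) by (auto intro: continuous_on_subset)
qed

text \<open>A C^1 approximation from below of the indicator of t > 0. Squaring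
  \<open>max 0 t\<close> removes the kink, and the value is exactly 0 for \<open>t \<le> 0\<close>,
  as causality demands of the test functions.\<close>

definition step :: "nat \<Rightarrow> real \<Rightarrow> real" where
  "step j t = 1 - 1 / (1 + real j * (max 0 t)\<^sup>2)"

lemma step_nonpos: "t \<le> 0 \<Longrightarrow> step j t = 0"
  by (simp add: step_def)

lemma step_bounds: "0 \<le> step j t" "step j t \<le> 1"
proof -
  have "1 \<le> 1 + real j * (max 0 t)\<^sup>2" by simp
  then show "0 \<le> step j t" "step j t \<le> 1" by (auto simp: step_def divide_le_eq_1)
qed

lemma step_tendsto: "(\<lambda>j. step j t) \<longlonglongrightarrow> (if 0 < t then 1 else 0)"
proof (cases "0 < t")
  case True
  then have "filterlim (\<lambda>j. t\<^sup>2 * real j) at_top sequentially"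
    by (intro filterlim_tendsto_pos_mult_at_top[OF tendsto_const]) (auto simp: filterlim_real_sequentially)
  then have "filterlim (\<lambda>j. 1 + t\<^sup>2 * real j) at_top sequentially"
    by (rule filterlim_tendsto_add_at_top[OF tendsto_const])
  then have "(\<lambda>j. 1 - 1 / (1 + t\<^sup>2 * real j)) \<longlonglongrightarrow> 1 - 0"
    by (intro tendsto_diff tendsto_const tendsto_divide_0[OF tendsto_const] filterlim_at_top_imp_at_infinity)
  then show ?thesis using True by (simp add: step_def mult.commute)
qed (simp add: step_nonpos)

lemma step_DERIV: "(step j has_real_derivative (2 * real j * max 0 t) / (1 + real j * (max 0 t)\<^sup>2)\<^sup>2) (at t)"
proof -
  have sq: "((\<lambda>t. (max 0 t)\<^sup>2) has_real_derivative 2 * max 0 t) (at t)"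
  proof -
    have "((\<lambda>t. if t \<in> {..0} then 0 else t\<^sup>2) has_vector_derivative (if t \<in> {..0} then 0 else 2 * t)) (at t within UNIV)"
    proof (rule has_vector_derivative_If_within_closures[where T="{0..}"])
      have "((\<lambda>t. t\<^sup>2) has_real_derivative 2 * t) (at t within A)" for A
        by (auto intro!: derivative_eq_intros)
      then show "((\<lambda>t. t\<^sup>2) has_vector_derivative 2 * t) (at t within A)" for A
        by (simp only: has_real_derivative_iff_has_vector_derivative)
    qed auto
    moreover have "(\<lambda>t. (max 0 t)\<^sup>2) = (\<lambda>t::real. if t \<in> {..0} then 0 else t\<^sup>2)" by (auto simp: max_def fun_eq_iff)
    moreover have "2 * max 0 t = (if t \<in> {..0} then 0 else 2 * t)" by auto
    ultimately show ?thesis by (simp only: has_real_derivative_iff_has_vector_derivative)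
  qed
  have pos: "1 + real j * (max 0 t)\<^sup>2 \<noteq> 0"
    by (metis add_pos_nonneg less_irrefl mult_nonneg_nonneg of_nat_0_le_iff zero_le_power2 zero_less_one)
  have "((\<lambda>t. 1 + real j * (max 0 t)\<^sup>2) has_real_derivative 0 + real j * (2 * max 0 t)) (at t)"
    by (intro DERIV_add DERIV_const DERIV_cmult sq)
  from DERIV_diff[OF DERIV_const DERIV_inverse_fun[OF this pos], of 1] show ?thesis
    unfolding step_def by (simp add: inverse_eq_divide power2_eq_square mult_ac)
qed

lemma smooth1_step: "smooth1 (\<lambda>z. step j (a * fst z + b * snd z + c))"
proof (rule smooth1_affine[OF step_DERIV])
  have "1 + real j * (max 0 t)\<^sup>2 \<noteq> 0" for t
    by (metis add_pos_nonneg less_irrefl mult_nonneg_nonneg of_nat_0_le_iff zero_le_power2 zero_less_one)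
  then show "continuous_on UNIV (\<lambda>t. (2 * real j * max 0 t) / (1 + real j * (max 0 t)\<^sup>2)\<^sup>2)"
    by (intro continuous_intros) auto
qed

text \<open>\<open>1 - (1 - a) (1 - b)\<close> is a smooth version of the union of \<open>{x > s}\<close> and \<open>{x - y > s}\<close>,
  which together make up the set where the non-smooth function \<^const>\<open>clock\<close> exceeds \<open>s\<close>.\<close>

definition late :: "nat \<Rightarrow> real \<Rightarrow> real \<times> real \<Rightarrow> real" where
  "late j s z = 1 - (1 - step j (1 * fst z + 0 * snd z + - s)) * (1 - step j (1 * fst z + (-1) * snd z + - s))"

text \<open>A smooth version of the indicator of a box as a product over four half-planes.
  Coefficients such as \<open>0\<close> and \<open>1\<close> are written out so that each factor has
  the form in \<open>smooth1_step\<close>.\<close>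

definition bump :: "nat \<Rightarrow> real \<Rightarrow> real \<Rightarrow> real \<Rightarrow> real \<Rightarrow> real \<times> real \<Rightarrow> real" where
  "bump j a b c d z = (step j (1 * fst z + 0 * snd z + - a) * step j ((-1) * fst z + 0 * snd z + b)) *
     (step j (0 * fst z + 1 * snd z + - c) * step j (0 * fst z + (-1) * snd z + d))"

lemma smooth1_late: "smooth1 (late j s)"
  unfolding late_def by (intro smooth1_one_minus smooth1_mult smooth1_step)

lemma smooth1_bump: "smooth1 (bump j a b c d)"
  unfolding bump_def by (intro smooth1_mult smooth1_step)

lemma late_early: "clock z \<le> s \<Longrightarrow> late j s z = 0"
  by (simp add: late_def clock_def step_nonpos)

lemma late_bounds: "0 \<le> late j s z" "late j s z \<le> 1"
  unfolding late_def using step_bounds by (simp_all add: mult_le_one)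

lemma bump_bounds: "0 \<le> bump j a b c d z" "bump j a b c d z \<le> 1"
  unfolding bump_def using step_bounds by (simp_all add: mult_le_one)

lemma late_tendsto: "(\<lambda>j. late j s z) \<longlonglongrightarrow> indicator {z. s < clock z} z"
proof -
  have "(\<lambda>j. late j s z) \<longlonglongrightarrow> 1 - (1 - (if 0 < 1 * fst z + 0 * snd z + - s then 1 else 0)) * (1 - (if 0 < 1 * fst z + (-1) * snd z + - s then 1 else 0))"
    unfolding late_def by (intro tendsto_intros step_tendsto)
  moreover have "1 - (1 - (if 0 < 1 * fst z + 0 * snd z + - s then 1 else 0)) * (1 - (if 0 < 1 * fst z + (-1) * snd z + - s then 1 else 0)) = (indicator {z. s < clock z} z :: real)"
    by (auto simp: indicator_def clock_def max_def)
  ultimately show ?thesis by simp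
qed

lemma bump_tendsto: "(\<lambda>j. bump j a b c d z) \<longlonglongrightarrow> indicator ({a<..<b} \<times> {c<..<d}) z"
proof -
  have "(\<lambda>j. bump j a b c d z) \<longlonglongrightarrow> ((if 0 < 1 * fst z + 0 * snd z + - a then 1 else 0) * (if 0 < (-1) * fst z + 0 * snd z + b then 1 else 0)) *
     ((if 0 < 0 * fst z + 1 * snd z + - c then 1 else 0) * (if 0 < 0 * fst z + (-1) * snd z + d then 1 else 0))"
    unfolding bump_def by (intro tendsto_intros step_tendsto)
  moreover have "((if 0 < 1 * fst z + 0 * snd z + - a then 1 else 0) * (if 0 < (-1) * fst z + 0 * snd z + b then 1 else 0)) *
     ((if 0 < 0 * fst z + 1 * snd z + - c then 1 else 0) * (if 0 < 0 * fst z + (-1) * snd z + d then 1 else 0)) = (indicator ({a<..<b} \<times> {c<..<d}) z :: real)"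
    by (cases z) (auto simp: indicator_def)
  ultimately show ?thesis by simp
qed

text \<open>A level set lies in the union of the lines \<open>x = c\<close> and
  \<open>x - y = c\<close>.\<close>

lemma AE_clock_neq: "AE q in lborel. clock q \<noteq> c"
proof -
  have neg: "negligible {z::real \<times> real. (1, 0) \<bullet> z = c}" "negligible {z::real \<times> real. (1, -1) \<bullet> z = c}"
    by (intro negligible_hyperplane; simp add: zero_prod_def)+
  have "{z. clock z = c} \<subseteq> {z. (1, 0) \<bullet> z = c} \<union> {z. (1, -1) \<bullet> z = c}"
    by (auto simp: clock_def max_def inner_prod_def)
  then have "negligible {z. clock z = c}"
    using negligible_Un[OF neg] negligible_subset by blast
  then have "AE q in lebesgue. q \<notin> {z. clock z = c}"
    by (intro AE_not_in) (simp add: negligible_iff_null_sets)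
  then show ?thesis by (simp add: AE_completion_iff)
qed

text \<open>For each test function the kernel represents the solution only outside a null set of
  points \<open>p\<close>. Rational \<open>s\<close>, rational boxes and integers \<open>j\<close>
  leave countably many such sets; for all other \<open>p\<close> the integrals force the row of
  \<open>k\<close> to vanish almost everywhere on \<open>{z. s < clock z}\<close> whenever
  \<open>clock p < s\<close>.\<close>

theorem (in curved_domain) solution_kernel_causal:
  assumes K: "solution_kernel l \<gamma> \<alpha> \<beta> Q K" and Q: "C1_upto ({0<..<1} \<times> {0<..<1}) ({0..1} \<times> {0..1}) Q"
    and k: "hs_kernel (Omega l \<gamma>) K k"
  shows "AE (p, q) in lborel. clock p < clock q \<longrightarrow> k (p, q) = 0"
proof -
  interpret hs_kernel "Omega l \<gamma>" K k by (rule k)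
  have solve: "\<exists>u. regular_solution l \<gamma> \<alpha> \<beta> Q f u \<and>
           (\<forall>v. regular_solution l \<gamma> \<alpha> \<beta> Q f v \<longrightarrow> (\<forall>z\<in>closure (Omega l \<gamma>). v z = u z)) \<and>
           (AE z in lebesgue_on (Omega l \<gamma>). u z = kernel_operator (Omega l \<gamma>) K f z)"
    if "C1_upto (Omega l \<gamma>) (closure (Omega l \<gamma>)) f" for f
    using K that unfolding solution_kernel_def by blast
  \<comment> \<open>The existence of \<open>K\<close> includes unique solvability for the right-hand
    side 0.\<close>
  have mono: "mono_on {0..l} (\<lambda>x. x - \<gamma> x)"
  proof (rule unique_imp_mono[of \<alpha> \<beta> Q])
    fix u v assume "regular_solution l \<gamma> \<alpha> \<beta> Q (\<lambda>_. 0) u" "regular_solution l \<gamma> \<alpha> \<beta> Q (\<lambda>_. 0) v"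
    moreover have "smooth1 (\<lambda>_. 0)"
      unfolding smooth1_def by (intro exI[of _ "\<lambda>_. 0"]) auto
    ultimately show "\<forall>z\<in>closure (Omega l \<gamma>). u z = v z"
      using solve[OF smooth1_C1_upto, of "\<lambda>_. 0"] by metis
  qed
  have test: "AE p in lborel. clock p < s \<longrightarrow> (LINT q|lborel. f q * k (p, q)) = 0"
    if f: "smooth1 f" and early: "\<And>z. clock z \<le> s \<Longrightarrow> f z = 0" for f s
  proof -
    obtain u where u: "regular_solution l \<gamma> \<alpha> \<beta> Q f u"
      "AE z in lebesgue_on (Omega l \<gamma>). u z = kernel_operator (Omega l \<gamma>) K f z"
      using solve[OF smooth1_C1_upto[OF f]] by blast
    have u0: "u z = 0" if z: "z \<in> Omega l \<gamma>" "clock z < s" for z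
    proof (rule causality[OF _ mono Q u(1) _ z(1)])
      \<comment> \<open>\<open>causality\<close> is stated for levels up to 1; on Omega the clock
        stays below 1, so taking the minimum loses nothing.\<close>
      show "clock z < min s 1" using z clock_less_1[OF z(1)] by simp
    qed (use early in auto)
    have fm: "f \<in> borel_measurable borel"
      using f by (auto simp: smooth1_def intro: borel_measurable_continuous_onI)
    define f' where "f' = (\<lambda>z. indicator (Omega l \<gamma>) z * f z)"
    have "represents (Omega l \<gamma>) f f'"
      using fm D by (auto simp: represents_def f'_def)
    from represents_S[OF this] have "AE p in lborel. p \<in> Omega l \<gamma> \<longrightarrow> kernel_operator (Omega l \<gamma>) K f p = S f' p"
      by (simp add: represents_def)
    moreover have "AE p in lborel. p \<in> Omega l \<gamma> \<longrightarrow> u p = kernel_operator (Omega l \<gamma>) K f p"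
      using u(2) D by (simp add: AE_lebesgue_on_iff)
    ultimately have "AE p in lborel. p \<in> Omega l \<gamma> \<longrightarrow> u p = S f' p" by (auto elim: AE_mp)
    then show ?thesis
    proof (rule AE_mp, intro AE_I2 impI)
      fix p assume p: "p \<in> Omega l \<gamma> \<longrightarrow> u p = S f' p" "clock p < s"
      have "S f' p = 0" using p u0[of p] S_outside[of p f'] by (cases "p \<in> Omega l \<gamma>") auto
      moreover have "S f' p = (LINT q|lborel. f q * k (p, q))"
        unfolding S_def f'_def by (intro Bochner_Integration.integral_cong) (auto simp: indicator_def k_zero)
      ultimately show "(LINT q|lborel. f q * k (p, q)) = 0" by simp
    qed
  qed
  \<comment> \<open>Square integrability implies integrability because Omega has finite
    measure.\<close>
  have ksec: "integrable lborel (\<lambda>q. k (p, q))" if p: "row p < \<infinity>" for p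
  proof -
    have "(\<integral>\<^sup>+q. ennreal ((indicator (Omega l \<gamma>) q)\<^sup>2) \<partial>lborel) = (\<integral>\<^sup>+q. indicator (Omega l \<gamma>) q \<partial>lborel)"
      by (intro nn_integral_cong) (auto simp: indicator_def)
    also have "\<dots> < \<infinity>" using D finD by simp
    finally have "integrable lborel (\<lambda>q. k (p, q) * indicator (Omega l \<gamma>) q)"
      using p D unfolding row_def by (intro integrable_mult_square) auto
    moreover have "k (p, q) * indicator (Omega l \<gamma>) q = k (p, q)" for q
      using k_zero[of p q] by (auto simp: indicator_def)
    ultimately show ?thesis by simp
  qed
  \<comment> \<open>Passage from smooth test functions to indicators, dominated by the absolute
    value of the row, since all factors lie between 0 and 1. The functions \<open>g j\<close> will
    be bumps for the boxes and the constant 1 for the whole plane.\<close>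
  have late_int: "(LINT q|lborel. h q * (indicator {z. s < clock z} q * k (p, q))) = 0"
    if p: "row p < \<infinity>" and h: "h \<in> borel_measurable borel"
      and g: "\<And>j. (LINT q|lborel. (g j q * late j s q) * k (p, q)) = 0"
      and gm: "\<And>j. g j \<in> borel_measurable borel" and gB: "\<And>j q. 0 \<le> g j q \<and> g j q \<le> 1" and lim: "\<And>q. (\<lambda>j. g j q) \<longlonglongrightarrow> h q"
    for h g p s
  proof -
    have "(\<lambda>j. LINT q|lborel. (g j q * late j s q) * k (p, q)) \<longlonglongrightarrow> (LINT q|lborel. h q * (indicator {z. s < clock z} q * k (p, q)))"
    proof (rule integral_dominated_convergence[where w="\<lambda>q. \<bar>k (p, q)\<bar>"])
      have "{z. s < clock z} \<in> sets borel"
        by (intro borel_open open_Collect_less continuous_intros continuous_clock)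
      then show "(\<lambda>q. h q * (indicator {z. s < clock z} q * k (p, q))) \<in> borel_measurable lborel"
        using h by simp
      have "late j s \<in> borel_measurable borel" for j
        using smooth1_late by (auto simp: smooth1_def intro: borel_measurable_continuous_onI)
      then show "(\<lambda>q. (g j q * late j s q) * k (p, q)) \<in> borel_measurable lborel" for j using gm by simp
      show "AE q in lborel. (\<lambda>j. (g j q * late j s q) * k (p, q)) \<longlonglongrightarrow> h q * (indicator {z. s < clock z} q * k (p, q))"
        unfolding mult.assoc[symmetric] by (intro AE_I2 tendsto_intros lim late_tendsto)
      show "AE q in lborel. norm ((g j q * late j s q) * k (p, q)) \<le> \<bar>k (p, q)\<bar>" for j
      proof (intro AE_I2)
        fix q
        have "\<bar>g j q * late j s q\<bar> \<le> 1"
          using gB[of j q] late_bounds[of j s q] by (simp add: abs_mult mult_le_one)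
        then show "norm ((g j q * late j s q) * k (p, q)) \<le> \<bar>k (p, q)\<bar>"
          by (simp add: abs_mult mult_left_le_one_le)
      qed
    qed (use ksec[OF p] in simp)
    then show ?thesis unfolding g by (simp add: LIMSEQ_const_iff)
  qed
  have bump_AE: "AE p in lborel. \<forall>j. clock p < s \<longrightarrow> (LINT q|lborel. (bump j a b c d q * late j s q) * k (p, q)) = 0" for s a b c d
    unfolding AE_all_countable by (intro allI test smooth1_mult smooth1_bump smooth1_late) (simp add: late_early)
  have one_AE: "AE p in lborel. \<forall>j. clock p < s \<longrightarrow> (LINT q|lborel. (1 * late j s q) * k (p, q)) = 0" for s
    unfolding AE_all_countable mult_1 by (intro allI test smooth1_late) (simp add: late_early)
  have "AE p in lborel. \<forall>s\<in>\<rat>. \<forall>a\<in>\<rat>. \<forall>b\<in>\<rat>. \<forall>c\<in>\<rat>. \<forall>d\<in>\<rat>. \<forall>j. clock p < s \<longrightarrow> (LINT q|lborel. (bump j a b c d q * late j s q) * k (p, q)) = 0"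
    by (intro AE_ball_countable[THEN iffD2] countable_rat ballI bump_AE)
  moreover have "AE p in lborel. \<forall>s\<in>\<rat>. \<forall>j. clock p < s \<longrightarrow> (LINT q|lborel. (1 * late j s q) * k (p, q)) = 0"
    by (intro AE_ball_countable[THEN iffD2] countable_rat ballI one_AE)
  ultimately have "AE p in lborel. AE q in lborel. clock p < clock q \<longrightarrow> k (p, q) = 0"
    using row_AE
  proof (eventually_elim)
    case (elim p)
    have "AE q in lborel. indicator {z. s < clock z} q * k (p, q) = 0" if s: "s \<in> \<rat>" "clock p < s" for s
    proof (rule AE_zero_of_box_integrals)
      have open_s: "{z. s < clock z} \<in> sets borel"
        by (intro borel_open open_Collect_less continuous_intros continuous_clock)
      show "integrable lborel (\<lambda>q. indicator {z. s < clock z} q * k (p, q))"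
        using integrable_mult_indicator[of "{z. s < clock z}" lborel "\<lambda>q. k (p, q)"] ksec[OF elim(3)] open_s by simp
      show "(LINT q|lborel. indicator ({a<..<b} \<times> {c<..<d}) q * (indicator {z. s < clock z} q * k (p, q))) = 0"
        if "a \<in> \<rat>" "b \<in> \<rat>" "c \<in> \<rat>" "d \<in> \<rat>" for a b c d
      proof (rule late_int[OF elim(3), where g="\<lambda>j. bump j a b c d"])
        show "indicator ({a<..<b} \<times> {c<..<d}) \<in> borel_measurable borel"
          by (intro borel_measurable_indicator borel_open open_Times) auto
        show "bump j a b c d \<in> borel_measurable borel" for j
          using smooth1_bump by (auto simp: smooth1_def intro: borel_measurable_continuous_onI)
      qed (use elim(1) that s bump_bounds bump_tendsto in auto)
      show "(LINT q|lborel. indicator {z. s < clock z} q * k (p, q)) = 0"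
        using late_int[OF elim(3), of "\<lambda>_. 1" "\<lambda>_ _. 1" s] elim(2) s by auto
    qed
    then have "AE q in lborel. \<forall>s\<in>\<rat>. clock p < s \<longrightarrow> indicator {z. s < clock z} q * k (p, q) = 0"
      by (intro AE_ball_countable[THEN iffD2] countable_rat ballI) (auto elim: AE_mp)
    then show ?case
    proof (rule AE_mp, intro AE_I2 impI)
      fix q assume q: "\<forall>s\<in>\<rat>. clock p < s \<longrightarrow> indicator {z. s < clock z} q * k (p, q) = 0" and less: "clock p < clock q"
      obtain s where "s \<in> \<rat>" "clock p < s" "s < clock q" using Rats_dense_in_real[OF less] by blast
      then show "k (p, q) = 0" using q by auto
    qed
  qed
  \<comment> \<open>Measurability of this set allows a statement about almost every section to be
    turned into one about the product measure.\<close>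
  moreover have "{z \<in> space (lborel \<Otimes>\<^sub>M lborel). clock (fst z) < clock (snd z) \<longrightarrow> k z = 0} \<in> sets (lborel \<Otimes>\<^sub>M lborel)"
  proof -
    have "open {z. clock (fst z) < clock (snd z)}"
      by (intro open_Collect_less continuous_on_compose2[OF continuous_clock] continuous_intros) auto
    moreover have "{z. k z = 0} \<in> sets borel" using borel_measurable_vimage[OF k_meas, of 0] by (simp add: vimage_def)
    ultimately have "- {z. clock (fst z) < clock (snd z)} \<union> {z. k z = 0} \<in> sets borel" by auto
    moreover have "{z \<in> space (lborel \<Otimes>\<^sub>M lborel). clock (fst z) < clock (snd z) \<longrightarrow> k z = 0} = - {z. clock (fst z) < clock (snd z)} \<union> {z. k z = 0}"
      by (auto simp: space_pair_measure)
    ultimately show ?thesis unfolding lborel_prod by simp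
  qed
  ultimately have "AE z in lborel \<Otimes>\<^sub>M lborel. clock (fst z) < clock (snd z) \<longrightarrow> k z = 0"
    by (intro lborel_pair.AE_pair_measure) auto
  then show ?thesis by (subst (asm) lborel_prod) (simp add: case_prod_beta)
qed

theorem theorem3:
  fixes l \<alpha> \<beta> :: real
    and \<gamma> :: "real \<Rightarrow> real"
    and Q :: "real \<times> real \<Rightarrow> real"
    and K :: "(real \<times> real) \<times> (real \<times> real) \<Rightarrow> real"
  assumes "admissible_curve l \<gamma>"
    and "\<alpha>\<^sup>2 + \<beta>\<^sup>2 > 0"
    and "C1_upto ({0<..<1} \<times> {0<..<1}) ({0..1} \<times> {0..1}) Q"
    and "solution_kernel l \<gamma> \<alpha> \<beta> Q K"
  shows "L2_volterra (lebesgue_on (Omega l \<gamma>)) (kernel_operator (Omega l \<gamma>) K)"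
proof -
  interpret curved_domain l \<gamma> by unfold_locales (rule assms(1))
  \<comment> \<open>Omega is given as two open pieces joined by a segment; this presentation already
    shows that it is Borel.\<close>
  have "open (Omega0 \<union> Omega1 l \<gamma>)" by (intro open_Un open_Omega0 open_Omega1)
  moreover have "segment_AB = {0<..<1} \<times> {0}" by (auto simp: segment_AB_def)
  ultimately have D: "Omega l \<gamma> \<in> sets borel"
    using borel_Times[of "{0<..<1::real}" "{0::real}"] unfolding Omega_def
    by (metis (no_types) borel_open open_Omega0 open_Omega1 sets.Un borel_singleton open_greaterThanLessThan sets.empty_sets)
  have "Omega l \<gamma> \<subseteq> cbox (0, -1) (1, 1)"
  proof
    fix z assume "z \<in> Omega l \<gamma>"
    then show "z \<in> cbox (0, -1) (1, 1)"
      using add_depth_le[of "fst z"]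
      by (cases z) (auto simp: Omega_def Omega0_def segment_AB_def Omega1_iff cbox_Pair_eq)
  qed
  then have "emeasure lborel (Omega l \<gamma>) \<le> emeasure lborel (cbox (0, -1) (1, 1) :: (real \<times> real) set)"
    by (intro emeasure_mono) auto
  also have "\<dots> < \<infinity>" by (simp add: emeasure_lborel_cbox_eq)
  finally have fin: "emeasure lborel (Omega l \<gamma>) < \<infinity>" .
  obtain k where k: "hs_kernel (Omega l \<gamma>) K k"
    using hs_kernel_exists[OF D fin] assms(4) unfolding solution_kernel_def by blast
  interpret hs_kernel "Omega l \<gamma>" K k by (rule k)
  have "clock \<in> borel_measurable borel"
    by (intro borel_measurable_continuous_onI continuous_clock)
  moreover have "0 \<le> clock z \<and> clock z \<le> 1" if "z \<in> Omega l \<gamma>" for z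
    using clock_less_1[OF that] that
    by (cases z) (auto simp: clock_def Omega_def Omega0_def segment_AB_def Omega1_iff)
  ultimately have "L2_quasinilpotent (lebesgue_on (Omega l \<gamma>)) (kernel_operator (Omega l \<gamma>) K)"
    using quasinilpotent solution_kernel_causal[OF assms(4,3) k] AE_clock_neq by blast
  then show ?thesis
    using L2_compact_kernel_operator by (simp add: L2_volterra_def)
qed

end
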